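(* Let $Z=\{z_k\}_{k=0}^\infty$ be a sequence of distinct points in the open unit disk $\mathbb{D}$ satisfying the Blaschke condition $\sum_{k=0}^\infty(1-|z_k|)<\infty$, and let $$B(z)=\prod_{k=0}^\infty \frac{z_k-z}{1-z\overline{z_k}}\,\frac{|z_k|}{z_k}$$ be the corresponding Blaschke product. Then the Nevanlinna--Pick problem $f(z_k)=0$, $k=0,1,2,\ldots$, in the Schur class is regular, i.e. $\lambda_0(K)>0$, if and only if the measure $\nu$ on $\mathbb{D}$, concentrated on $Z$ and defined by $$\nu(\{z_k\})=|B'(z_k)|^{-2},\qquad k=0,1,2,\ldots,$$ is a Carleson measure in $\mathbb{D}$.
   Context: The Schur class is the set of analytic functions $f$ on $\mathbb{D}$ with $|f|\le 1$. For the problem $f(z_k)=0$, $k=0,1,2,\ldots$, the associated Nevanlinna--Pick matrices are $$K_n=\left\|\frac{1}{1-z_i\overline{z_j}}\right\|_{i,j=0}^n,\qquad n=0,1,2,\ldots,$$ which are Hermitian and nonnegative. Let $\lambda_{n,0}\ge 0$ be the smallest eigenvalue of $K_n$. By eigenvalue interlacing $\lambda_{n,0}$ is non-increasing in $n$, and one sets $\lambda_0(K)=\lim_{n\to\infty}\lambda_{n,0}$. The problem is called regular if $\lambda_0(K)>0$ and singular if $\lambda_0(K)=0$. A (finite) Borel measure $\nu$ on $\mathbb{D}$ is called a Carleson measure if there is a constant $C>0$ such that $$\int_{\mathbb{D}}|f|^2\,d\nu\le C\int_{\mathbb{T}}|f|^2\,dm\qquad\text{for all } f\in H^2,$$ where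 $H^2$ is the Hardy space of the disk, $dm$ is normalized Lebesgue measure on the unit circle $\mathbb{T}$, and on $\mathbb{T}$ the function $f$ is understood through its boundary values. If some $z_k=0$, the corresponding factor of $B$ is interpreted as $z$ (the unimodular constant is irrelevant, as only $|B'(z_k)|$ is used). *)

theory Defs
  imports "HOL-Analysis.Analysis" "Jordan_Normal_Form.Char_Poly"
begin

definition pick_matrix :: "(nat \<Rightarrow> complex) \<Rightarrow> nat \<Rightarrow> complex mat" where
  "pick_matrix z n = mat (Suc n) (Suc n) (\<lambda>(i, j). 1 / (1 - z i * cnj (z j)))"

(* For nodes in the unit disk the matrix is Hermitian, so all its complex eigenvalues are real
   and the set below is finite and nonempty. *)
definition smallest_eigenvalue :: "complex mat \<Rightarrow> real" where
  "smallest_eigenvalue A = Min {x. eigenvalue A (complex_of_real x)}"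

(* The limit exists, since the smallest eigenvalues are nonnegative and, by interlacing,
   non-increasing in n. *)
definition pick_lambda0 :: "(nat \<Rightarrow> complex) \<Rightarrow> real" where
  "pick_lambda0 z = lim (\<lambda>n. smallest_eigenvalue (pick_matrix z n))"

definition regular_NP_zero_problem :: "(nat \<Rightarrow> complex) \<Rightarrow> bool" where
  "regular_NP_zero_problem z \<longleftrightarrow> pick_lambda0 z > 0"

definition blaschke_factor :: "complex \<Rightarrow> complex \<Rightarrow> complex" where
  "blaschke_factor a w =
     (if a = 0 then w else (a - w) / (1 - w * cnj a) * (complex_of_real (cmod a) / a))"

(* prodinf takes the value 0 at the nodes: the product there has a vanishing factor and the
   remaining factors have a nonzero product. *)
definition blaschke_product :: "(nat \<Rightarrow> complex) \<Rightarrow> complex \<Rightarrow> complex" where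
  "blaschke_product z w = (\<Prod>k. blaschke_factor (z k) w)"

definition unit_disk_borel :: "complex measure" where
  "unit_disk_borel = restrict_space borel (ball 0 1)"

definition circle_measure :: "complex measure" where
  "circle_measure =
     distr (uniform_measure lborel {0..2 * pi}) (restrict_space borel (sphere 0 1)) cis"

definition hardy_H2 :: "(complex \<Rightarrow> complex) set" where
  "hardy_H2 = {f. f holomorphic_on ball 0 1 \<and>
     (SUP r\<in>{0..<1::real}.
        \<integral>\<^sup>+\<zeta>. ennreal ((cmod (f (of_real r * \<zeta>)))\<^sup>2) \<partial>circle_measure) < \<infinity>}"

(* Boundary values are radial limits, which exist almost everywhere on the circle for functions
   in H2 (Fatou). The values of f itself outside the open disk are irrelevant. *)
definition boundary_value :: "(complex \<Rightarrow> complex) \<Rightarrow> complex \<Rightarrow> complex" where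
  "boundary_value f \<zeta> = Lim (at_left (1::real)) (\<lambda>r. f (of_real r * \<zeta>))"

definition Carleson_measure :: "complex measure \<Rightarrow> bool" where
  "Carleson_measure \<nu> \<longleftrightarrow>
     sets \<nu> = sets unit_disk_borel \<and> finite_measure \<nu> \<and>
     (\<exists>C::real. C > 0 \<and> (\<forall>f\<in>hardy_H2.
        (\<integral>\<^sup>+w. ennreal ((cmod (f w))\<^sup>2) \<partial>\<nu>)
          \<le> ennreal C * (\<integral>\<^sup>+\<zeta>. ennreal ((cmod (boundary_value f \<zeta>))\<^sup>2) \<partial>circle_measure)))"

(* The discrete measure on the disk with the prescribed point masses: weights are put on the
   indices and pushed forward along z. *)
definition blaschke_measure :: "(nat \<Rightarrow> complex) \<Rightarrow> complex measure" where
  "blaschke_measure z =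
     distr (point_measure UNIV
              (\<lambda>k. ennreal (1 / (cmod (deriv (blaschke_product z) (z k)))\<^sup>2)))
       unit_disk_borel z"

lemma blaschke_measure_measurable:
  assumes "\<And>k. z k \<in> ball 0 1"
  shows "z \<in> measurable (point_measure UNIV w) unit_disk_borel"
  using assms by (auto simp: point_measure_def unit_disk_borel_def space_restrict_space)

lemma emeasure_blaschke_measure_point:
  assumes "\<And>k. z k \<in> ball 0 1" "inj z"
  shows "emeasure (blaschke_measure z) {z k}
           = ennreal (1 / (cmod (deriv (blaschke_product z) (z k)))\<^sup>2)"
proof -
  have s: "{z k} \<in> sets unit_disk_borel"
    using assms(1)[of k] by (simp add: unit_disk_borel_def sets_restrict_space_iff)
  have "z -` {z k} = {k}" using assms(2) by (auto dest: injD)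
  then show ?thesis
    unfolding blaschke_measure_def
    by (subst emeasure_distr[OF blaschke_measure_measurable[OF assms(1)] s])
       (simp add: space_point_measure emeasure_point_measure_finite2)
qed

lemma emeasure_blaschke_measure_complement:
  assumes "\<And>k. z k \<in> ball 0 1"
  shows "emeasure (blaschke_measure z) (ball 0 1 - range z) = 0"
proof -
  have "range z \<in> sets borel"
    by (rule sets.countable) auto
  then have s: "ball 0 1 - range z \<in> sets unit_disk_borel"
    by (auto simp: unit_disk_borel_def sets_restrict_space_iff)
  have "z -` (ball 0 1 - range z) = {}" by auto
  then show ?thesis
    unfolding blaschke_measure_def
    by (subst emeasure_distr[OF blaschke_measure_measurable[OF assms(1)] s]) simp
qed

end

theory Submission
  imports Defs "HOL-Complex_Analysis.Complex_Analysis" "HOL-Probability.Probability_Measure"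
begin

text \<open>
  Write \<open>K\<close> for the Pick matrix of the first \<open>n + 1\<close> nodes and \<open>\<beta>\<^sub>j\<close> for the derivative at
  \<open>z\<^sub>j\<close> of the Blaschke product of these nodes. For a coefficient vector \<open>c\<close> put
  \<open>f = \<Sum>\<^sub>j c\<^sub>j / (1 - w cnj z\<^sub>j)\<close>; then \<open>K c\<close> is the vector of values of \<open>f\<close> at the nodes, and
  \<open>c\<^sup>* K c\<close> is the squared \<open>H\<^sup>2\<close> norm of \<open>f\<close>.

  The heart of the matter is an identity of Cauchy matrices: with \<open>D = diag(1/\<beta>\<^sub>j)\<close>,
  the transpose of \<open>K\<close> times \<open>D K\<close> is the inverse of the conjugate of \<open>D\<close>
  (\<open>pick_matrix_congruence\<close>, a partial fraction expansion). Consequently the antilinear map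
  \<open>c \<mapsto> cnj (D K c)\<close> is an involution that preserves the form \<open>c\<^sup>* K c\<close>; it is the natural
  conjugation of the model space of the finite Blaschke product, written in kernel coordinates. It
  exchanges \<open>|c|\<^sup>2\<close> with \<open>\<Sum>\<^sub>j |f(z\<^sub>j)|\<^sup>2 / |\<beta>\<^sub>j|\<^sup>2\<close>. Hence the smallest eigenvalue of \<open>K\<close> is at least
  \<open>\<epsilon>\<close> if and only if the measure with masses \<open>|\<beta>\<^sub>j|\<^sup>-\<^sup>2\<close> satisfies the Carleson inequality with
  constant \<open>1/\<epsilon>\<close> on the span of the kernels (\<open>pick_form_bound_iff\<close>). A general element of \<open>H\<^sup>2\<close>
  has the same values at the nodes as some element of the span of no larger norm
  (\<open>interpolant_pick_form_le\<close>), so the inequality then holds on all of \<open>H\<^sup>2\<close>. As \<open>n\<close> grows, the masses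
  \<open>|\<beta>\<^sub>j|\<^sup>-\<^sup>2\<close> increase to \<open>|B'(z\<^sub>j)|\<^sup>-\<^sup>2\<close>, because each new factor has modulus at most one and the Blaschke
  condition makes the partial products converge locally uniformly. So uniformity of \<open>\<epsilon>\<close> in \<open>n\<close>
  is the same as the Carleson property of the limit measure, with constant \<open>1/\<epsilon>\<close>.

  The norm in the Carleson inequality is that of the radial boundary function, so one needs
  Fatou's theorem for \<open>H\<^sup>2\<close>: radial limits exist almost everywhere and their square integral is
  the sum of the squared Taylor coefficients (\<open>radial_limit_AE\<close>, \<open>boundary_norm\<close>). Both follow
  from an \<open>L\<^sup>2\<close> bound for the radial maximal function. For that bound choose a radius \<open>\<rho>(\<zeta>)\<close> at
  each boundary point and let \<open>T\<close> be the corresponding Poisson averaging operator. The semigroup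
  law of the Poisson kernel and the inequality \<open>P\<^sub>r\<^sub>s \<le> 4 (P\<^sub>r + P\<^sub>s)\<close> bound \<open>T T\<^sup>*\<close> by
  \<open>4 (T + T\<^sup>*)\<close>, hence \<open>\<parallel>T\<parallel>\<^sup>2 \<le> 8 \<parallel>T\<parallel>\<close> and \<open>\<parallel>T\<parallel> \<le> 8\<close>, uniformly in the choice of radii.
\<close>

section \<open>Integration on the unit circle\<close>

lemma measurable_cis_circle: "cis \<in> measurable borel (restrict_space borel (sphere 0 1))"
  by (intro measurable_restrict_space2 borel_measurable_continuous_onI continuous_on_cis continuous_intros) auto

lemma circle_interval:
  "emeasure lborel {0..2*pi} = ennreal (2*pi)"
  by simp

lemma space_circle_measure [simp]: "space circle_measure = sphere 0 1"
  by (simp add: circle_measure_def space_restrict_space)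

lemma sets_circle_measure [measurable_cong]: "sets circle_measure = sets (restrict_space borel (sphere 0 1))"
  by (simp add: circle_measure_def)

lemma prob_space_circle_measure: "prob_space circle_measure"
proof -
  have "prob_space (uniform_measure lborel {0..2 * pi})"
  proof
    show "emeasure (uniform_measure lborel {0..2 * pi}) (space (uniform_measure lborel {0..2 * pi})) = 1"
      by (subst emeasure_uniform_measure)
         (auto simp: ennreal_divide_self)
  qed
  then show ?thesis
    unfolding circle_measure_def
    by (rule prob_space.prob_space_distr)
       (use measurable_cis_circle in \<open>simp add: uniform_measure_def\<close>)
qed

interpretation circle: prob_space circle_measure
  by (rule prob_space_circle_measure)

interpretation circle2: pair_sigma_finite circle_measure circle_measure ..

lemma circle_prob_sphere [simp]: "circle.prob (sphere 0 1) = 1"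
  using circle.prob_space by simp

lemma measurable_circle_id [measurable]: "(\<lambda>\<zeta>. \<zeta>) \<in> borel_measurable circle_measure"
  by (simp add: measurable_cong_sets[OF sets_circle_measure refl] measurable_restrict_space1)

lemma measurable_cnj [measurable]: "cnj \<in> borel_measurable borel"
  by (intro borel_measurable_continuous_onI continuous_intros)

lemma circle_integrable_bounded:
  fixes f :: "complex \<Rightarrow> 'b::{banach, second_countable_topology}"
  assumes "f \<in> borel_measurable circle_measure" "\<And>\<zeta>. cmod \<zeta> = 1 \<Longrightarrow> norm (f \<zeta>) \<le> B"
  shows "integrable circle_measure f"
  by (rule circle.integrable_const_bound[of _ B]) (use assms in auto)

text \<open>
  Reduces circle integrals to Lebesgue integrals over a parameter interval, where the fundamental theorem of calculus applies.
\<close>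

lemma circle_integral_eq:
  fixes f :: "complex \<Rightarrow> complex"
  assumes [measurable]: "f \<in> borel_measurable circle_measure"
  shows "integral\<^sup>L circle_measure f
    = (1/(2*pi)) *\<^sub>R (\<integral>t. indicator {0..2*pi} t *\<^sub>R f (cis t) \<partial>lborel)"
proof -
  have m: "f \<in> borel_measurable (restrict_space borel (sphere 0 1))"
    using assms by (simp add: measurable_cong_sets[OF sets_circle_measure refl])
  have u: "uniform_measure lborel {0..2*pi}
      = density lborel (\<lambda>t. ennreal (indicator {0..2*pi} t / (2*pi)))"
    unfolding uniform_measure_def circle_interval
    by (intro arg_cong2[where f=density] refl ext)
       (simp add: divide_ennreal[symmetric] ennreal_indicator split: split_indicator)
  have fc: "(\<lambda>t. f (cis t)) \<in> borel_measurable lborel"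
    using measurable_compose[OF measurable_cis_circle m] by simp
  have "integral\<^sup>L circle_measure f = (\<integral>t. f (cis t) \<partial>uniform_measure lborel {0..2*pi})"
    unfolding circle_measure_def
    by (rule integral_distr) (use measurable_cis_circle m in \<open>simp_all add: uniform_measure_def\<close>)
  also have "\<dots> = (\<integral>t. (indicator {0..2*pi} t / (2*pi)) *\<^sub>R f (cis t) \<partial>lborel)"
    unfolding u by (rule integral_density) (use fc in auto)
  also have "\<dots> = (\<integral>t. (1/(2*pi)) *\<^sub>R (indicator {0..2*pi} t *\<^sub>R f (cis t)) \<partial>lborel)"
    by (simp add: field_simps)
  finally show ?thesis by (simp only: integral_scaleR_right)
qed

lemma circle_integral_power: "(\<integral>\<zeta>. \<zeta> ^ n \<partial>circle_measure) = (if n = 0 then 1 else 0)"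
proof (cases "n = 0")
  case True then show ?thesis using circle.prob_space by simp
next
  case False
  have "(\<integral>t. indicator {0..2*pi} t *\<^sub>R cis t ^ n \<partial>lborel)
      = cis (real n * (2*pi)) / (\<i> * n) - cis (real n * 0) / (\<i> * n)"
  proof (rule integral_FTC_Icc)
    fix t assume "0 \<le> t" "t \<le> 2*pi"
    have d: "((\<lambda>t. cis (real n * t) / (\<i> * n)) has_vector_derivative
          (real n *\<^sub>R (\<i> * cis (real n * t))) / (\<i> * n)) (at t within {0..2*pi})"
      unfolding has_vector_derivative_def
      by (auto intro!: derivative_eq_intros ext simp: scaleR_conv_of_real algebra_simps False)
    have e: "(real n *\<^sub>R (\<i> * cis (real n * t))) / (\<i> * n) = cis (real n * t)"
      using False by (simp add: scaleR_conv_of_real)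
    from d show "((\<lambda>t. cis (real n * t) / (\<i> * n)) has_vector_derivative cis t ^ n) (at t within {0..2*pi})"
      by (simp only: e Complex.DeMoivre)
  qed (auto intro!: continuous_intros)
  also have "\<dots> = 0"
  proof -
    have "cis (real n * (2 * pi)) = cis (2 * pi) ^ n" by (rule Complex.DeMoivre[symmetric])
    then show ?thesis by simp
  qed
  finally show ?thesis using False by (simp add: circle_integral_eq)
qed

section \<open>Power series on the circle and the Poisson kernel\<close>

text \<open>
  Coefficient sequences carry the function theory: an element of \<open>H\<^sup>2\<close> is \<open>pseries a\<close> for a square-summable
  \<open>a\<close>, and an absolutely summable \<open>a\<close> gives a function continuous up to the circle.
\<close>

definition pseries :: "(nat \<Rightarrow> complex) \<Rightarrow> complex \<Rightarrow> complex" where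
  "pseries a w = (\<Sum>n. a n * w ^ n)"

lemma summable_norm_pseries:
  assumes "summable (\<lambda>n. cmod (a n))" "cmod w \<le> 1"
  shows "summable (\<lambda>n. cmod (a n * w ^ n))"
  using assms(1)
  by (rule summable_comparison_test'[where N=0])
     (use assms(2) in \<open>auto simp: norm_mult norm_power intro!: mult_right_le_one_le power_le_one\<close>)

lemma norm_pseries_le:
  assumes "summable (\<lambda>n. cmod (a n))" "cmod w \<le> 1"
  shows "cmod (pseries a w) \<le> (\<Sum>n. cmod (a n))"
proof -
  have "cmod (pseries a w) \<le> (\<Sum>n. cmod (a n * w ^ n))"
    unfolding pseries_def by (rule summable_norm[OF summable_norm_pseries[OF assms]])
  also have "\<dots> \<le> (\<Sum>n. cmod (a n))"
    by (rule suminf_le[OF _ summable_norm_pseries[OF assms] assms(1)])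
       (use assms(2) in \<open>auto simp: norm_mult norm_power intro!: mult_right_le_one_le power_le_one\<close>)
  finally show ?thesis .
qed

lemma measurable_pseries [measurable]: "pseries a \<in> borel_measurable borel"
  unfolding pseries_def by measurable

text \<open>
  Absolute summability of the coefficients dominates the series on the circle, so it may be integrated term by term against any bounded function.
\<close>

lemma circle_integral_pseries_mult:
  assumes a: "summable (\<lambda>n. cmod (a n))"
    and [measurable]: "\<phi> \<in> borel_measurable circle_measure"
    and \<phi>: "\<And>\<zeta>. cmod \<zeta> = 1 \<Longrightarrow> cmod (\<phi> \<zeta>) \<le> B"
  shows "(\<lambda>n. a n * (\<integral>\<zeta>. \<zeta> ^ n * \<phi> \<zeta> \<partial>circle_measure)) sums
           (\<integral>\<zeta>. pseries a \<zeta> * \<phi> \<zeta> \<partial>circle_measure)"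
proof -
  have B: "0 \<le> B" using \<phi>[of 1] by (metis norm_ge_zero norm_one order_trans)
  have nb: "cmod (a n * \<zeta> ^ n * \<phi> \<zeta>) \<le> cmod (a n) * B" if "cmod \<zeta> = 1" for n \<zeta>
    using \<phi>[OF that] that by (simp add: norm_mult norm_power mult_left_mono)
  have int: "integrable circle_measure (\<lambda>\<zeta>. a n * \<zeta> ^ n * \<phi> \<zeta>)" for n
    by (rule circle_integrable_bounded[OF _ nb]) measurable
  have "(\<lambda>n. \<integral>\<zeta>. a n * \<zeta> ^ n * \<phi> \<zeta> \<partial>circle_measure) sums
      (\<integral>\<zeta>. (\<Sum>n. a n * \<zeta> ^ n * \<phi> \<zeta>) \<partial>circle_measure)"
  proof (rule sums_integral[OF int])
    show "AE \<zeta> in circle_measure. summable (\<lambda>n. norm (a n * \<zeta> ^ n * \<phi> \<zeta>))"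
      by (rule AE_I2, rule summable_comparison_test'[OF summable_mult2[OF a, of B], of 0])
         (simp add: nb)
    show "summable (\<lambda>n. \<integral>\<zeta>. norm (a n * \<zeta> ^ n * \<phi> \<zeta>) \<partial>circle_measure)"
    proof (rule summable_comparison_test'[where N=0 and g="\<lambda>n. cmod (a n) * B"])
      fix n
      have "(\<integral>\<zeta>. norm (a n * \<zeta> ^ n * \<phi> \<zeta>) \<partial>circle_measure) \<le> (\<integral>\<zeta>. cmod (a n) * B \<partial>circle_measure)"
        by (rule integral_mono) (use int nb in auto)
      then show "norm (\<integral>\<zeta>. norm (a n * \<zeta> ^ n * \<phi> \<zeta>) \<partial>circle_measure) \<le> cmod (a n) * B"
        by simp
    qed (use summable_mult2[OF a] in auto)
  qed
  moreover have "(\<integral>\<zeta>. (\<Sum>n. a n * \<zeta> ^ n * \<phi> \<zeta>) \<partial>circle_measure)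
      = (\<integral>\<zeta>. pseries a \<zeta> * \<phi> \<zeta> \<partial>circle_measure)"
    by (rule Bochner_Integration.integral_cong)
       (auto simp: pseries_def suminf_mult2[OF summable_norm_cancel[OF summable_norm_pseries[OF a]]])
  ultimately show ?thesis by (simp add: mult.assoc)
qed

lemma circle_integral_power_cnj_power:
  "(\<integral>\<zeta>. \<zeta> ^ m * cnj (\<zeta> ^ n) \<partial>circle_measure) = (if m = n then 1 else 0)"
proof -
  have 1: "\<zeta> ^ (k + l) * cnj (\<zeta> ^ l) = \<zeta> ^ k" if "cmod \<zeta> = 1" for \<zeta> :: complex and k l
  proof -
    have "\<zeta> ^ l * cnj (\<zeta> ^ l) = 1"
      using that by (metis complex_norm_square norm_power of_real_1 power_one)
    then show ?thesis by (simp add: power_add mult.assoc)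
  qed
  have 2: "(\<integral>\<zeta>. \<zeta> ^ (k + l) * cnj (\<zeta> ^ l) \<partial>circle_measure) = (if k = 0 then 1 else 0)" for k l
    using circle_integral_power[of k]
    by (subst Bochner_Integration.integral_cong[OF refl, of _ _ "\<lambda>\<zeta>. \<zeta> ^ k"]) (auto simp: 1 simp del: complex_cnj_power)
  show ?thesis
  proof (cases "n \<le> m")
    case True
    then show ?thesis using 2[of "m - n" n] by (auto split: if_splits)
  next
    case False
    have "(\<integral>\<zeta>. \<zeta> ^ m * cnj (\<zeta> ^ n) \<partial>circle_measure)
        = (\<integral>\<zeta>. cnj (\<zeta> ^ n * cnj (\<zeta> ^ m)) \<partial>circle_measure)"
      by (simp add: mult.commute)
    also have "\<dots> = cnj (\<integral>\<zeta>. \<zeta> ^ n * cnj (\<zeta> ^ m) \<partial>circle_measure)"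
      by (rule Bochner_Integration.integral_cnj)
    also have "\<dots> = 0" using 2[of "n - m" m] False by auto
    finally show ?thesis using False by simp
  qed
qed

text \<open>
  The product is again analytic, and the mean of an analytic function over the circle is its value at the origin.
\<close>

lemma circle_integral_pseries_pseries:
  assumes a: "summable (\<lambda>n. cmod (a n))" and b: "summable (\<lambda>n. cmod (b n))"
  shows "(\<integral>\<zeta>. pseries a \<zeta> * pseries b \<zeta> \<partial>circle_measure) = a 0 * b 0"
proof -
  have b': "(\<integral>\<zeta>. \<zeta> ^ n * pseries b \<zeta> \<partial>circle_measure) = (if n = 0 then b 0 else 0)" for n
  proof -
    have A: "(\<lambda>m. b m * (\<integral>\<zeta>. \<zeta> ^ m * \<zeta> ^ n \<partial>circle_measure)) sums
           (\<integral>\<zeta>. pseries b \<zeta> * \<zeta> ^ n \<partial>circle_measure)"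
      by (rule circle_integral_pseries_mult[OF b, where B=1]) (auto simp: norm_power)
    have eq: "(\<lambda>m. b m * (\<integral>\<zeta>. \<zeta> ^ m * \<zeta> ^ n \<partial>circle_measure))
        = (\<lambda>m. if m = 0 then (if n = 0 then b 0 else 0) else 0)"
      by (auto simp: fun_eq_iff power_add[symmetric] circle_integral_power)
    have B: "(\<lambda>m. if m = 0 then (if n = 0 then b 0 else 0) else 0) sums (if n = 0 then b 0 else 0)"
      by (rule sums_single)
    have "(\<integral>\<zeta>. pseries b \<zeta> * \<zeta> ^ n \<partial>circle_measure) = (if n = 0 then b 0 else 0)"
      using A[unfolded eq] B by (rule sums_unique2)
    then show ?thesis by (simp only: mult.commute)
  qed
  have A: "(\<lambda>n. a n * (\<integral>\<zeta>. \<zeta> ^ n * pseries b \<zeta> \<partial>circle_measure)) sums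
           (\<integral>\<zeta>. pseries a \<zeta> * pseries b \<zeta> \<partial>circle_measure)"
    by (rule circle_integral_pseries_mult[OF a _ norm_pseries_le[OF b]]) auto
  have eq: "(\<lambda>n. a n * (\<integral>\<zeta>. \<zeta> ^ n * pseries b \<zeta> \<partial>circle_measure)) = (\<lambda>n. if n = 0 then a 0 * b 0 else 0)"
    by (auto simp: b')
  have B: "(\<lambda>n::nat. if n = 0 then a 0 * b 0 else 0) sums (a 0 * b 0)"
    by (rule sums_single)
  show ?thesis using A[unfolded eq] B by (rule sums_unique2)
qed

lemma circle_integral_pseries_cnj_pseries:
  assumes a: "summable (\<lambda>n. cmod (a n))" and b: "summable (\<lambda>n. cmod (b n))"
  shows "(\<lambda>n. a n * cnj (b n)) sums (\<integral>\<zeta>. pseries a \<zeta> * cnj (pseries b \<zeta>) \<partial>circle_measure)"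
proof -
  have b': "(\<integral>\<zeta>. \<zeta> ^ n * cnj (pseries b \<zeta>) \<partial>circle_measure) = cnj (b n)" for n
  proof -
    have A: "(\<lambda>m. b m * (\<integral>\<zeta>. \<zeta> ^ m * cnj (\<zeta> ^ n) \<partial>circle_measure)) sums
           (\<integral>\<zeta>. pseries b \<zeta> * cnj (\<zeta> ^ n) \<partial>circle_measure)"
      by (rule circle_integral_pseries_mult[OF b, where B=1]) (auto simp: norm_power)
    have eq: "(\<lambda>m. b m * (\<integral>\<zeta>. \<zeta> ^ m * cnj (\<zeta> ^ n) \<partial>circle_measure))
        = (\<lambda>m. if m = n then b m else 0)"
      by (auto simp del: complex_cnj_power simp: fun_eq_iff circle_integral_power_cnj_power)
    have B: "(\<lambda>m. if m = n then b m else 0) sums b n"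
      by (rule sums_single)
    have "(\<integral>\<zeta>. pseries b \<zeta> * cnj (\<zeta> ^ n) \<partial>circle_measure) = b n"
      using A[unfolded eq] B by (rule sums_unique2)
    then have "cnj (\<integral>\<zeta>. pseries b \<zeta> * cnj (\<zeta> ^ n) \<partial>circle_measure) = cnj (b n)" by simp
    then show ?thesis unfolding Bochner_Integration.integral_cnj[symmetric] by (simp add: mult.commute)
  qed
  have "(\<lambda>n. a n * (\<integral>\<zeta>. \<zeta> ^ n * cnj (pseries b \<zeta>) \<partial>circle_measure)) sums
           (\<integral>\<zeta>. pseries a \<zeta> * cnj (pseries b \<zeta>) \<partial>circle_measure)"
    by (rule circle_integral_pseries_mult[OF a, where B="\<Sum>n. cmod (b n)"])
       (auto simp: norm_pseries_le[OF b])
  then show ?thesis by (simp add: b')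
qed

lemma circle_parseval:
  assumes a: "summable (\<lambda>n. cmod (a n))"
  shows "summable (\<lambda>n. (cmod (a n))\<^sup>2)"
    and "(\<integral>\<^sup>+\<zeta>. ennreal ((cmod (pseries a \<zeta>))\<^sup>2) \<partial>circle_measure) = ennreal (\<Sum>n. (cmod (a n))\<^sup>2)"
proof -
  have int: "integrable circle_measure (\<lambda>\<zeta>. (cmod (pseries a \<zeta>))\<^sup>2)"
    by (rule circle_integrable_bounded[where B="(\<Sum>n. cmod (a n))\<^sup>2"])
       (auto intro!: power_mono norm_pseries_le[OF a])
  have "(\<lambda>n. complex_of_real ((cmod (a n))\<^sup>2)) sums
      (\<integral>\<zeta>. complex_of_real ((cmod (pseries a \<zeta>))\<^sup>2) \<partial>circle_measure)"
    using circle_integral_pseries_cnj_pseries[OF a a] by (simp only: complex_norm_square)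
  then have "(\<lambda>n. (cmod (a n))\<^sup>2) sums (\<integral>\<zeta>. (cmod (pseries a \<zeta>))\<^sup>2 \<partial>circle_measure)"
    by (simp only: integral_complex_of_real sums_of_real_iff)
  then show "summable (\<lambda>n. (cmod (a n))\<^sup>2)"
    "(\<integral>\<^sup>+\<zeta>. ennreal ((cmod (pseries a \<zeta>))\<^sup>2) \<partial>circle_measure) = ennreal (\<Sum>n. (cmod (a n))\<^sup>2)"
    by (auto simp: sums_iff nn_integral_eq_integral[OF int])
qed

text \<open>
  This normalisation is the classical kernel only for \<open>\<zeta>\<close> and \<open>\<eta>\<close> on the unit circle, where \<open>cnj \<zeta>\<close> is the
  inverse of \<open>\<zeta>\<close>.
\<close>

definition poisson :: "real \<Rightarrow> complex \<Rightarrow> complex \<Rightarrow> real" where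
  "poisson r \<zeta> \<eta> = (1 - r\<^sup>2) / (cmod (1 - of_real r * (cnj \<zeta> * \<eta>)))\<^sup>2"

lemma poisson_nonneg: "0 \<le> r \<Longrightarrow> r < 1 \<Longrightarrow> 0 \<le> poisson r \<zeta> \<eta>"
  by (simp add: poisson_def power_le_one abs_square_le_1)

lemma poisson_commute: "poisson r \<zeta> \<eta> = poisson r \<eta> \<zeta>"
proof -
  have "cmod (1 - of_real r * (cnj \<zeta> * \<eta>)) = cmod (cnj (1 - of_real r * (cnj \<zeta> * \<eta>)))"
    by (simp only: complex_mod_cnj)
  then show ?thesis by (simp add: poisson_def mult.commute)
qed

lemma measurable_poisson [measurable]:
  assumes [measurable]: "r \<in> borel_measurable N" "f \<in> borel_measurable N" "g \<in> borel_measurable N"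
  shows "(\<lambda>x. poisson (r x) (f x) (g x)) \<in> borel_measurable N"
proof -
  show ?thesis unfolding poisson_def by measurable
qed

lemma poisson_eq_Re:
  assumes "cmod \<zeta> = 1" "cmod \<eta> = 1" "0 \<le> r" "r < 1"
  shows "poisson r \<zeta> \<eta> = Re (2 / (1 - of_real r * cnj \<zeta> * \<eta>) - 1)"
proof -
  define x where "x = of_real r * cnj \<zeta> * \<eta>"
  have n: "cmod x = r" using assms by (simp add: x_def norm_mult)
  then have nz: "1 - x \<noteq> 0" using assms by auto
  have r: "r\<^sup>2 = (Re x)\<^sup>2 + (Im x)\<^sup>2" using n cmod_power2 by metis
  have "2 / (1 - x) - 1 = (1 + x) / (1 - x)" using nz by (simp add: field_simps)
  then have "Re (2 / (1 - x) - 1) = Re ((1 + x) / (1 - x))" by simp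
  also have "\<dots> = (1 - ((Re x)\<^sup>2 + (Im x)\<^sup>2)) / (cmod (1 - x))\<^sup>2"
    unfolding Re_divide' by (simp add: power2_eq_square algebra_simps)
  also have "\<dots> = (1 - r\<^sup>2) / (cmod (1 - x))\<^sup>2" by (simp only: r)
  finally show ?thesis by (simp add: poisson_def x_def mult.assoc)
qed

lemma geometric_pseries:
  assumes "cmod (c * w) < 1"
  shows "pseries (\<lambda>n. c ^ n) w = 1 / (1 - c * w)"
  using suminf_geometric[OF assms] by (simp add: pseries_def power_mult_distrib)

text \<open>
  The kernel is an analytic part in \<open>\<eta>\<close>, its conjugate, and a constant. This turns integrals against it into the orthogonality relations above.
\<close>

lemma poisson_eq_series:
  assumes "cmod \<zeta> = 1" "cmod \<eta> = 1" "0 \<le> r" "r < 1"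
  shows "complex_of_real (poisson r \<zeta> \<eta>)
    = pseries (\<lambda>n. (of_real r * cnj \<zeta>) ^ n) \<eta> + cnj (pseries (\<lambda>n. (of_real r * cnj \<zeta>) ^ n) \<eta>) - 1"
proof -
  let ?S = "pseries (\<lambda>n. (of_real r * cnj \<zeta>) ^ n) \<eta>"
  have "?S = 1 / (1 - of_real r * cnj \<zeta> * \<eta>)"
    by (rule geometric_pseries) (use assms in \<open>simp add: norm_mult\<close>)
  then have "poisson r \<zeta> \<eta> = Re (2 * ?S - 1)"
    by (simp only: poisson_eq_Re[OF assms]) simp
  then show ?thesis by (simp add: complex_eq_iff)
qed

lemma poisson_le:
  assumes "cmod \<zeta> = 1" "cmod \<eta> = 1" "0 \<le> r" "r \<le> R" "R < 1"
  shows "poisson r \<zeta> \<eta> \<le> 1 / (1 - R)\<^sup>2"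
proof -
  have "1 - R \<le> 1 - cmod (of_real r * (cnj \<zeta> * \<eta>))" using assms by (simp add: norm_mult)
  also have "\<dots> \<le> cmod (1 - of_real r * (cnj \<zeta> * \<eta>))"
    by (metis norm_one norm_triangle_ineq2)
  finally have "(1 - R)\<^sup>2 \<le> (cmod (1 - of_real r * (cnj \<zeta> * \<eta>)))\<^sup>2"
    using assms by (intro power_mono) auto
  then show ?thesis unfolding poisson_def
    using assms by (intro frac_le) (auto simp: abs_square_le_1)
qed

text \<open>
  The analytic part of the kernel contributes the mean of the function, which the constant term cancels.
  The conjugate part reproduces the series at the radius \<open>r\<close>.
\<close>

lemma poisson_reproduces:
  assumes a: "summable (\<lambda>n. cmod (a n))" and z: "cmod \<zeta> = 1" and r: "0 \<le> r" "r < 1"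
  shows "(\<integral>\<eta>. pseries a \<eta> * complex_of_real (poisson r \<zeta> \<eta>) \<partial>circle_measure) = pseries a (of_real r * \<zeta>)"
proof -
  define c where "c = (\<lambda>n. (of_real r * cnj \<zeta>) ^ n)"
  have c: "summable (\<lambda>n. cmod (c n))"
    using r z by (simp add: c_def norm_power norm_mult summable_geometric)
  have e: "summable (\<lambda>n. cmod (if n = 0 then 1 else 0 :: complex))"
    by (rule summable_finite[of "{0::nat}"]) auto
  have e1: "pseries (\<lambda>n. if n = 0 then 1 else 0) \<eta> = 1" for \<eta>
    using sums_single[of 0 "\<lambda>n. \<eta> ^ n"]
    by (auto simp: pseries_def sums_iff if_distrib[of "\<lambda>x. x * _"] cong: if_cong)
  note na = norm_pseries_le[OF a] and nc = norm_pseries_le[OF c]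
  have i1: "integrable circle_measure (\<lambda>\<eta>. pseries a \<eta> * pseries c \<eta>)"
    by (rule circle_integrable_bounded[where B="(\<Sum>n. cmod (a n)) * (\<Sum>n. cmod (c n))"])
       (auto simp: norm_mult intro!: mult_mono na nc suminf_nonneg a)
  have i2: "integrable circle_measure (\<lambda>\<eta>. pseries a \<eta> * cnj (pseries c \<eta>))"
    by (rule circle_integrable_bounded[where B="(\<Sum>n. cmod (a n)) * (\<Sum>n. cmod (c n))"])
       (auto simp: norm_mult intro!: mult_mono na nc suminf_nonneg a)
  have i3: "integrable circle_measure (pseries a)"
    by (rule circle_integrable_bounded[where B="(\<Sum>n. cmod (a n))"]) (auto intro: na)
  have "(\<integral>\<eta>. pseries a \<eta> * complex_of_real (poisson r \<zeta> \<eta>) \<partial>circle_measure)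
     = (\<integral>\<eta>. (pseries a \<eta> * pseries c \<eta> + pseries a \<eta> * cnj (pseries c \<eta>)) - pseries a \<eta> \<partial>circle_measure)"
    by (rule Bochner_Integration.integral_cong) (auto simp: poisson_eq_series[OF z _ r] c_def algebra_simps)
  also have "\<dots> = (\<integral>\<eta>. pseries a \<eta> * pseries c \<eta> \<partial>circle_measure)
      + (\<integral>\<eta>. pseries a \<eta> * cnj (pseries c \<eta>) \<partial>circle_measure) - (\<integral>\<eta>. pseries a \<eta> \<partial>circle_measure)"
    using i1 i2 i3 by simp
  also have "(\<integral>\<eta>. pseries a \<eta> * pseries c \<eta> \<partial>circle_measure) = a 0"
    by (simp only: circle_integral_pseries_pseries[OF a c]) (simp add: c_def)
  also have "(\<integral>\<eta>. pseries a \<eta> \<partial>circle_measure) = a 0"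
    using circle_integral_pseries_pseries[OF a e] by (simp add: e1)
  also have "(\<integral>\<eta>. pseries a \<eta> * cnj (pseries c \<eta>) \<partial>circle_measure) = pseries a (of_real r * \<zeta>)"
    using circle_integral_pseries_cnj_pseries[OF a c] by (simp add: sums_iff pseries_def c_def)
  finally show ?thesis by simp
qed

text \<open>
  One of the two kernels is the real part of a function analytic in \<open>\<eta>\<close>, so the other kernel reproduces it
  at a smaller radius.
\<close>

lemma poisson_semigroup:
  assumes z: "cmod \<zeta> = 1" "cmod \<zeta>' = 1" and r: "0 \<le> r" "r < 1" and s: "0 \<le> s" "s < 1"
  shows "(\<integral>\<^sup>+\<eta>. ennreal (poisson r \<zeta> \<eta>) * ennreal (poisson s \<zeta>' \<eta>) \<partial>circle_measure)
           = ennreal (poisson (r * s) \<zeta> \<zeta>')"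
proof -
  define a where "a = (\<lambda>n. 2 * (of_real r * cnj \<zeta>) ^ n - (if n = 0 then 1 else 0))"
  have c: "summable (\<lambda>n. cmod ((of_real r * cnj \<zeta>) ^ n))"
    using r z by (simp add: norm_power norm_mult summable_geometric)
  have a: "summable (\<lambda>n. cmod (a n))"
  proof (rule summable_comparison_test'[where N=1])
    show "summable (\<lambda>n. 2 * cmod ((of_real r * cnj \<zeta>) ^ n))"
      using c by (rule summable_mult)
  qed (auto simp: a_def norm_mult norm_power)
  have pa: "pseries a w = 2 / (1 - of_real r * cnj \<zeta> * w) - 1" if "cmod w \<le> 1" for w
  proof -
    have "cmod (of_real r * cnj \<zeta> * w) < 1"
    proof -
      have "cmod (of_real r * cnj \<zeta> * w) \<le> r"
        using z r that by (simp add: norm_mult mult_left_le)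
      then show ?thesis using r by simp
    qed
    then have g: "(\<lambda>n. (of_real r * cnj \<zeta> * w) ^ n) sums (1 / (1 - of_real r * cnj \<zeta> * w))"
      by (rule geometric_sums)
    have eq: "(\<lambda>n. a n * w ^ n) = (\<lambda>n. 2 * (of_real r * cnj \<zeta> * w) ^ n - (if n = 0 then 1 else 0))"
      by (auto simp: fun_eq_iff a_def power_mult_distrib algebra_simps)
    from sums_diff[OF sums_mult[OF g, of 2] sums_single[of 0 "\<lambda>_. 1"]]
    have "(\<lambda>n. a n * w ^ n) sums (2 / (1 - of_real r * cnj \<zeta> * w) - 1)"
      by (simp only: eq times_divide_eq_right mult_1_right)
    then show ?thesis by (simp add: pseries_def sums_iff)
  qed
  have b: "norm (poisson r \<zeta> \<eta> * poisson s \<zeta>' \<eta>) \<le> (1 / (1-r)\<^sup>2) * (1 / (1-s)\<^sup>2)" if "cmod \<eta> = 1" for \<eta>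
    unfolding norm_mult
    by (intro mult_mono) (use poisson_le[OF z(1) that r(1) order_refl r(2)] poisson_nonneg[OF r]
         poisson_le[OF z(2) that s(1) order_refl s(2)] poisson_nonneg[OF s] in auto)
  have int: "integrable circle_measure (\<lambda>\<eta>. poisson r \<zeta> \<eta> * poisson s \<zeta>' \<eta>)"
    by (rule circle_integrable_bounded[OF _ b]) auto
  have inta: "integrable circle_measure (\<lambda>\<eta>. pseries a \<eta> * complex_of_real (poisson s \<zeta>' \<eta>))"
  proof (rule circle_integrable_bounded)
    show "cmod (pseries a \<eta> * complex_of_real (poisson s \<zeta>' \<eta>)) \<le> (\<Sum>n. cmod (a n)) * (1 / (1-s)\<^sup>2)"
      if "cmod \<eta> = 1" for \<eta>
      unfolding norm_mult
      by (intro mult_mono norm_pseries_le[OF a] suminf_nonneg a)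
         (use that poisson_nonneg[OF s] poisson_le[OF z(2) that s(1) order_refl s(2)] in auto)
  qed measurable
  have "(\<integral>\<eta>. poisson r \<zeta> \<eta> * poisson s \<zeta>' \<eta> \<partial>circle_measure)
      = (\<integral>\<eta>. Re (pseries a \<eta> * complex_of_real (poisson s \<zeta>' \<eta>)) \<partial>circle_measure)"
    by (rule Bochner_Integration.integral_cong) (auto simp: poisson_eq_Re[OF z(1) _ r] pa)
  also have "\<dots> = Re (pseries a (of_real s * \<zeta>'))"
    by (subst integral_Re[OF inta]) (simp add: poisson_reproduces[OF a z(2) s])
  also have "\<dots> = Re (2 / (1 - of_real (r * s) * cnj \<zeta> * \<zeta>') - 1)"
    using z s by (subst pa) (simp_all add: norm_mult mult_ac)
  also have "\<dots> = poisson (r * s) \<zeta> \<zeta>'"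
  proof -
    have "r * s \<le> r" using r s by (intro mult_left_le) auto
    then have "r * s < 1" using r by linarith
    then show ?thesis using z r s by (subst poisson_eq_Re) auto
  qed
  finally have eq: "(\<integral>\<eta>. poisson r \<zeta> \<eta> * poisson s \<zeta>' \<eta> \<partial>circle_measure) = poisson (r * s) \<zeta> \<zeta>'" .
  have "(\<integral>\<^sup>+\<eta>. ennreal (poisson r \<zeta> \<eta>) * ennreal (poisson s \<zeta>' \<eta>) \<partial>circle_measure)
      = (\<integral>\<^sup>+\<eta>. ennreal (poisson r \<zeta> \<eta> * poisson s \<zeta>' \<eta>) \<partial>circle_measure)"
    by (simp add: ennreal_mult poisson_nonneg[OF r] poisson_nonneg[OF s])
  then show ?thesis
    using nn_integral_eq_integral[OF int] poisson_nonneg[OF r] poisson_nonneg[OF s] by (simp add: eq)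
qed

text \<open>
  The numerators satisfy \<open>1 - (r s)\<^sup>2 \<le> (1 - r\<^sup>2) + (1 - s\<^sup>2)\<close>. Shrinking the radius decreases the
  distance from \<open>1\<close> to the point by at most a factor two, because the distance moved is at most that
  of the inner point from the circle, which is at most its distance from \<open>1\<close>. The square of this factor is the constant \<open>4\<close>.
\<close>

lemma poisson_product_le:
  assumes z: "cmod \<zeta> = 1" "cmod \<zeta>' = 1" and r: "0 \<le> r" "r < 1" and s: "0 \<le> s" "s < 1"
  shows "poisson (r * s) \<zeta> \<zeta>' \<le> 4 * (poisson r \<zeta> \<zeta>' + poisson s \<zeta> \<zeta>')"
proof -
  define x where "x = cnj \<zeta> * \<zeta>'"
  have x: "cmod x = 1" using z by (simp add: x_def norm_mult)
  have half: "cmod (1 - of_real t * x) \<le> 2 * cmod (1 - of_real q * x)"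
    if "0 \<le> q" "q \<le> t" "t < 1" for q t :: real
  proof -
    have "cmod (1 - of_real t * x) \<le> cmod (1 - of_real q * x) + cmod (of_real (q - t) * x)"
      by (rule order_trans[OF _ norm_triangle_ineq]) (simp add: algebra_simps)
    also have "cmod (of_real (q - t) * x) = t - q" using that x by (simp add: norm_mult del: of_real_diff)
    also have "t - q \<le> 1 - cmod (of_real q * x)" using that x by (simp add: norm_mult)
    also have "\<dots> \<le> cmod (1 - of_real q * x)" by (metis norm_one norm_triangle_ineq2)
    finally show ?thesis by simp
  qed
  have one: "(1 - t\<^sup>2) / (cmod (1 - of_real q * x))\<^sup>2 \<le> 4 * poisson t \<zeta> \<zeta>'"
    if "0 \<le> q" "q \<le> t" "t < 1" for q t :: real
  proof -
    have "(cmod (1 - of_real t * x))\<^sup>2 \<le> (2 * cmod (1 - of_real q * x))\<^sup>2"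
      by (intro power_mono half that) auto
    then have le: "(cmod (1 - of_real t * x))\<^sup>2 / 4 \<le> (cmod (1 - of_real q * x))\<^sup>2"
      by (simp add: power_mult_distrib)
    have "cmod (of_real t * x) < 1" using x that by (simp add: norm_mult)
    then have pos: "0 < (cmod (1 - of_real t * x))\<^sup>2"
      by (auto simp: zero_less_power2)
    have "(1 - t\<^sup>2) / (cmod (1 - of_real q * x))\<^sup>2 \<le> (1 - t\<^sup>2) / ((cmod (1 - of_real t * x))\<^sup>2 / 4)"
      by (rule divide_left_mono[OF le]) (use pos le that in \<open>auto simp: abs_square_le_1 intro!: mult_pos_pos\<close>)
    then show ?thesis by (simp add: poisson_def x_def algebra_simps)
  qed
  have rs: "r * s \<le> r" "r * s \<le> s" "0 \<le> r * s" using r s by (auto intro: mult_left_le mult_left_le_one_le)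
  have "poisson (r * s) \<zeta> \<zeta>' \<le> ((1 - r\<^sup>2) + (1 - s\<^sup>2)) / (cmod (1 - of_real (r * s) * x))\<^sup>2"
    unfolding poisson_def x_def
  proof (rule divide_right_mono)
    have "0 \<le> (1 - r\<^sup>2) * (1 - s\<^sup>2)" using r s by (intro mult_nonneg_nonneg) (auto simp: abs_square_le_1)
    then show "1 - (r * s)\<^sup>2 \<le> 1 - r\<^sup>2 + (1 - s\<^sup>2)" by (simp add: algebra_simps power_mult_distrib)
  qed auto
  also have "\<dots> = (1 - r\<^sup>2) / (cmod (1 - of_real (r * s) * x))\<^sup>2 + (1 - s\<^sup>2) / (cmod (1 - of_real (r * s) * x))\<^sup>2"
    by (rule add_divide_distrib)
  also have "\<dots> \<le> 4 * poisson r \<zeta> \<zeta>' + 4 * poisson s \<zeta> \<zeta>'"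
    by (intro add_mono one rs r s)
  finally show ?thesis by simp
qed

section \<open>The L2 maximal inequality for Poisson averages\<close>

text \<open>
  With \<open>T\<close> the averaging operator with kernel \<open>k\<close>, the left-hand side is \<open>\<parallel>T\<^sup>* h\<parallel>\<^sup>2\<close>, that is, the form of
  \<open>T T\<^sup>*\<close> at \<open>h\<close>. By the semigroup law the kernel of \<open>T T\<^sup>*\<close> is a Poisson kernel at the product of the two
  radii, and the preceding inequality splits it into the kernels of \<open>T\<close> and \<open>T\<^sup>*\<close>.
\<close>

lemma poisson_maximal_TTstar:
  fixes k :: "complex \<Rightarrow> complex \<Rightarrow> ennreal" and h :: "complex \<Rightarrow> ennreal"
  assumes \<rho> [measurable]: "\<rho> \<in> borel_measurable circle_measure" and h [measurable]: "h \<in> borel_measurable circle_measure"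
    and \<rho>_bounds: "\<And>\<zeta>. 0 \<le> \<rho> \<zeta>" "\<And>\<zeta>. \<rho> \<zeta> < 1"
  defines "k \<equiv> \<lambda>\<zeta> \<eta>. ennreal (poisson (\<rho> \<zeta>) \<zeta> \<eta>)"
  shows "(\<integral>\<^sup>+\<eta>. (\<integral>\<^sup>+\<zeta>. k \<zeta> \<eta> * h \<zeta> \<partial>circle_measure)\<^sup>2 \<partial>circle_measure)
           \<le> 8 * (\<integral>\<^sup>+\<zeta>. h \<zeta> * (\<integral>\<^sup>+\<eta>. k \<zeta> \<eta> * h \<eta> \<partial>circle_measure) \<partial>circle_measure)"
    (is "?L \<le> 8 * ?I")
proof -
  let ?M = circle_measure
  have k [measurable]: "case_prod k \<in> borel_measurable (?M \<Otimes>\<^sub>M ?M)"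
    unfolding k_def by measurable
  have km [measurable]: "(\<lambda>x. k (f x) (g x)) \<in> borel_measurable N"
    if [measurable]: "f \<in> measurable N ?M" "g \<in> measurable N ?M" for f g and N :: "'z measure"
    unfolding k_def by measurable
  have "?L = (\<integral>\<^sup>+\<eta>. (\<integral>\<^sup>+\<zeta>. (\<integral>\<^sup>+\<zeta>'. (k \<zeta> \<eta> * h \<zeta>) * (k \<zeta>' \<eta> * h \<zeta>') \<partial>?M) \<partial>?M) \<partial>?M)"
  proof (rule nn_integral_cong)
    fix \<eta> assume \<eta>: "\<eta> \<in> space ?M"
    have [measurable]: "(\<lambda>\<zeta>. k \<zeta> \<eta> * h \<zeta>) \<in> borel_measurable ?M"
      using \<eta> by measurable
    show "(\<integral>\<^sup>+\<zeta>. k \<zeta> \<eta> * h \<zeta> \<partial>?M)\<^sup>2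
        = (\<integral>\<^sup>+\<zeta>. (\<integral>\<^sup>+\<zeta>'. (k \<zeta> \<eta> * h \<zeta>) * (k \<zeta>' \<eta> * h \<zeta>') \<partial>?M) \<partial>?M)"
      by (simp add: power2_eq_square nn_integral_cmult nn_integral_multc)
  qed
  also have "\<dots> = (\<integral>\<^sup>+\<zeta>. (\<integral>\<^sup>+\<eta>. (\<integral>\<^sup>+\<zeta>'. (k \<zeta> \<eta> * h \<zeta>) * (k \<zeta>' \<eta> * h \<zeta>') \<partial>?M) \<partial>?M) \<partial>?M)"
    by (rule circle2.Fubini') measurable
  also have "\<dots> = (\<integral>\<^sup>+\<zeta>. (\<integral>\<^sup>+\<zeta>'. (\<integral>\<^sup>+\<eta>. (k \<zeta> \<eta> * h \<zeta>) * (k \<zeta>' \<eta> * h \<zeta>') \<partial>?M) \<partial>?M) \<partial>?M)"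
    by (intro nn_integral_cong circle2.Fubini') measurable
  also have "\<dots> = (\<integral>\<^sup>+\<zeta>. (\<integral>\<^sup>+\<zeta>'. (h \<zeta> * h \<zeta>') * (\<integral>\<^sup>+\<eta>. k \<zeta> \<eta> * k \<zeta>' \<eta> \<partial>?M) \<partial>?M) \<partial>?M)"
    by (intro nn_integral_cong, subst nn_integral_cmult[symmetric]) (auto simp: mult_ac)
  also have "\<dots> \<le> (\<integral>\<^sup>+\<zeta>. (\<integral>\<^sup>+\<zeta>'. (h \<zeta> * h \<zeta>') * (4 * (k \<zeta> \<zeta>' + k \<zeta>' \<zeta>)) \<partial>?M) \<partial>?M)"
  proof (intro nn_integral_mono mult_left_mono)
    fix \<zeta> \<zeta>' assume "\<zeta> \<in> space ?M" "\<zeta>' \<in> space ?M"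
    then have z: "cmod \<zeta> = 1" "cmod \<zeta>' = 1" by auto
    have "(\<integral>\<^sup>+\<eta>. k \<zeta> \<eta> * k \<zeta>' \<eta> \<partial>?M) = ennreal (poisson (\<rho> \<zeta> * \<rho> \<zeta>') \<zeta> \<zeta>')"
      unfolding k_def by (rule poisson_semigroup[OF z \<rho>_bounds \<rho>_bounds])
    also have "\<dots> \<le> ennreal (4 * (poisson (\<rho> \<zeta>) \<zeta> \<zeta>' + poisson (\<rho> \<zeta>') \<zeta> \<zeta>'))"
      by (rule ennreal_leI[OF poisson_product_le[OF z \<rho>_bounds \<rho>_bounds]])
    also have "\<dots> = 4 * (k \<zeta> \<zeta>' + k \<zeta>' \<zeta>)"
      unfolding k_def poisson_commute[of _ \<zeta>' \<zeta>]
      by (subst ennreal_plus[symmetric]) (simp_all add: ennreal_mult' poisson_nonneg[OF \<rho>_bounds] del: distrib_left_numeral)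
    finally show "(\<integral>\<^sup>+\<eta>. k \<zeta> \<eta> * k \<zeta>' \<eta> \<partial>?M) \<le> 4 * (k \<zeta> \<zeta>' + k \<zeta>' \<zeta>)" .
  qed auto
  also have "\<dots> = (\<integral>\<^sup>+\<zeta>. (\<integral>\<^sup>+\<zeta>'. 4 * (h \<zeta> * (k \<zeta> \<zeta>' * h \<zeta>')) + 4 * (h \<zeta>' * (k \<zeta>' \<zeta> * h \<zeta>)) \<partial>?M) \<partial>?M)"
    by (simp add: algebra_simps)
  also have "\<dots> = (\<integral>\<^sup>+\<zeta>. (\<integral>\<^sup>+\<zeta>'. 4 * (h \<zeta> * (k \<zeta> \<zeta>' * h \<zeta>')) \<partial>?M) + (\<integral>\<^sup>+\<zeta>'. 4 * (h \<zeta>' * (k \<zeta>' \<zeta> * h \<zeta>)) \<partial>?M) \<partial>?M)"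
    by (intro nn_integral_cong nn_integral_add) measurable
  also have "\<dots> = (\<integral>\<^sup>+\<zeta>. (\<integral>\<^sup>+\<zeta>'. 4 * (h \<zeta> * (k \<zeta> \<zeta>' * h \<zeta>')) \<partial>?M) \<partial>?M)
      + (\<integral>\<^sup>+\<zeta>. (\<integral>\<^sup>+\<zeta>'. 4 * (h \<zeta>' * (k \<zeta>' \<zeta> * h \<zeta>)) \<partial>?M) \<partial>?M)"
    by (intro nn_integral_add) measurable
  also have "(\<integral>\<^sup>+\<zeta>. (\<integral>\<^sup>+\<zeta>'. 4 * (h \<zeta>' * (k \<zeta>' \<zeta> * h \<zeta>)) \<partial>?M) \<partial>?M)
      = (\<integral>\<^sup>+\<zeta>'. (\<integral>\<^sup>+\<zeta>. 4 * (h \<zeta>' * (k \<zeta>' \<zeta> * h \<zeta>)) \<partial>?M) \<partial>?M)"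
    by (rule circle2.Fubini') measurable
  also have "(\<integral>\<^sup>+\<zeta>. (\<integral>\<^sup>+\<zeta>'. 4 * (h \<zeta> * (k \<zeta> \<zeta>' * h \<zeta>')) \<partial>?M) \<partial>?M) = 4 * ?I"
  proof -
    have "(\<integral>\<^sup>+\<zeta>'. 4 * (h \<zeta> * (k \<zeta> \<zeta>' * h \<zeta>')) \<partial>?M) = 4 * (h \<zeta> * (\<integral>\<^sup>+\<eta>. k \<zeta> \<eta> * h \<eta> \<partial>?M))"
      if \<zeta>: "\<zeta> \<in> space ?M" for \<zeta>
    proof -
      have "(\<lambda>\<eta>. k \<zeta> \<eta> * h \<eta>) \<in> borel_measurable ?M"
        using \<zeta> by measurable
      then show ?thesis by (simp add: nn_integral_cmult)
    qed
    then have "(\<integral>\<^sup>+\<zeta>. (\<integral>\<^sup>+\<zeta>'. 4 * (h \<zeta> * (k \<zeta> \<zeta>' * h \<zeta>')) \<partial>?M) \<partial>?M)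
        = (\<integral>\<^sup>+\<zeta>. 4 * (h \<zeta> * (\<integral>\<^sup>+\<eta>. k \<zeta> \<eta> * h \<eta> \<partial>?M)) \<partial>?M)"
      by (rule nn_integral_cong)
    also have "\<dots> = 4 * ?I" by (rule nn_integral_cmult) measurable
    finally show ?thesis .
  qed
  also have "4 * ?I + 4 * ?I = 8 * ?I"
    by (simp add: distrib_right[symmetric])
  finally show ?thesis .
qed

text \<open>
  An \<open>L\<^sup>2\<close> bound for Poisson averages whose radius varies with the point, with a constant independent of the
  choice of radii. The bound \<open>R\<close> only serves to make the operator bounded to begin with. If \<open>S\<close> is any constant
  for which the inequality holds, then \<open>8 \<surd>S\<close> is another by duality and the estimate for \<open>T T\<^sup>*\<close>, so the least
  constant is at most \<open>64\<close>.
\<close>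

lemma poisson_maximal:
  fixes h :: "complex \<Rightarrow> ennreal"
  assumes \<rho> [measurable]: "\<rho> \<in> borel_measurable circle_measure" and h [measurable]: "h \<in> borel_measurable circle_measure"
    and \<rho>0: "\<And>\<zeta>. 0 \<le> \<rho> \<zeta>" and \<rho>R: "\<And>\<zeta>. \<rho> \<zeta> \<le> R" and R: "R < 1"
  shows "(\<integral>\<^sup>+\<zeta>. (\<integral>\<^sup>+\<eta>. ennreal (poisson (\<rho> \<zeta>) \<zeta> \<eta>) * h \<eta> \<partial>circle_measure)\<^sup>2 \<partial>circle_measure)
           \<le> 64 * (\<integral>\<^sup>+\<eta>. (h \<eta>)\<^sup>2 \<partial>circle_measure)"
proof -
  let ?M = circle_measure
  have \<rho>1: "\<rho> \<zeta> < 1" for \<zeta> using \<rho>R[of \<zeta>] R by simp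
  define k where "k = (\<lambda>\<zeta> \<eta>. ennreal (poisson (\<rho> \<zeta>) \<zeta> \<eta>))"
  have k [measurable]: "case_prod k \<in> borel_measurable (?M \<Otimes>\<^sub>M ?M)"
    unfolding k_def by measurable
  have km [measurable]: "(\<lambda>x. k (f x) (g x)) \<in> borel_measurable N"
    if [measurable]: "f \<in> measurable N ?M" "g \<in> measurable N ?M" for f g and N :: "'z measure"
    unfolding k_def by measurable
  define T where "T = (\<lambda>h \<zeta>. \<integral>\<^sup>+\<eta>. k \<zeta> \<eta> * h \<eta> \<partial>?M)"
  define A where "A = (\<lambda>h \<eta>. \<integral>\<^sup>+\<zeta>. k \<zeta> \<eta> * h \<zeta> \<partial>?M)"
  define N where "N = (\<lambda>h. \<integral>\<^sup>+\<eta>. (h \<eta>)\<^sup>2 \<partial>?M)" for h :: "complex \<Rightarrow> ennreal"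
  have T [measurable]: "T h \<in> borel_measurable ?M" if [measurable]: "h \<in> borel_measurable ?M" for h
    unfolding T_def by measurable
  have A [measurable]: "A h \<in> borel_measurable ?M" if [measurable]: "h \<in> borel_measurable ?M" for h
    unfolding A_def by measurable
  have adjoint: "(N (T h))\<^sup>2 \<le> N h * N (A (T h))" if [measurable]: "h \<in> borel_measurable ?M" for h
  proof -
    have "N (T h) = (\<integral>\<^sup>+\<zeta>. (\<integral>\<^sup>+\<eta>. T h \<zeta> * (k \<zeta> \<eta> * h \<eta>) \<partial>?M) \<partial>?M)"
      unfolding N_def
    proof (rule nn_integral_cong)
      fix \<zeta> assume \<zeta>: "\<zeta> \<in> space ?M"
      have "(\<lambda>\<eta>. k \<zeta> \<eta> * h \<eta>) \<in> borel_measurable ?M"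
        using \<zeta> by measurable
      then show "(T h \<zeta>)\<^sup>2 = (\<integral>\<^sup>+\<eta>. T h \<zeta> * (k \<zeta> \<eta> * h \<eta>) \<partial>?M)"
        by (simp add: power2_eq_square nn_integral_cmult) (simp add: T_def)
    qed
    also have "\<dots> = (\<integral>\<^sup>+\<eta>. (\<integral>\<^sup>+\<zeta>. T h \<zeta> * (k \<zeta> \<eta> * h \<eta>) \<partial>?M) \<partial>?M)"
      by (rule circle2.Fubini') measurable
    also have "\<dots> = (\<integral>\<^sup>+\<eta>. h \<eta> * A (T h) \<eta> \<partial>?M)"
      unfolding A_def by (intro nn_integral_cong, subst nn_integral_cmult[symmetric]) (auto simp: mult_ac)
    finally show ?thesis
      unfolding N_def using Cauchy_Schwarz_nn_integral[of h ?M "A (T h)"] by simp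
  qed
  have TT: "N (A g) \<le> 8 * (\<integral>\<^sup>+\<zeta>. g \<zeta> * T g \<zeta> \<partial>?M)" if [measurable]: "g \<in> borel_measurable ?M" for g
    unfolding N_def A_def T_def k_def by (rule poisson_maximal_TTstar[OF \<rho> that \<rho>0 \<rho>1])
  have CS: "(\<integral>\<^sup>+\<zeta>. g \<zeta> * T g \<zeta> \<partial>?M)\<^sup>2 \<le> N g * N (T g)" if [measurable]: "g \<in> borel_measurable ?M" for g
    unfolding N_def by (rule Cauchy_Schwarz_nn_integral) measurable
  \<comment> \<open>V collects the admissible constants; positivity keeps the case of an infinite norm harmless.\<close>
  define V where "V = {S::real. 0 < S \<and> (\<forall>h\<in>borel_measurable ?M. N (T h) \<le> ennreal S * N h)}"
  \<comment> \<open>The kernel is bounded, which provides a first admissible constant.\<close>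
  have "(1 / (1-R)\<^sup>2)\<^sup>2 \<in> V"
  proof -
    let ?L = "1 / (1-R)\<^sup>2"
    have "N (T h) \<le> ennreal (?L\<^sup>2) * N h" if [measurable]: "h \<in> borel_measurable ?M" for h
    proof -
      have "N (T h) \<le> (\<integral>\<^sup>+\<zeta>. (ennreal ?L * (\<integral>\<^sup>+\<eta>. h \<eta> \<partial>?M))\<^sup>2 \<partial>?M)"
        unfolding N_def
      proof (intro nn_integral_mono power_mono)
        fix \<zeta> assume "\<zeta> \<in> space ?M"
        then have "T h \<zeta> \<le> (\<integral>\<^sup>+\<eta>. ennreal ?L * h \<eta> \<partial>?M)"
          unfolding T_def k_def
          by (intro nn_integral_mono mult_right_mono ennreal_leI poisson_le \<rho>0 \<rho>R R) auto
        then show "T h \<zeta> \<le> ennreal ?L * (\<integral>\<^sup>+\<eta>. h \<eta> \<partial>?M)" by (simp add: nn_integral_cmult)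
      qed auto
      also have "\<dots> = (ennreal ?L)\<^sup>2 * (\<integral>\<^sup>+\<eta>. h \<eta> \<partial>?M)\<^sup>2"
        by (simp add: circle.emeasure_space_1[simplified] power_mult_distrib)
      also have "\<dots> \<le> (ennreal ?L)\<^sup>2 * N h"
        using Cauchy_Schwarz_nn_integral[of h ?M "\<lambda>_. 1"]
        by (intro mult_left_mono) (auto simp: N_def circle.emeasure_space_1[simplified])
      also have "(ennreal ?L)\<^sup>2 = ennreal (?L\<^sup>2)" by (rule ennreal_power) auto
      finally show ?thesis .
    qed
    then show ?thesis using R by (auto simp: V_def)
  qed
  then have Vne: "V \<noteq> {}" by auto
  have Vbdd: "bdd_below V" by (rule bdd_belowI[of _ 0]) (auto simp: V_def)
  have finite_case: "enn2real (N (T h)) \<le> S * enn2real (N h)" "N (T h) < \<infinity>"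
    if "S \<in> V" "N h < \<infinity>" "h \<in> borel_measurable ?M" for S h
  proof -
    have le: "N (T h) \<le> ennreal S * N h" and S: "0 < S" using that by (auto simp: V_def)
    have "ennreal S * N h < \<infinity>" using that by (simp add: ennreal_mult_less_top)
    then show "N (T h) < \<infinity>" using le by (rule order.strict_trans1[rotated])
    have "enn2real (N (T h)) \<le> enn2real (ennreal S * N h)"
      by (rule enn2real_mono[OF le]) (use \<open>ennreal S * N h < \<infinity>\<close> in simp)
    then show "enn2real (N (T h)) \<le> S * enn2real (N h)" using S by (simp add: enn2real_mult)
  qed
  have step: "8 * sqrt S \<in> V" if S: "S \<in> V" for S
  proof -
    have S0: "0 < S" using S by (simp add: V_def)
    have "N (T h) \<le> ennreal (8 * sqrt S) * N h" if h [measurable]: "h \<in> borel_measurable ?M" for h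
    proof (cases "N h < \<infinity>")
      case False
      then have "N h = \<infinity>" by (simp add: less_top[symmetric])
      then show ?thesis using S0 by (simp add: ennreal_mult_top)
    next
      case True
      define a x I where "a = enn2real (N h)" and "x = enn2real (N (T h))"
        and "I = (\<integral>\<^sup>+\<zeta>. T h \<zeta> * T (T h) \<zeta> \<partial>?M)"
      have Nx: "N (T h) = ennreal x" and Na: "N h = ennreal a" and pos: "0 \<le> x" "0 \<le> a"
        using True finite_case(2)[OF S True h] by (auto simp: x_def a_def less_top)
      have "I\<^sup>2 \<le> N (T h) * N (T (T h))" unfolding I_def by (rule CS[OF T[OF h]])
      also have "\<dots> \<le> N (T h) * (ennreal S * N (T h))"
        using S T[OF h] by (intro mult_left_mono) (auto simp: V_def)
      also have "\<dots> = ennreal ((sqrt S * x)\<^sup>2)"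
        using S0 pos by (simp add: Nx ennreal_mult[symmetric] power2_eq_square mult_ac)
      finally have I2: "I\<^sup>2 \<le> ennreal ((sqrt S * x)\<^sup>2)" .
      then have "I \<noteq> \<infinity>" by (auto simp: power2_eq_square top_unique)
      then obtain i where i: "I = ennreal i" "0 \<le> i" by (cases I) auto
      then have "i\<^sup>2 \<le> (sqrt S * x)\<^sup>2" using I2 S0 pos by (simp add: ennreal_power)
      then have "i \<le> sqrt S * x" by (rule power2_le_imp_le) (use S0 pos in auto)
      then have I: "I \<le> ennreal (sqrt S * x)" unfolding i(1) by (rule ennreal_leI)
      have "ennreal (x\<^sup>2) = (N (T h))\<^sup>2" using pos by (simp add: Nx ennreal_power)
      also have "\<dots> \<le> N h * N (A (T h))" by (rule adjoint[OF h])
      also have "\<dots> \<le> N h * (8 * I)" unfolding I_def by (rule mult_left_mono[OF TT[OF T[OF h]]]) simp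
      also have "\<dots> \<le> N h * (8 * ennreal (sqrt S * x))" by (intro mult_left_mono I) auto
      also have "\<dots> = ennreal (a * (8 * (sqrt S * x)))"
        using S0 pos by (simp add: Na ennreal_mult)
      finally have "x\<^sup>2 \<le> a * (8 * (sqrt S * x))" using S0 pos by (simp add: ennreal_le_iff)
      then have "x * x \<le> (8 * sqrt S * a) * x" by (simp add: power2_eq_square mult_ac)
      then have "x \<le> 8 * sqrt S * a"
        using pos S0 by (cases "x = 0") (auto simp: mult_le_cancel_right)
      then show ?thesis using S0 pos by (simp add: Nx Na ennreal_mult[symmetric] ennreal_leI)
    qed
    then show ?thesis using S0 by (auto simp: V_def)
  qed
  define s where "s = Inf V"
  have s0: "0 \<le> s" unfolding s_def by (rule cInf_greatest[OF Vne]) (auto simp: V_def)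
  have "s\<^sup>2 / 64 \<le> s"
    unfolding s_def[symmetric]
  proof (subst (2) s_def, rule cInf_greatest[OF Vne])
    fix S assume S: "S \<in> V"
    have "s \<le> 8 * sqrt S" unfolding s_def by (rule cInf_lower[OF step[OF S] Vbdd])
    then have "s\<^sup>2 \<le> (8 * sqrt S)\<^sup>2" using s0 by (rule power_mono)
    then show "s\<^sup>2 / 64 \<le> S" using S by (simp add: power_mult_distrib V_def)
  qed
  then have s64: "s \<le> 64" using s0 by (cases "s = 0") (auto simp: power2_eq_square)
  have "N (T h) \<le> 64 * N h"
  proof (cases "N h < \<infinity>")
    case False
    then have "N h = \<infinity>" by (simp add: less_top[symmetric])
    then show ?thesis by (simp add: ennreal_mult_top)
  next
    case True
    define a x where "a = enn2real (N h)" and "x = enn2real (N (T h))"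
    obtain S0 where S0: "S0 \<in> V" using Vne by auto
    have Nx: "N (T h) = ennreal x" and Na: "N h = ennreal a" and pos: "0 \<le> x" "0 \<le> a"
      using True finite_case(2)[OF S0 True h] by (auto simp: x_def a_def less_top)
    have xS: "x \<le> S * a" if "S \<in> V" for S
      using finite_case(1)[OF that True h] by (simp add: x_def a_def)
    have "x \<le> s * a"
    proof (cases "a = 0")
      case True then show ?thesis using xS[OF S0] by simp
    next
      case False
      then have "x / a \<le> s" unfolding s_def
        by (intro cInf_greatest[OF Vne]) (use xS pos in \<open>auto simp: divide_le_eq\<close>)
      then show ?thesis using pos False by (simp add: divide_le_eq)
    qed
    also have "\<dots> \<le> 64 * a" using s64 pos by (intro mult_right_mono) auto
    finally have "ennreal x \<le> ennreal (64 * a)" by (rule ennreal_leI)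
    then show ?thesis by (simp add: Nx Na ennreal_mult')
  qed
  then show ?thesis by (simp add: N_def T_def k_def)
qed

section \<open>Radial limits of square-summable power series\<close>

text \<open>
  Square summability suffices for absolute convergence in the open disk, since \<open>2 x y \<le> x\<^sup>2 + y\<^sup>2\<close>.
\<close>

lemma square_summable_imp_abs_summable:
  assumes b: "summable (\<lambda>n. (cmod (b n))\<^sup>2)" and r: "0 \<le> r" "r < 1"
  shows "summable (\<lambda>n. cmod (b n) * r ^ n)"
proof (rule summable_comparison_test'[where N=0])
  have "r\<^sup>2 < 1" using r by (simp add: abs_square_less_1)
  then have "summable (\<lambda>n. (r\<^sup>2) ^ n)" by (intro summable_geometric) simp
  then show "summable (\<lambda>n. ((cmod (b n))\<^sup>2 + (r\<^sup>2) ^ n) / 2)"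
    by (intro summable_divide summable_add b)
  fix n
  have "0 \<le> (cmod (b n))\<^sup>2 + (r ^ n)\<^sup>2 - 2 * cmod (b n) * r ^ n"
    using zero_le_power2[of "cmod (b n) - r ^ n"] by (simp only: power2_diff)
  moreover have "(r ^ n)\<^sup>2 = (r\<^sup>2) ^ n" by (simp add: power_mult[symmetric] mult.commute)
  ultimately show "norm (cmod (b n) * r ^ n) \<le> ((cmod (b n))\<^sup>2 + (r\<^sup>2) ^ n) / 2"
    using r by (simp add: abs_mult)
qed

lemma pseries_dilate: "pseries (\<lambda>n. b n * c ^ n) w = pseries b (c * w)"
  by (simp add: pseries_def power_mult_distrib mult.assoc)

lemma square_summable_pseries_sums:
  assumes b: "summable (\<lambda>n. (cmod (b n))\<^sup>2)" and w: "cmod w < 1"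
  shows "(\<lambda>n. b n * w ^ n) sums pseries b w"
  unfolding pseries_def
  by (rule summable_sums[OF summable_norm_cancel])
     (use square_summable_imp_abs_summable[OF b norm_ge_zero w] in \<open>simp add: norm_mult norm_power\<close>)

lemma square_summable_pseries_isCont:
  assumes b: "summable (\<lambda>n. (cmod (b n))\<^sup>2)" and w: "cmod w < 1"
  shows "isCont (pseries b) w"
proof -
  define K where "K = (1 + cmod w) / 2"
  have K: "cmod w < K" "0 \<le> K" "K < 1" using w by (auto simp: K_def)
  have "summable (\<lambda>n. b n * (complex_of_real K) ^ n)"
    using square_summable_pseries_sums[OF b, of "of_real K"] K by (simp add: sums_iff)
  then show ?thesis
    unfolding pseries_def by (rule Transcendental.isCont_powser) (use K in simp)
qed

lemma dilated_parseval:
  assumes b: "summable (\<lambda>n. (cmod (b n))\<^sup>2)" and r: "0 \<le> r" "r < 1"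
  shows "summable (\<lambda>n. (cmod (b n) * r ^ n)\<^sup>2)"
    and "(\<integral>\<^sup>+\<zeta>. ennreal ((cmod (pseries b (of_real r * \<zeta>)))\<^sup>2) \<partial>circle_measure)
           = ennreal (\<Sum>n. (cmod (b n) * r ^ n)\<^sup>2)"
proof -
  have "summable (\<lambda>n. cmod (b n * of_real r ^ n))"
    using square_summable_imp_abs_summable[OF b r] r by (simp add: norm_mult norm_power)
  from circle_parseval[OF this] r show
    "summable (\<lambda>n. (cmod (b n) * r ^ n)\<^sup>2)"
    "(\<integral>\<^sup>+\<zeta>. ennreal ((cmod (pseries b (of_real r * \<zeta>)))\<^sup>2) \<partial>circle_measure)
           = ennreal (\<Sum>n. (cmod (b n) * r ^ n)\<^sup>2)"
    by (simp_all add: pseries_dilate norm_mult norm_power)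
qed

lemma dilated_sum_le:
  assumes b: "summable (\<lambda>n. (cmod (b n))\<^sup>2)" and r: "0 \<le> r" "r < 1"
  shows "(\<Sum>n. (cmod (b n) * r ^ n)\<^sup>2) \<le> (\<Sum>n. (cmod (b n))\<^sup>2)"
  by (rule suminf_le[OF _ dilated_parseval(1)[OF b r] b])
     (use r in \<open>auto intro!: power_mono mult_right_le_one_le power_le_one\<close>)

text \<open>
  Dilating by a factor between \<open>R\<close> and \<open>1\<close> makes the coefficients absolutely summable at the price of slightly
  larger radii. The dilated function is the Poisson integral of its boundary values, so its modulus is at most a Poisson
  average of a nonnegative function, to which the bound for varying radii applies.
\<close>

lemma linearised_radial_maximal:
  assumes b: "summable (\<lambda>n. (cmod (b n))\<^sup>2)"
    and \<rho> [measurable]: "\<rho> \<in> borel_measurable circle_measure"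
    and \<rho>0: "\<And>\<zeta>. 0 \<le> \<rho> \<zeta>" and \<rho>R: "\<And>\<zeta>. \<rho> \<zeta> \<le> R" and R: "R < 1"
  shows "(\<integral>\<^sup>+\<zeta>. ennreal ((cmod (pseries b (of_real (\<rho> \<zeta>) * \<zeta>)))\<^sup>2) \<partial>circle_measure)
           \<le> ennreal (64 * (\<Sum>n. (cmod (b n))\<^sup>2))"
proof -
  have R0: "0 \<le> R" using \<rho>0[of 0] \<rho>R[of 0] by simp
  \<comment> \<open>Any number strictly between R and 1 would do.\<close>
  define \<delta> where "\<delta> = (1 + R) / 2"
  have \<delta>: "0 < \<delta>" "\<delta> < 1" "R < \<delta>" using R R0 by (auto simp: \<delta>_def)
  define c where "c = (\<lambda>n. b n * of_real \<delta> ^ n)"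
  have c: "summable (\<lambda>n. cmod (c n))"
    using square_summable_imp_abs_summable[OF b, of \<delta>] \<delta> by (simp add: c_def norm_mult norm_power)
  define \<sigma> where "\<sigma> = (\<lambda>\<zeta>. \<rho> \<zeta> / \<delta>)"
  have \<sigma> [measurable]: "\<sigma> \<in> borel_measurable circle_measure" unfolding \<sigma>_def by measurable
  have \<sigma>0: "0 \<le> \<sigma> \<zeta>" and \<sigma>R: "\<sigma> \<zeta> \<le> R / \<delta>" for \<zeta>
    using \<rho>0 \<rho>R \<delta> by (auto simp: \<sigma>_def divide_right_mono)
  have R\<delta>: "R / \<delta> < 1" using \<delta> by simp
  have \<sigma>1: "\<sigma> \<zeta> < 1" for \<zeta> using \<sigma>R[of \<zeta>] R\<delta> by simp
  have "(\<integral>\<^sup>+\<zeta>. ennreal ((cmod (pseries b (of_real (\<rho> \<zeta>) * \<zeta>)))\<^sup>2) \<partial>circle_measure)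
      \<le> (\<integral>\<^sup>+\<zeta>. (\<integral>\<^sup>+\<eta>. ennreal (poisson (\<sigma> \<zeta>) \<zeta> \<eta>) * ennreal (cmod (pseries c \<eta>)) \<partial>circle_measure)\<^sup>2 \<partial>circle_measure)"
  proof (rule nn_integral_mono)
    fix \<zeta> assume "\<zeta> \<in> space circle_measure"
    then have z: "cmod \<zeta> = 1" by simp
    have int: "integrable circle_measure (\<lambda>\<eta>. pseries c \<eta> * complex_of_real (poisson (\<sigma> \<zeta>) \<zeta> \<eta>))"
    proof (rule circle_integrable_bounded)
      show "cmod (pseries c \<eta> * complex_of_real (poisson (\<sigma> \<zeta>) \<zeta> \<eta>))
          \<le> (\<Sum>n. cmod (c n)) * (1 / (1 - \<sigma> \<zeta>)\<^sup>2)" if "cmod \<eta> = 1" for \<eta>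
        unfolding norm_mult
        by (intro mult_mono norm_pseries_le[OF c] suminf_nonneg c)
           (use that poisson_nonneg[OF \<sigma>0 \<sigma>1] poisson_le[OF z that \<sigma>0 order_refl \<sigma>1] in auto)
    qed measurable
    have "pseries b (of_real (\<rho> \<zeta>) * \<zeta>) = pseries c (of_real (\<sigma> \<zeta>) * \<zeta>)"
      using \<delta> by (simp add: c_def pseries_dilate \<sigma>_def)
    also have "\<dots> = (\<integral>\<eta>. pseries c \<eta> * complex_of_real (poisson (\<sigma> \<zeta>) \<zeta> \<eta>) \<partial>circle_measure)"
      by (rule poisson_reproduces[OF c z \<sigma>0 \<sigma>1, symmetric])
    finally have "ennreal (cmod (pseries b (of_real (\<rho> \<zeta>) * \<zeta>)))
        \<le> (\<integral>\<^sup>+\<eta>. norm (pseries c \<eta> * complex_of_real (poisson (\<sigma> \<zeta>) \<zeta> \<eta>)) \<partial>circle_measure)"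
      using integral_norm_bound_ennreal[OF int] by simp
    also have "\<dots> = (\<integral>\<^sup>+\<eta>. ennreal (poisson (\<sigma> \<zeta>) \<zeta> \<eta>) * ennreal (cmod (pseries c \<eta>)) \<partial>circle_measure)"
      by (rule nn_integral_cong)
         (simp add: norm_mult ennreal_mult poisson_nonneg[OF \<sigma>0 \<sigma>1] mult.commute)
    finally show "ennreal ((cmod (pseries b (of_real (\<rho> \<zeta>) * \<zeta>)))\<^sup>2)
      \<le> (\<integral>\<^sup>+\<eta>. ennreal (poisson (\<sigma> \<zeta>) \<zeta> \<eta>) * ennreal (cmod (pseries c \<eta>)) \<partial>circle_measure)\<^sup>2"
      by (simp add: ennreal_power[symmetric] power_mono)
  qed
  also have "\<dots> \<le> 64 * (\<integral>\<^sup>+\<eta>. (ennreal (cmod (pseries c \<eta>)))\<^sup>2 \<partial>circle_measure)"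
    by (rule poisson_maximal[OF \<sigma> _ \<sigma>0 \<sigma>R R\<delta>]) measurable
  also have "(\<integral>\<^sup>+\<eta>. (ennreal (cmod (pseries c \<eta>)))\<^sup>2 \<partial>circle_measure) = ennreal (\<Sum>n. (cmod (c n))\<^sup>2)"
    using circle_parseval(2)[OF c] by (simp add: ennreal_power)
  also have "(\<Sum>n. (cmod (c n))\<^sup>2) \<le> (\<Sum>n. (cmod (b n))\<^sup>2)"
    using dilated_sum_le[OF b, of \<delta>] \<delta> by (simp add: c_def norm_mult norm_power)
  finally show ?thesis by (simp add: ennreal_mult' ennreal_leI mult_left_mono)
qed

text \<open>
  A measurable selection of the radius, among the first \<open>m + 1\<close> terms of \<open>q\<close>, at which \<open>g\<close> is largest on
  the ray through \<open>\<zeta>\<close>. The recursion makes measurability immediate.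
\<close>

primrec best_radius :: "(complex \<Rightarrow> complex) \<Rightarrow> (nat \<Rightarrow> real) \<Rightarrow> nat \<Rightarrow> complex \<Rightarrow> real" where
  "best_radius g q 0 \<zeta> = q 0"
| "best_radius g q (Suc m) \<zeta> =
     (if cmod (g (of_real (best_radius g q m \<zeta>) * \<zeta>)) < cmod (g (of_real (q (Suc m)) * \<zeta>))
      then q (Suc m) else best_radius g q m \<zeta>)"

lemma measurable_best_radius [measurable]:
  assumes [measurable]: "g \<in> borel_measurable borel"
  shows "best_radius g q m \<in> borel_measurable circle_measure"
proof (induction m)
  case (Suc m)
  note [measurable] = Suc
  show ?case by simp
qed simp

lemma best_radius_in: "best_radius g q m \<zeta> \<in> q ` {..m}"
  by (induction m) (auto simp: atMost_Suc)

lemma best_radius_best: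
  "i \<le> m \<Longrightarrow> cmod (g (of_real (q i) * \<zeta>)) \<le> cmod (g (of_real (best_radius g q m \<zeta>) * \<zeta>))"
  by (induction m) (auto simp: le_Suc_eq intro: less_imp_le order_trans)

text \<open>
  The maximal function is an increasing limit of maxima over finitely many rational radii, each of which is
  covered by the linearised inequality. Continuity inside the disk passes from rational to all radii.
\<close>

lemma radial_maximal_function:
  assumes b: "summable (\<lambda>n. (cmod (b n))\<^sup>2)"
  obtains Mx :: "complex \<Rightarrow> ennreal" where "Mx \<in> borel_measurable circle_measure"
    and "\<And>\<zeta> r. cmod \<zeta> = 1 \<Longrightarrow> 0 \<le> r \<Longrightarrow> r < 1 \<Longrightarrow> ennreal ((cmod (pseries b (of_real r * \<zeta>)))\<^sup>2) \<le> Mx \<zeta>"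
    and "(\<integral>\<^sup>+\<zeta>. Mx \<zeta> \<partial>circle_measure) \<le> ennreal (64 * (\<Sum>n. (cmod (b n))\<^sup>2))"
proof -
  let ?D = "\<rat> \<inter> {0..<1::real}"
  define q where "q = from_nat_into ?D"
  have "0 \<in> ?D" by simp
  then have D: "?D \<noteq> {}" "countable ?D" by (blast, simp add: countable_rat)
  have q: "range q = ?D" unfolding q_def by (rule range_from_nat_into[OF D])
  have q01: "0 \<le> q i" "q i < 1" for i using q by (auto simp: set_eq_iff)
  define u where "u = (\<lambda>m \<zeta>. ennreal ((cmod (pseries b (of_real (best_radius (pseries b) q m \<zeta>) * \<zeta>)))\<^sup>2))"
  have u [measurable]: "u m \<in> borel_measurable circle_measure" for m
    unfolding u_def by measurable
  define Mx where "Mx = (\<lambda>\<zeta>. SUP m. u m \<zeta>)"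
  have inc: "incseq u"
    unfolding u_def incseq_Suc_iff le_fun_def by (auto intro!: ennreal_leI power_mono)
  have "(\<integral>\<^sup>+\<zeta>. u m \<zeta> \<partial>circle_measure) \<le> ennreal (64 * (\<Sum>n. (cmod (b n))\<^sup>2))" for m
    unfolding u_def
  proof (rule linearised_radial_maximal[OF b])
    show "0 \<le> best_radius (pseries b) q m \<zeta>" "best_radius (pseries b) q m \<zeta> \<le> Max (q ` {..m})" for \<zeta>
      using best_radius_in[of "pseries b" q m \<zeta>] q01 by (auto intro: Max_ge)
    show "Max (q ` {..m}) < 1" using q01 by (subst Max_less_iff) auto
  qed measurable
  then have int: "(\<integral>\<^sup>+\<zeta>. Mx \<zeta> \<partial>circle_measure) \<le> ennreal (64 * (\<Sum>n. (cmod (b n))\<^sup>2))"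
    unfolding Mx_def by (subst nn_integral_monotone_convergence_SUP[OF inc]) (auto intro: SUP_least)
  have bound: "ennreal ((cmod (pseries b (of_real r * \<zeta>)))\<^sup>2) \<le> Mx \<zeta>"
    if z: "cmod \<zeta> = 1" and r: "0 \<le> r" "r < 1" for \<zeta> r
  proof -
    have Q: "ennreal ((cmod (pseries b (of_real (q i) * \<zeta>)))\<^sup>2) \<le> Mx \<zeta>" for i
    proof -
      have "ennreal ((cmod (pseries b (of_real (q i) * \<zeta>)))\<^sup>2) \<le> u i \<zeta>"
        unfolding u_def by (intro ennreal_leI power_mono best_radius_best) auto
      also have "\<dots> \<le> Mx \<zeta>" unfolding Mx_def by (rule SUP_upper) simp
      finally show ?thesis .
    qed
    have "\<exists>t\<in>\<rat>. r < t \<and> t < min 1 (r + 1 / real (Suc k))" for k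
      by (rule Rats_dense_in_real) (use r in simp)
    then obtain t where t: "\<And>k. t k \<in> \<rat>" "\<And>k. r < t k" "\<And>k. t k < min 1 (r + 1 / real (Suc k))"
      by metis
    have "t \<longlonglongrightarrow> r"
    proof (rule real_tendsto_sandwich)
      show "(\<lambda>k. r) \<longlonglongrightarrow> r" by simp
      show "(\<lambda>k. r + 1 / real (Suc k)) \<longlonglongrightarrow> r"
        using tendsto_add[OF tendsto_const[of r] LIMSEQ_inverse_real_of_nat] by (simp add: inverse_eq_divide)
    qed (use t in \<open>auto intro!: always_eventually less_imp_le simp: less_imp_le\<close>)
    then have lim: "(\<lambda>k. complex_of_real (t k) * \<zeta>) \<longlonglongrightarrow> of_real r * \<zeta>" by (intro tendsto_intros)
    have "isCont (pseries b) (of_real r * \<zeta>)"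
      by (rule square_summable_pseries_isCont[OF b]) (use r z in \<open>simp add: norm_mult\<close>)
    from isCont_tendsto_compose[OF this lim]
    have A: "(\<lambda>k. ennreal ((cmod (pseries b (of_real (t k) * \<zeta>)))\<^sup>2)) \<longlonglongrightarrow> ennreal ((cmod (pseries b (of_real r * \<zeta>)))\<^sup>2)"
      by (intro tendsto_ennrealI tendsto_intros)
    have B: "ennreal ((cmod (pseries b (of_real (t k) * \<zeta>)))\<^sup>2) \<le> Mx \<zeta>" for k
    proof -
      have "t k \<in> range q" unfolding q using t(1)[of k] t(2)[of k] t(3)[of k] r by auto
      then show ?thesis using Q by auto
    qed
    show ?thesis by (rule LIMSEQ_le_const2[OF A]) (use B in blast)
  qed
  show ?thesis by (rule that[OF _ bound int]) (auto simp: Mx_def)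
qed

lemma cauchy_at_left_convergent:
  fixes h :: "real \<Rightarrow> complex"
  assumes "\<And>e. 0 < e \<Longrightarrow> \<exists>d<1. \<forall>r s. d < r \<longrightarrow> r < 1 \<longrightarrow> d < s \<longrightarrow> s < 1 \<longrightarrow> cmod (h r - h s) < e"
  shows "\<exists>L. (h \<longlongrightarrow> L) (at_left 1)"
proof -
  define t where "t = (\<lambda>k. 1 - 1 / real (Suc k))"
  have t1: "t k < 1" for k by (simp add: t_def)
  have tlim: "t \<longlonglongrightarrow> 1"
    unfolding t_def using tendsto_diff[OF tendsto_const[of 1] LIMSEQ_inverse_real_of_nat] by (simp add: inverse_eq_divide)
  have "Cauchy (\<lambda>k. h (t k))"
  proof (rule CauchyI)
    fix e :: real assume "0 < e"
    then obtain d where d: "d < 1" "\<And>r s. d < r \<Longrightarrow> r < 1 \<Longrightarrow> d < s \<Longrightarrow> s < 1 \<Longrightarrow> cmod (h r - h s) < e"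
      using assms by meson
    obtain N where "\<And>k. N \<le> k \<Longrightarrow> d < t k"
      using order_tendstoD(1)[OF tlim d(1)] by (auto simp: eventually_sequentially)
    then show "\<exists>M. \<forall>m\<ge>M. \<forall>n\<ge>M. norm (h (t m) - h (t n)) < e" using d(2) t1 by blast
  qed
  then obtain L where L: "(\<lambda>k. h (t k)) \<longlonglongrightarrow> L" using Cauchy_convergent_iff convergent_def by blast
  have "(h \<longlongrightarrow> L) (at_left 1)"
  proof (rule tendstoI)
    fix e :: real assume e: "0 < e"
    then obtain d where d: "d < 1" "\<And>r s. d < r \<Longrightarrow> r < 1 \<Longrightarrow> d < s \<Longrightarrow> s < 1 \<Longrightarrow> cmod (h r - h s) < e / 2"
      using assms[OF half_gt_zero[OF e]] by meson
    have "\<forall>\<^sub>F k in sequentially. d < t k \<and> dist (h (t k)) L < e / 2"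
      using order_tendstoD(1)[OF tlim d(1)] tendstoD[OF L, of "e / 2"] e by (auto intro: eventually_conj)
    then obtain k where k: "d < t k" "dist (h (t k)) L < e / 2"
      by (auto simp: eventually_sequentially)
    have "dist (h r) L < e" if "d < r" "r < 1" for r
    proof -
      have "dist (h r) L \<le> dist (h r) (h (t k)) + dist (h (t k)) L" by (rule dist_triangle)
      also have "dist (h r) (h (t k)) < e / 2" using d(2)[OF that k(1) t1] by (simp add: dist_norm)
      finally show ?thesis using k(2) by simp
    qed
    then show "\<forall>\<^sub>F r in at_left 1. dist (h r) L < e"
      using d(1) by (auto simp: eventually_at_left_field)
  qed
  then show ?thesis ..
qed

text \<open>
  A polynomial has radial limits everywhere, and the maximal function of a tail of the series bounds the
  oscillation that the tail can add. The integrals of the maximal functions of the tails tend to zero, so their infimum vanishes almost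
  everywhere, and at such points the Cauchy criterion holds.
\<close>

lemma radial_limit_AE:
  assumes b: "summable (\<lambda>n. (cmod (b n))\<^sup>2)"
  shows "AE \<zeta> in circle_measure. \<exists>L. ((\<lambda>r. pseries b (of_real r * \<zeta>)) \<longlongrightarrow> L) (at_left 1)"
proof -
  define tl where "tl = (\<lambda>m n. if n < m then 0 else b n)"
  have tl_shift: "(\<lambda>n. (cmod (tl m (n + m)))\<^sup>2) = (\<lambda>n. (cmod (b (n + m)))\<^sup>2)" for m
    by (simp add: tl_def)
  have tl: "summable (\<lambda>n. (cmod (tl m n))\<^sup>2)" for m
    by (subst summable_iff_shift[of _ m, symmetric])
       (simp only: tl_shift summable_ignore_initial_segment[OF b])
  have tl_sum: "(\<Sum>n. (cmod (tl m n))\<^sup>2) = (\<Sum>n. (cmod (b (n + m)))\<^sup>2)" for m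
    using suminf_split_initial_segment[OF tl[of m], of m] by (simp add: tl_def)
  define p where "p = (\<lambda>m w. \<Sum>n<m. b n * w ^ n)"
  have split: "pseries b w = p m w + pseries (tl m) w" if w: "cmod w < 1" for m w
  proof -
    have s: "(\<lambda>n. b n * w ^ n) sums pseries b w" "(\<lambda>n. tl m n * w ^ n) sums pseries (tl m) w"
      by (rule square_summable_pseries_sums[OF b w], rule square_summable_pseries_sums[OF tl w])
    have "(\<lambda>n. b n * w ^ n - tl m n * w ^ n) sums p m w"
      unfolding p_def
      by (rule sums_cong[THEN iffD1, OF _ sums_If_finite_set[of "{..<m}" "\<lambda>n. b n * w ^ n"]]) (auto simp: tl_def)
    then have "pseries b w - pseries (tl m) w = p m w"
      using sums_diff[OF s] sums_unique2 by blast
    then show ?thesis by (simp add: algebra_simps)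
  qed
  have "\<exists>Mx. Mx \<in> borel_measurable circle_measure \<and>
      (\<forall>\<zeta> r. cmod \<zeta> = 1 \<longrightarrow> 0 \<le> r \<longrightarrow> r < 1 \<longrightarrow> ennreal ((cmod (pseries (tl m) (of_real r * \<zeta>)))\<^sup>2) \<le> Mx \<zeta>) \<and>
      (\<integral>\<^sup>+\<zeta>. Mx \<zeta> \<partial>circle_measure) \<le> ennreal (64 * (\<Sum>n. (cmod (tl m n))\<^sup>2))" for m
    using radial_maximal_function[OF tl[of m]] by metis
  then obtain Mx where Mx [measurable]: "\<And>m. Mx m \<in> borel_measurable circle_measure"
    and Mx_ge: "\<And>m \<zeta> r. cmod \<zeta> = 1 \<Longrightarrow> 0 \<le> r \<Longrightarrow> r < 1 \<Longrightarrow>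
        ennreal ((cmod (pseries (tl m) (of_real r * \<zeta>)))\<^sup>2) \<le> Mx m \<zeta>"
    and Mx_int: "\<And>m. (\<integral>\<^sup>+\<zeta>. Mx m \<zeta> \<partial>circle_measure) \<le> ennreal (64 * (\<Sum>n. (cmod (tl m n))\<^sup>2))"
    by metis
  have "(\<integral>\<^sup>+\<zeta>. (INF m. Mx m \<zeta>) \<partial>circle_measure) \<le> ennreal (64 * (\<Sum>n. (cmod (b (n + m)))\<^sup>2))" for m
  proof -
    have "(\<integral>\<^sup>+\<zeta>. (INF m. Mx m \<zeta>) \<partial>circle_measure) \<le> (\<integral>\<^sup>+\<zeta>. Mx m \<zeta> \<partial>circle_measure)"
      by (intro nn_integral_mono INF_lower) simp
    also note Mx_int[of m]
    finally show ?thesis by (simp only: tl_sum)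
  qed
  moreover have "(\<lambda>m. ennreal (64 * (\<Sum>n. (cmod (b (n + m)))\<^sup>2))) \<longlonglongrightarrow> ennreal (64 * 0)"
    by (intro tendsto_ennrealI tendsto_intros suminf_exist_split2[OF b])
  ultimately have "(\<integral>\<^sup>+\<zeta>. (INF m. Mx m \<zeta>) \<partial>circle_measure) \<le> ennreal (64 * 0)"
    by (intro LIMSEQ_le_const) auto
  then have "(\<integral>\<^sup>+\<zeta>. (INF m. Mx m \<zeta>) \<partial>circle_measure) = 0" by simp
  then have "AE \<zeta> in circle_measure. (INF m. Mx m \<zeta>) = 0"
    by (subst (asm) nn_integral_0_iff_AE) auto
  then show ?thesis
    using AE_space
  proof eventually_elim
    case (elim \<zeta>)
    then have z: "cmod \<zeta> = 1" and inf: "(INF m. Mx m \<zeta>) = 0" by auto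
    show ?case
    proof (rule cauchy_at_left_convergent)
      fix e :: real assume e: "0 < e"
      then have "(INF m. Mx m \<zeta>) < ennreal ((e / 4)\<^sup>2)" by (simp add: inf)
      then obtain m where m: "Mx m \<zeta> < ennreal ((e / 4)\<^sup>2)" by (auto simp: INF_less_iff)
      have small: "cmod (pseries (tl m) (of_real r * \<zeta>)) < e / 4" if "0 \<le> r" "r < 1" for r
      proof (rule power_less_imp_less_base)
        have "ennreal ((cmod (pseries (tl m) (of_real r * \<zeta>)))\<^sup>2) < ennreal ((e / 4)\<^sup>2)"
          using Mx_ge[OF z that] m by (rule le_less_trans)
        then show "(cmod (pseries (tl m) (of_real r * \<zeta>)))\<^sup>2 < (e / 4)\<^sup>2"
          by (simp add: ennreal_less_iff)
      qed (use e in simp)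
      have "((\<lambda>r. p m (of_real r * \<zeta>)) \<longlongrightarrow> p m (of_real 1 * \<zeta>)) (at_left 1)"
        unfolding p_def by (intro tendsto_intros)
      then have "\<forall>\<^sub>F r in at_left 1. dist (p m (of_real r * \<zeta>)) (p m (of_real 1 * \<zeta>)) < e / 4"
        by (rule tendstoD) (use e in simp)
      then obtain d where d: "d < 1"
        "\<And>r. d < r \<Longrightarrow> r < 1 \<Longrightarrow> dist (p m (of_real r * \<zeta>)) (p m (of_real 1 * \<zeta>)) < e / 4"
        by (auto simp: eventually_at_left_field)
      have "cmod (pseries b (of_real r * \<zeta>) - pseries b (of_real s * \<zeta>)) < e"
        if rs: "max 0 d < r" "r < 1" "max 0 d < s" "s < 1" for r s
      proof -
        have *: "dist (pseries b (of_real t * \<zeta>)) (p m (of_real 1 * \<zeta>)) < e / 2" if t: "max 0 d < t" "t < 1" for t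
        proof -
          have "dist (pseries b (of_real t * \<zeta>)) (p m (of_real t * \<zeta>)) = cmod (pseries (tl m) (of_real t * \<zeta>))"
            using t z by (subst split[of _ m]) (auto simp: norm_mult dist_norm)
          also have "\<dots> < e / 4" by (rule small) (use t in auto)
          finally show ?thesis
            using d(2)[of t] t dist_triangle[of "pseries b (of_real t * \<zeta>)" "p m (of_real 1 * \<zeta>)" "p m (of_real t * \<zeta>)"]
            by auto
        qed
        show ?thesis
          using *[OF rs(1,2)] *[OF rs(3,4)] dist_triangle2[of "pseries b (of_real r * \<zeta>)" "pseries b (of_real s * \<zeta>)" "p m (of_real 1 * \<zeta>)"]
          by (simp add: dist_norm)
      qed
      then show "\<exists>d<1. \<forall>r s. d < r \<longrightarrow> r < 1 \<longrightarrow> d < s \<longrightarrow> s < 1 \<longrightarrow>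
            cmod (pseries b (of_real r * \<zeta>) - pseries b (of_real s * \<zeta>)) < e"
        using d(1) by (intro exI[of _ "max 0 d"]) auto
    qed
  qed
qed

text \<open>
  The maximal function is an integrable majorant of \<open>|f(r \<zeta>)|\<^sup>2\<close>, so the circle integrals converge to the
  integral of the radial limit.
\<close>

theorem boundary_norm:
  assumes b: "summable (\<lambda>n. (cmod (b n))\<^sup>2)" and f: "\<And>w. cmod w < 1 \<Longrightarrow> f w = pseries b w"
  shows "(\<integral>\<^sup>+\<zeta>. ennreal ((cmod (boundary_value f \<zeta>))\<^sup>2) \<partial>circle_measure) = ennreal (\<Sum>n. (cmod (b n))\<^sup>2)"
proof -
  define t where "t = (\<lambda>k. 1 - 1 / real (Suc k))"
  have t: "0 \<le> t k" "t k < 1" for k by (auto simp: t_def)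
  have tlim: "t \<longlonglongrightarrow> 1"
    unfolding t_def using tendsto_diff[OF tendsto_const[of 1] LIMSEQ_inverse_real_of_nat] by (simp add: inverse_eq_divide)
  moreover have "t k \<noteq> 1" for k using t(2)[of k] by simp
  ultimately have tleft: "filterlim t (at_left 1) sequentially"
    using t(2) by (auto simp: filterlim_at intro!: always_eventually)
  obtain Mx where Mx [measurable]: "Mx \<in> borel_measurable circle_measure"
    and Mx_ge: "\<And>\<zeta> r. cmod \<zeta> = 1 \<Longrightarrow> 0 \<le> r \<Longrightarrow> r < 1 \<Longrightarrow> ennreal ((cmod (pseries b (of_real r * \<zeta>)))\<^sup>2) \<le> Mx \<zeta>"
    and Mx_int: "(\<integral>\<^sup>+\<zeta>. Mx \<zeta> \<partial>circle_measure) \<le> ennreal (64 * (\<Sum>n. (cmod (b n))\<^sup>2))"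
    using radial_maximal_function[OF b] by metis
  define u where "u = (\<lambda>k \<zeta>. ennreal ((cmod (pseries b (of_real (t k) * \<zeta>)))\<^sup>2))"
  have u [measurable]: "u k \<in> borel_measurable circle_measure" for k unfolding u_def by measurable
  have conv: "AE \<zeta> in circle_measure. (\<lambda>k. u k \<zeta>) \<longlonglongrightarrow> ennreal ((cmod (boundary_value f \<zeta>))\<^sup>2)"
    using radial_limit_AE[OF b] AE_space
  proof eventually_elim
    case (elim \<zeta>)
    then obtain L where L: "((\<lambda>r. pseries b (of_real r * \<zeta>)) \<longlongrightarrow> L) (at_left 1)" and z: "cmod \<zeta> = 1" by auto
    have "\<forall>\<^sub>F r in at_left 1. pseries b (of_real r * \<zeta>) = f (of_real r * \<zeta>)"
      unfolding eventually_at_left_field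
      by (rule exI[of _ 0]) (use z in \<open>auto simp: f norm_mult\<close>)
    then have "((\<lambda>r. f (of_real r * \<zeta>)) \<longlongrightarrow> L) (at_left 1)"
      using L by (rule Lim_transform_eventually[rotated])
    then have bv: "boundary_value f \<zeta> = L"
      unfolding boundary_value_def by (intro tendsto_Lim) auto
    show ?case unfolding u_def bv
      by (intro tendsto_ennrealI tendsto_intros filterlim_compose[OF L tleft])
  qed
  \<comment> \<open>The boundary function itself is not visibly measurable, as it takes default values where the limit fails to exist; v is a measurable version.\<close>
  define v where "v = (\<lambda>\<zeta>. liminf (\<lambda>k. u k \<zeta>))"
  have v: "AE \<zeta> in circle_measure. v \<zeta> = ennreal ((cmod (boundary_value f \<zeta>))\<^sup>2)"
    using conv unfolding v_def by eventually_elim (auto intro: lim_imp_Liminf)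
  have vm [measurable]: "v \<in> borel_measurable circle_measure" unfolding v_def by measurable
  have "(\<lambda>k. \<integral>\<^sup>+\<zeta>. u k \<zeta> \<partial>circle_measure) \<longlonglongrightarrow> (\<integral>\<^sup>+\<zeta>. v \<zeta> \<partial>circle_measure)"
  proof (rule nn_integral_dominated_convergence[OF u vm Mx])
    show "AE \<zeta> in circle_measure. u k \<zeta> \<le> Mx \<zeta>" for k
      unfolding u_def by (rule AE_I2) (use Mx_ge t in auto)
    show "(\<integral>\<^sup>+\<zeta>. Mx \<zeta> \<partial>circle_measure) < \<infinity>"
      using Mx_int by (rule le_less_trans) simp
    show "AE \<zeta> in circle_measure. (\<lambda>k. u k \<zeta>) \<longlonglongrightarrow> v \<zeta>"
      using conv v by eventually_elim simp
  qed
  moreover have "(\<integral>\<^sup>+\<zeta>. u k \<zeta> \<partial>circle_measure) = ennreal (\<Sum>n. (cmod (b n) * t k ^ n)\<^sup>2)" for k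
    unfolding u_def by (rule dilated_parseval(2)[OF b t])
  moreover have "(\<lambda>k. ennreal (\<Sum>n. (cmod (b n) * t k ^ n)\<^sup>2)) \<longlonglongrightarrow> ennreal (\<Sum>n. (cmod (b n))\<^sup>2)"
  proof (rule tendsto_ennrealI)
    have "((\<lambda>k. \<Sum>n. (cmod (b n) * t k ^ n)\<^sup>2) \<longlongrightarrow> (\<Sum>n. (cmod (b n) * 1 ^ n)\<^sup>2)) sequentially"
    proof (rule tannerys_theorem[THEN conjunct2, THEN conjunct2, OF _ _ b])
      show "(\<lambda>k. (cmod (b n) * t k ^ n)\<^sup>2) \<longlonglongrightarrow> (cmod (b n) * 1 ^ n)\<^sup>2" for n
        by (intro tendsto_intros tlim)
      show "\<forall>\<^sub>F (n, k) in sequentially \<times>\<^sub>F sequentially. norm ((cmod (b n) * t k ^ n)\<^sup>2) \<le> (cmod (b n))\<^sup>2"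
        by (rule always_eventually)
           (use t in \<open>auto simp: less_imp_le intro!: power_mono mult_right_le_one_le power_le_one\<close>)
    qed simp
    then show "(\<lambda>k. \<Sum>n. (cmod (b n) * t k ^ n)\<^sup>2) \<longlonglongrightarrow> (\<Sum>n. (cmod (b n))\<^sup>2)" by simp
  qed
  ultimately have "(\<integral>\<^sup>+\<zeta>. v \<zeta> \<partial>circle_measure) = ennreal (\<Sum>n. (cmod (b n))\<^sup>2)"
    using LIMSEQ_unique by simp
  then show ?thesis using nn_integral_cong_AE[OF v] by simp
qed

section \<open>Algebra of the Pick matrices\<close>

text \<open>
  In \<open>H\<^sup>2\<close> this is the combination of reproducing kernels with coefficients \<open>c\<close>. Its values at the nodes form
  the product of the Pick matrix with \<open>c\<close>.
\<close>

definition kernel_sum :: "(nat \<Rightarrow> complex) \<Rightarrow> nat \<Rightarrow> (nat \<Rightarrow> complex) \<Rightarrow> complex \<Rightarrow> complex" where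
  "kernel_sum z n c w = (\<Sum>j\<le>n. c j / (1 - w * cnj (z j)))"

text \<open>
  The Taylor coefficients of \<open>kernel_sum\<close>.
\<close>

definition kernel_coeff :: "(nat \<Rightarrow> complex) \<Rightarrow> nat \<Rightarrow> (nat \<Rightarrow> complex) \<Rightarrow> nat \<Rightarrow> complex" where
  "kernel_coeff z n c m = (\<Sum>j\<le>n. c j * cnj (z j) ^ m)"

text \<open>
  The quadratic form of the Pick matrix. The sum is already real, and it equals the squared \<open>H\<^sup>2\<close> norm of \<open>kernel_sum\<close>.
\<close>

definition pick_form :: "(nat \<Rightarrow> complex) \<Rightarrow> nat \<Rightarrow> (nat \<Rightarrow> complex) \<Rightarrow> real" where
  "pick_form z n c = Re (\<Sum>i\<le>n. cnj (c i) * kernel_sum z n c (z i))"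

text \<open>
  Up to a unimodular factor, the derivative at \<open>z j\<close> of the Blaschke product with zeros \<open>z 0, \<dots>, z n\<close>. The factors
  with \<open>l \<noteq> j\<close> are evaluated at \<open>z j\<close>, and the one with \<open>l = j\<close> contributes \<open>1 / (1 - |z j|\<^sup>2)\<close>.
\<close>

definition blaschke_deriv :: "(nat \<Rightarrow> complex) \<Rightarrow> nat \<Rightarrow> nat \<Rightarrow> complex" where
  "blaschke_deriv z n j = (\<Prod>l\<in>{..n}-{j}. z j - z l) / (\<Prod>l\<le>n. 1 - z j * cnj (z l))"

lemma one_minus_cnj_nonzero:
  assumes "cmod a < 1" "cmod b \<le> 1"
  shows "1 - a * cnj b \<noteq> 0" "1 - b * cnj a \<noteq> 0"
proof -
  have "cmod a * cmod b < 1"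
    using assms by (meson mult_left_le norm_ge_zero order.strict_trans1)
  then have "cmod (a * cnj b) < 1" "cmod (b * cnj a) < 1" by (auto simp: norm_mult mult.commute)
  then show "1 - a * cnj b \<noteq> 0" "1 - b * cnj a \<noteq> 0" by auto
qed

lemma kernel_coeff_sums:
  assumes z: "\<And>k. cmod (z k) < 1" and w: "cmod w \<le> 1"
  shows "(\<lambda>m. kernel_coeff z n c m * w ^ m) sums kernel_sum z n c w"
proof -
  have "(\<lambda>m. \<Sum>j\<le>n. c j * (w * cnj (z j)) ^ m) sums (\<Sum>j\<le>n. c j * (1 / (1 - w * cnj (z j))))"
  proof (intro sums_sum sums_mult geometric_sums)
    fix j show "cmod (w * cnj (z j)) < 1"
      using z[of j] w by (simp add: norm_mult) (metis mult_left_le_one_le norm_ge_zero order.strict_trans1)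
  qed
  then show ?thesis
    by (simp add: kernel_sum_def kernel_coeff_def power_mult_distrib sum_distrib_left sum_distrib_right mult_ac)
qed

text \<open>
  Parseval for a combination of kernels, by expanding each \<open>1 / (1 - z\<^sub>i cnj z\<^sub>j)\<close> as a geometric series.
\<close>

lemma kernel_coeff_square_sums:
  assumes z: "\<And>k. cmod (z k) < 1"
  shows "(\<lambda>m. (cmod (kernel_coeff z n c m))\<^sup>2) sums pick_form z n c"
proof -
  have "(\<lambda>m. \<Sum>i\<le>n. cnj (c i) * (kernel_coeff z n c m * z i ^ m)) sums (\<Sum>i\<le>n. cnj (c i) * kernel_sum z n c (z i))"
    by (intro sums_sum sums_mult kernel_coeff_sums) (use z in \<open>auto simp: less_imp_le\<close>)
  moreover have "(\<Sum>i\<le>n. cnj (c i) * (kernel_coeff z n c m * z i ^ m)) = complex_of_real ((cmod (kernel_coeff z n c m))\<^sup>2)" for m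
  proof -
    have "(\<Sum>i\<le>n. cnj (c i) * (kernel_coeff z n c m * z i ^ m)) = kernel_coeff z n c m * cnj (kernel_coeff z n c m)"
      by (subst (2) kernel_coeff_def) (simp add: sum_distrib_left mult_ac)
    then show ?thesis by (simp only: complex_norm_square)
  qed
  ultimately have "(\<lambda>m. Re (complex_of_real ((cmod (kernel_coeff z n c m))\<^sup>2))) sums pick_form z n c"
    unfolding pick_form_def by (intro sums_Re) simp
  then show ?thesis by (simp only: Re_complex_of_real)
qed

text \<open>
  This is Lagrange interpolation of the polynomial \<open>\<Prod>\<^sub>l\<^sub>\<noteq>\<^sub>a (1 - w b\<^sub>l)\<close> at the points \<open>z\<^sub>j\<close>, read off at \<open>w = 1/\<alpha>\<close> and
  multiplied by a power of \<open>\<alpha>\<close>. In this form it stays meaningful at \<open>\<alpha> = 0\<close>, which corresponds to a node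
  at the origin.
\<close>

lemma partial_fractions_reflected:
  fixes z :: "nat \<Rightarrow> complex" and b :: "nat \<Rightarrow> complex"
  assumes I: "finite I" and inj: "inj_on z I" and a: "a \<in> I"
    and nz: "\<And>j. j \<in> I \<Longrightarrow> 1 - \<alpha> * z j \<noteq> 0"
  shows "(\<Sum>j\<in>I. (\<Prod>l\<in>I-{a}. 1 - z j * b l) / ((\<Prod>l\<in>I-{j}. z j - z l) * (1 - \<alpha> * z j)))
       = (\<Prod>l\<in>I-{a}. \<alpha> - b l) / (\<Prod>l\<in>I. 1 - \<alpha> * z l)"
proof -
  define q where "q = (\<lambda>j. \<Prod>l\<in>I-{j}. z j - z l)"
  have q: "q j \<noteq> 0" if "j \<in> I" for j
    unfolding q_def using I inj that by (auto simp: prod_zero_iff dest: inj_onD)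
  define p where "p = (\<Prod>l\<in>I-{a}. [:1, - b l:])"
  define L where "L = (\<Sum>j\<in>I. Polynomial.smult (poly p (z j) / q j) (\<Prod>l\<in>I-{j}. [:- z l, 1:]))"
  have cardI: "0 < card I" using I a by (auto simp: card_gt_0_iff)
  have pe: "poly p w = (\<Prod>l\<in>I-{a}. 1 - w * b l)" for w
    by (simp add: p_def poly_prod mult.commute)
  have Le: "poly L w = (\<Sum>j\<in>I. poly p (z j) / q j * (\<Prod>l\<in>I-{j}. w - z l))" for w
    by (simp add: L_def poly_sum poly_prod)
  have "degree p \<le> (\<Sum>l\<in>I-{a}. degree [:1, - b l:])"
    unfolding p_def by (rule degree_prod_sum_le[unfolded o_def]) (use I in auto)
  also have "\<dots> \<le> (\<Sum>l\<in>I-{a}. 1)" by (rule sum_mono) auto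
  also have "\<dots> < card I" using I a cardI by simp
  finally have dp: "degree p < card I" .
  have dL: "degree L < card I"
    unfolding L_def
  proof (rule degree_sum_less[OF _ cardI])
    fix j assume j: "j \<in> I"
    have "degree (\<Prod>l\<in>I-{j}. [:- z l, 1:]) \<le> (\<Sum>l\<in>I-{j}. degree [:- z l, 1:])"
      by (rule degree_prod_sum_le[unfolded o_def]) (use I in auto)
    also have "\<dots> < card I" using I j cardI by simp
    finally show "degree (Polynomial.smult (poly p (z j) / q j) (\<Prod>l\<in>I-{j}. [:- z l, 1:])) < card I"
      by (meson degree_smult_le order.strict_trans1)
  qed
  have "p = L"
  proof (rule poly_eqI_degree[of "z ` I"])
    fix w assume "w \<in> z ` I"
    then obtain i where i: "i \<in> I" "w = z i" by auto
    have "(\<Sum>j\<in>I. poly p (z j) / q j * (\<Prod>l\<in>I-{j}. z i - z l))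
        = (\<Sum>j\<in>I. if j = i then poly p (z i) else 0)"
    proof (rule sum.cong[OF refl])
      fix j assume j: "j \<in> I"
      show "poly p (z j) / q j * (\<Prod>l\<in>I-{j}. z i - z l) = (if j = i then poly p (z i) else 0)"
      proof (cases "j = i")
        case True then show ?thesis using q[OF i(1)] by (simp add: q_def)
      next
        case False
        then have "(\<Prod>l\<in>I-{j}. z i - z l) = 0" using I i by (auto simp: prod_zero_iff)
        then show ?thesis using False by simp
      qed
    qed
    then show "poly p w = poly L w" using I i by (simp add: Le)
  qed (use dp dL card_image[OF inj] in auto)
  then have interp: "(\<Prod>l\<in>I-{a}. 1 - w * b l) = (\<Sum>j\<in>I. poly p (z j) / q j * (\<Prod>l\<in>I-{j}. w - z l))" for w
    using pe Le by metis
  have nonzero: "(\<Sum>j\<in>I. poly p (z j) / q j * (\<Prod>l\<in>I-{j}. 1 - \<alpha> * z l)) = (\<Prod>l\<in>I-{a}. \<alpha> - b l)"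
    if \<alpha>: "\<alpha> \<noteq> 0" for \<alpha>
  proof -
    have pull: "\<alpha> ^ (card I - 1) * (\<Prod>l\<in>I-{j}. f l) = (\<Prod>l\<in>I-{j}. \<alpha> * f l)" if "j \<in> I" for j and f :: "nat \<Rightarrow> complex"
      using I that by (simp add: prod.distrib)
    have "(\<Prod>l\<in>I-{a}. \<alpha> - b l) = \<alpha> ^ (card I - 1) * (\<Prod>l\<in>I-{a}. 1 - (1 / \<alpha>) * b l)"
      unfolding pull[OF a] using \<alpha> by (simp add: algebra_simps)
    also have "\<dots> = (\<Sum>j\<in>I. poly p (z j) / q j * (\<alpha> ^ (card I - 1) * (\<Prod>l\<in>I-{j}. 1 / \<alpha> - z l)))"
      unfolding interp by (simp add: sum_distrib_left mult_ac)
    also have "\<dots> = (\<Sum>j\<in>I. poly p (z j) / q j * (\<Prod>l\<in>I-{j}. 1 - \<alpha> * z l))"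
    proof (rule sum.cong[OF refl])
      fix j assume "j \<in> I"
      then show "poly p (z j) / q j * (\<alpha> ^ (card I - 1) * (\<Prod>l\<in>I-{j}. 1 / \<alpha> - z l))
          = poly p (z j) / q j * (\<Prod>l\<in>I-{j}. 1 - \<alpha> * z l)"
        using \<alpha> by (simp only: pull) (simp add: algebra_simps)
    qed
    finally show ?thesis by simp
  qed
  \<comment> \<open>The value at the origin follows by continuity.\<close>
  have all: "(\<Sum>j\<in>I. poly p (z j) / q j * (\<Prod>l\<in>I-{j}. 1 - \<alpha> * z l)) = (\<Prod>l\<in>I-{a}. \<alpha> - b l)" for \<alpha>
  proof -
    let ?f = "\<lambda>\<alpha>. (\<Sum>j\<in>I. poly p (z j) / q j * (\<Prod>l\<in>I-{j}. 1 - \<alpha> * z l)) - (\<Prod>l\<in>I-{a}. \<alpha> - b l)"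
    have "isCont ?f \<alpha>" by (intro continuous_intros)
    then have "?f \<midarrow>\<alpha>\<rightarrow> ?f \<alpha>" by (simp add: isCont_def)
    moreover have "\<forall>\<^sub>F \<alpha> in at \<alpha>. ?f \<alpha> = 0"
      using eventually_neq_at_within[of 0 \<alpha> UNIV] by eventually_elim (subst nonzero, assumption, simp)
    then have "?f \<midarrow>\<alpha>\<rightarrow> 0" by (rule tendsto_eventually)
    ultimately have "?f \<alpha> = 0" by (rule LIM_unique)
    then show ?thesis by simp
  qed
  have "(\<Sum>j\<in>I. (\<Prod>l\<in>I-{a}. 1 - z j * b l) / (q j * (1 - \<alpha> * z j)))
      = (\<Sum>j\<in>I. (poly p (z j) / q j * (\<Prod>l\<in>I-{j}. 1 - \<alpha> * z l)) / (\<Prod>l\<in>I. 1 - \<alpha> * z l))"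
  proof (rule sum.cong[OF refl])
    fix j assume j: "j \<in> I"
    have "(\<Prod>l\<in>I. 1 - \<alpha> * z l) = (1 - \<alpha> * z j) * (\<Prod>l\<in>I-{j}. 1 - \<alpha> * z l)"
      by (rule prod.remove[OF I j])
    moreover have "(\<Prod>l\<in>I-{j}. 1 - \<alpha> * z l) \<noteq> 0" using I nz by (auto simp: prod_zero_iff)
    ultimately show "(\<Prod>l\<in>I-{a}. 1 - z j * b l) / (q j * (1 - \<alpha> * z j))
      = (poly p (z j) / q j * (\<Prod>l\<in>I-{j}. 1 - \<alpha> * z l)) / (\<Prod>l\<in>I. 1 - \<alpha> * z l)"
      by (simp add: pe)
  qed
  also have "\<dots> = (\<Prod>l\<in>I-{a}. \<alpha> - b l) / (\<Prod>l\<in>I. 1 - \<alpha> * z l)"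
    by (simp only: sum_divide_distrib[symmetric] all)
  finally show ?thesis by (simp add: q_def)
qed

lemma blaschke_deriv_nonzero:
  assumes "\<And>k. cmod (z k) < 1" "inj z" "j \<le> n"
  shows "blaschke_deriv z n j \<noteq> 0"
  using assms one_minus_cnj_nonzero(1)[OF assms(1) less_imp_le[OF assms(1)]]
  by (auto simp: blaschke_deriv_def prod_zero_iff inj_eq)

text \<open>
  The partial fraction identity with \<open>b\<^sub>l = cnj z\<^sub>l\<close> and \<open>\<alpha> = cnj z\<^sub>a\<close>: its right-hand side contains the
  factor \<open>\<alpha> - cnj z\<^sub>a = 0\<close> unless the omitted index \<open>b\<close> is \<open>a\<close>.
\<close>

lemma pick_matrix_congruence:
  assumes z: "\<And>k. cmod (z k) < 1" and inj: "inj z" and a: "a \<le> n" and b: "b \<le> n"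
  shows "(\<Sum>j\<le>n. 1 / (1 - z j * cnj (z a)) * (1 / (1 - z j * cnj (z b))) / blaschke_deriv z n j)
       = (if a = b then cnj (blaschke_deriv z n a) else 0)"
proof -
  note nz = one_minus_cnj_nonzero(1)[OF z less_imp_le[OF z]]
  have "(\<Sum>j\<le>n. 1 / (1 - z j * cnj (z a)) * (1 / (1 - z j * cnj (z b))) / blaschke_deriv z n j)
      = (\<Sum>j\<le>n. (\<Prod>l\<in>{..n}-{b}. 1 - z j * cnj (z l)) / ((\<Prod>l\<in>{..n}-{j}. z j - z l) * (1 - cnj (z a) * z j)))"
  proof (rule sum.cong[OF refl])
    fix j assume "j \<in> {..n}"
    have e: "(\<Prod>l\<le>n. 1 - z j * cnj (z l)) = (1 - z j * cnj (z b)) * (\<Prod>l\<in>{..n}-{b}. 1 - z j * cnj (z l))"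
      by (rule prod.remove) (use b in auto)
    have gen: "1 / x * (1 / y) / (P / (y * Q)) = Q / (P * x)" if "y \<noteq> 0" for x y P Q :: complex
      using that by (simp add: field_simps)
    show "1 / (1 - z j * cnj (z a)) * (1 / (1 - z j * cnj (z b))) / blaschke_deriv z n j
      = (\<Prod>l\<in>{..n}-{b}. 1 - z j * cnj (z l)) / ((\<Prod>l\<in>{..n}-{j}. z j - z l) * (1 - cnj (z a) * z j))"
      unfolding blaschke_deriv_def e mult.commute[of "cnj (z a)" "z j"] by (rule gen[OF nz])
  qed
  also have "\<dots> = (\<Prod>l\<in>{..n}-{b}. cnj (z a) - cnj (z l)) / (\<Prod>l\<le>n. 1 - cnj (z a) * z l)"
  proof (rule partial_fractions_reflected[where b="\<lambda>l. cnj (z l)"])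
    show "1 - cnj (z a) * z j \<noteq> 0" for j using nz[of j a] by (subst mult.commute)
  qed (use b inj in \<open>auto intro: inj_on_subset\<close>)
  also have "\<dots> = (if a = b then cnj (blaschke_deriv z n a) else 0)"
  proof (cases "a = b")
    case False
    then have "(\<Prod>l\<in>{..n}-{b}. cnj (z a) - cnj (z l)) = 0" using a by (auto simp: prod_zero_iff)
    then show ?thesis using False by simp
  qed (simp add: blaschke_deriv_def)
  finally show ?thesis .
qed

text \<open>
  In kernel coordinates, the conjugation of the model space of the finite Blaschke product \<open>B\<close>, which on the circle sends \<open>f\<close> to
  \<open>B cnj (\<zeta> f)\<close>, where \<open>B = \<Prod>\<^sub>l (w - z\<^sub>l) / (1 - w cnj z\<^sub>l)\<close>.
\<close>

definition pick_conjugation :: "(nat \<Rightarrow> complex) \<Rightarrow> nat \<Rightarrow> (nat \<Rightarrow> complex) \<Rightarrow> nat \<Rightarrow> complex" where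
  "pick_conjugation z n c j = cnj (kernel_sum z n c (z j) / blaschke_deriv z n j)"

text \<open>
  The congruence identity collapses the double sum to its diagonal. Everything else about the conjugation follows from this formula.
\<close>

lemma kernel_sum_pick_conjugation:
  assumes z: "\<And>k. cmod (z k) < 1" and inj: "inj z" and a: "a \<le> n"
  shows "kernel_sum z n (pick_conjugation z n c) (z a) = blaschke_deriv z n a * cnj (c a)"
proof -
  have "cnj (kernel_sum z n (pick_conjugation z n c) (z a))
      = (\<Sum>j\<le>n. (\<Sum>b\<le>n. c b / (1 - z j * cnj (z b))) / blaschke_deriv z n j / (1 - z j * cnj (z a)))"
    by (simp add: kernel_sum_def pick_conjugation_def mult.commute)
  also have "\<dots> = (\<Sum>j\<le>n. \<Sum>b\<le>n. c b * (1 / (1 - z j * cnj (z a)) * (1 / (1 - z j * cnj (z b))) / blaschke_deriv z n j))"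
    by (simp add: sum_divide_distrib mult_ac)
  also have "\<dots> = (\<Sum>b\<le>n. c b * (\<Sum>j\<le>n. 1 / (1 - z j * cnj (z a)) * (1 / (1 - z j * cnj (z b))) / blaschke_deriv z n j))"
    by (subst sum.swap) (simp add: sum_distrib_left)
  also have "\<dots> = (\<Sum>b\<le>n. if b = a then c a * cnj (blaschke_deriv z n a) else 0)"
    by (rule sum.cong[OF refl], subst pick_matrix_congruence[OF z inj a]) auto
  also have "\<dots> = c a * cnj (blaschke_deriv z n a)" using a by simp
  finally have "cnj (cnj (kernel_sum z n (pick_conjugation z n c) (z a))) = cnj (c a * cnj (blaschke_deriv z n a))"
    by (rule arg_cong)
  then show ?thesis by (simp add: mult.commute)
qed

lemma pick_conjugation_involution:
  assumes z: "\<And>k. cmod (z k) < 1" and inj: "inj z" and a: "a \<le> n"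
  shows "pick_conjugation z n (pick_conjugation z n c) a = c a"
  by (subst pick_conjugation_def, subst kernel_sum_pick_conjugation[OF assms])
     (simp add: blaschke_deriv_nonzero[OF assms])

lemma pick_form_pick_conjugation:
  assumes z: "\<And>k. cmod (z k) < 1" and inj: "inj z"
  shows "pick_form z n (pick_conjugation z n c) = pick_form z n c"
proof -
  have "(\<Sum>i\<le>n. cnj (pick_conjugation z n c i) * kernel_sum z n (pick_conjugation z n c) (z i))
      = (\<Sum>i\<le>n. cnj (c i) * kernel_sum z n c (z i))"
  proof (rule sum.cong[OF refl])
    fix i assume "i \<in> {..n}"
    then have i: "i \<le> n" by simp
    show "cnj (pick_conjugation z n c i) * kernel_sum z n (pick_conjugation z n c) (z i)
        = cnj (c i) * kernel_sum z n c (z i)"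
      using blaschke_deriv_nonzero[OF z inj i]
      by (simp add: kernel_sum_pick_conjugation[OF z inj i]) (simp add: pick_conjugation_def)
  qed
  then show ?thesis by (simp add: pick_form_def)
qed

text \<open>
  The conjugation exhibits an explicit preimage, so the Pick matrix is surjective.
\<close>

lemma interpolating_kernel_sum:
  assumes z: "\<And>k. cmod (z k) < 1" and inj: "inj z"
  obtains c where "\<And>i. i \<le> n \<Longrightarrow> kernel_sum z n c (z i) = v i"
proof
  let ?d = "\<lambda>i. cnj (v i / blaschke_deriv z n i)"
  fix i assume i: "i \<le> n"
  show "kernel_sum z n (pick_conjugation z n ?d) (z i) = v i"
    using blaschke_deriv_nonzero[OF z inj i]
    by (simp add: kernel_sum_pick_conjugation[OF z inj i])
qed

text \<open>
  Replace \<open>c\<close> by its conjugate vector: the form is unchanged, while the Euclidean norm of \<open>c\<close> becomes the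
  weighted norm of the values at the nodes. Since the conjugation is an involution, both directions follow.
\<close>

lemma pick_form_bound_iff:
  assumes z: "\<And>k. cmod (z k) < 1" and inj: "inj z"
  shows "(\<forall>c. \<epsilon> * (\<Sum>i\<le>n. (cmod (c i))\<^sup>2) \<le> pick_form z n c) \<longleftrightarrow>
    (\<forall>c. \<epsilon> * (\<Sum>i\<le>n. (cmod (kernel_sum z n c (z i)))\<^sup>2 / (cmod (blaschke_deriv z n i))\<^sup>2) \<le> pick_form z n c)"
proof -
  have eq: "(\<Sum>i\<le>n. (cmod (pick_conjugation z n c i))\<^sup>2)
      = (\<Sum>i\<le>n. (cmod (kernel_sum z n c (z i)))\<^sup>2 / (cmod (blaschke_deriv z n i))\<^sup>2)" for c
    by (simp add: pick_conjugation_def norm_divide power_divide)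
  have inv: "(\<Sum>i\<le>n. (cmod (pick_conjugation z n (pick_conjugation z n c) i))\<^sup>2) = (\<Sum>i\<le>n. (cmod (c i))\<^sup>2)" for c
    by (simp add: pick_conjugation_involution[OF z inj])
  show ?thesis
    unfolding eq[symmetric]
    by (metis inv pick_form_pick_conjugation[OF z inj])
qed

section \<open>The smallest eigenvalue\<close>

text \<open>
  Vectors of length \<open>N\<close> are represented by functions on \<open>nat\<close> of which only the values below \<open>N\<close> matter. This
  avoids dimension side conditions everywhere except where eigenvalues and determinants enter.
\<close>

definition fmult :: "nat \<Rightarrow> (nat \<Rightarrow> nat \<Rightarrow> complex) \<Rightarrow> (nat \<Rightarrow> complex) \<Rightarrow> nat \<Rightarrow> complex" where
  "fmult N H c i = (\<Sum>j<N. H i j * c j)"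

definition finner :: "nat \<Rightarrow> (nat \<Rightarrow> complex) \<Rightarrow> (nat \<Rightarrow> complex) \<Rightarrow> complex" where
  "finner N c d = (\<Sum>i<N. cnj (c i) * d i)"

definition fnorm2 :: "nat \<Rightarrow> (nat \<Rightarrow> complex) \<Rightarrow> real" where
  "fnorm2 N c = (\<Sum>i<N. (cmod (c i))\<^sup>2)"

lemma fnorm2_nonneg: "0 \<le> fnorm2 N c"
  by (simp add: fnorm2_def sum_nonneg)

lemma fnorm2_eq_0_iff: "fnorm2 N c = 0 \<longleftrightarrow> (\<forall>i<N. c i = 0)"
  by (auto simp: fnorm2_def sum_nonneg_eq_0_iff)

lemma finner_self: "finner N c c = of_real (fnorm2 N c)"
  by (simp add: finner_def fnorm2_def complex_norm_square[symmetric] mult.commute[of "cnj _"])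

lemma Re_finner_le: "Re (finner N c d) \<le> (fnorm2 N c + fnorm2 N d) / 2"
proof -
  have "Re (cnj a * b) \<le> ((cmod a)\<^sup>2 + (cmod b)\<^sup>2) / 2" for a b :: complex
  proof -
    have "0 \<le> (Re a - Re b)\<^sup>2 + (Im a - Im b)\<^sup>2" by simp
    then show ?thesis by (simp add: cmod_power2 power2_diff algebra_simps)
  qed
  then have "Re (finner N c d) \<le> (\<Sum>i<N. ((cmod (c i))\<^sup>2 + (cmod (d i))\<^sup>2) / 2)"
    unfolding finner_def Re_sum by (intro sum_mono) auto
  then show ?thesis by (simp add: fnorm2_def sum.distrib sum_divide_distrib[symmetric])
qed

lemma fnorm2_fmult_le: "fnorm2 N (fmult N X c) \<le> (\<Sum>i<N. \<Sum>j<N. (cmod (X i j))\<^sup>2) * fnorm2 N c"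
proof -
  have "(cmod (fmult N X c i))\<^sup>2 \<le> (\<Sum>j<N. (cmod (X i j))\<^sup>2) * fnorm2 N c" for i
  proof -
    have "cmod (fmult N X c i) \<le> (\<Sum>j<N. cmod (X i j) * cmod (c j))"
      unfolding fmult_def by (rule order_trans[OF norm_sum]) (simp add: norm_mult)
    then have "(cmod (fmult N X c i))\<^sup>2 \<le> (\<Sum>j<N. cmod (X i j) * cmod (c j))\<^sup>2"
      by (rule power_mono) simp
    also have "\<dots> \<le> (\<Sum>j<N. (cmod (X i j))\<^sup>2) * (\<Sum>j<N. (cmod (c j))\<^sup>2)"
      by (rule Cauchy_Schwarz_ineq_sum)
    finally show ?thesis by (simp add: fnorm2_def)
  qed
  then have "fnorm2 N (fmult N X c) \<le> (\<Sum>i<N. (\<Sum>j<N. (cmod (X i j))\<^sup>2) * fnorm2 N c)"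
    unfolding fnorm2_def[of N "fmult N X c"] by (intro sum_mono) auto
  then show ?thesis by (simp add: sum_distrib_right)
qed

lemma finner_fmult_hermitian:
  assumes H: "\<forall>i<N. \<forall>j<N. H j i = cnj (H i j)"
  shows "finner N c (fmult N H d) = finner N (fmult N H c) d"
proof -
  have "finner N c (fmult N H d) = (\<Sum>i<N. \<Sum>j<N. cnj (c i) * (H i j * d j))"
    by (simp add: finner_def fmult_def sum_distrib_left)
  also have "\<dots> = (\<Sum>j<N. \<Sum>i<N. cnj (c i) * (H i j * d j))" by (rule sum.swap)
  also have "\<dots> = (\<Sum>j<N. \<Sum>i<N. cnj (H j i * c i) * d j)"
  proof (intro sum.cong refl)
    fix j i assume "j \<in> {..<N}" "i \<in> {..<N}"
    then have "H i j = cnj (H j i)" using H by blast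
    then show "cnj (c i) * (H i j * d j) = cnj (H j i * c i) * d j" by (simp add: mult_ac)
  qed
  also have "\<dots> = finner N (fmult N H c) d"
    by (simp add: finner_def fmult_def sum_distrib_right)
  finally show ?thesis .
qed

text \<open>
  For a positive semidefinite form \<open>q\<close> with matrix \<open>G\<close>, nonnegativity of \<open>q(c - t G c)\<close> for a suitable small \<open>t\<close>
  controls \<open>|G c|\<^sup>2\<close> by \<open>q(c)\<close>.
\<close>

lemma psd_fnorm2_le:
  assumes G: "\<forall>i<N. \<forall>j<N. G j i = cnj (G i j)"
    and psd: "\<And>c. 0 \<le> Re (finner N c (fmult N G c))"
  shows "\<exists>M>0. \<forall>c. fnorm2 N (fmult N G c) \<le> M * Re (finner N c (fmult N G c))"
proof -
  define F where "F = (\<Sum>i<N. \<Sum>j<N. (cmod (G i j))\<^sup>2)"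
  define M where "M = 1 + F"
  have F: "0 \<le> F" by (simp add: F_def sum_nonneg)
  then have M: "0 < M" by (simp add: M_def)
  have "fnorm2 N (fmult N G c) \<le> M * Re (finner N c (fmult N G c))" for c
  proof -
    define d e where "d = fmult N G c" and "e = fmult N G d"
    \<comment> \<open>This choice minimises the upper bound found below for the form at c - t d.\<close>
    define t where "t = 1 / M"
    have "Re (finner N d e) \<le> (fnorm2 N d + fnorm2 N e) / 2" by (rule Re_finner_le)
    also have "\<dots> \<le> (fnorm2 N d + F * fnorm2 N d) / 2"
      unfolding e_def F_def using fnorm2_fmult_le by (intro divide_right_mono add_left_mono) auto
    also have "\<dots> \<le> M * fnorm2 N d"
      using F fnorm2_nonneg[of N d] by (simp add: M_def algebra_simps)
    finally have de: "Re (finner N d e) \<le> M * fnorm2 N d" .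
    have lin: "fmult N G (\<lambda>j. c j - of_real t * d j) = (\<lambda>i. d i - of_real t * e i)"
      by (rule ext) (simp add: d_def e_def fmult_def sum_subtractf sum_distrib_left algebra_simps)
    have ce: "finner N c e = of_real (fnorm2 N d)"
      unfolding e_def finner_fmult_hermitian[OF G] d_def[symmetric] by (rule finner_self)
    have "finner N (\<lambda>j. c j - of_real t * d j) (\<lambda>i. d i - of_real t * e i)
        = finner N c d - of_real t * finner N d d - of_real t * finner N c e + of_real (t * t) * finner N d e"
      by (simp add: finner_def sum_subtractf sum.distrib sum_distrib_left algebra_simps)
    then have "0 \<le> Re (finner N c d) - 2 * t * fnorm2 N d + t * t * Re (finner N d e)"
      using psd[of "\<lambda>j. c j - of_real t * d j"] unfolding lin by (simp add: ce finner_self)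
    also have "t * t * Re (finner N d e) \<le> t * t * (M * fnorm2 N d)"
      by (rule mult_left_mono[OF de]) simp
    also have "\<dots> = t * fnorm2 N d" using M by (simp add: t_def)
    finally have "t * fnorm2 N d \<le> Re (finner N c d)" by simp
    then show ?thesis using M by (simp add: t_def d_def pos_divide_le_eq mult.commute)
  qed
  then show ?thesis using M by blast
qed

lemma eigenvalue_fmult_iff:
  "eigenvalue (mat N N (\<lambda>(i, j). H i j)) x \<longleftrightarrow>
     (\<exists>c. (\<exists>i<N. c i \<noteq> 0) \<and> (\<forall>i<N. fmult N H c i = x * c i))"
proof
  assume "eigenvalue (mat N N (\<lambda>(i, j). H i j)) x"
  then obtain v where v: "v \<in> carrier_vec N" "v \<noteq> 0\<^sub>v N"
    "mat N N (\<lambda>(i, j). H i j) *\<^sub>v v = x \<cdot>\<^sub>v v"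
    by (auto simp: eigenvalue_def eigenvector_def)
  have "\<exists>i<N. v $ i \<noteq> 0"
    using v(1,2) by (metis carrier_vecD eq_vecI index_zero_vec(1,2))
  moreover have "fmult N H (\<lambda>i. v $ i) i = x * v $ i" if "i < N" for i
  proof -
    have "(mat N N (\<lambda>(i, j). H i j) *\<^sub>v v) $ i = (x \<cdot>\<^sub>v v) $ i" by (simp only: v(3))
    then show ?thesis using that v(1)
      by (simp add: fmult_def scalar_prod_def atLeast0LessThan)
  qed
  ultimately show "\<exists>c. (\<exists>i<N. c i \<noteq> 0) \<and> (\<forall>i<N. fmult N H c i = x * c i)"
    by (intro exI[of _ "\<lambda>i. v $ i"]) auto
next
  assume "\<exists>c. (\<exists>i<N. c i \<noteq> 0) \<and> (\<forall>i<N. fmult N H c i = x * c i)"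
  then obtain c i0 where c: "i0 < N" "c i0 \<noteq> 0" "\<And>i. i < N \<Longrightarrow> fmult N H c i = x * c i" by auto
  have "eigenvector (mat N N (\<lambda>(i, j). H i j)) (vec N c) x"
    unfolding eigenvector_def
  proof (intro conjI)
    show "vec N c \<noteq> 0\<^sub>v (dim_row (mat N N (\<lambda>(i, j). H i j)))"
    proof
      assume "vec N c = 0\<^sub>v (dim_row (mat N N (\<lambda>(i, j). H i j)))"
      then have "vec N c $ i0 = 0" using c by simp
      then show False using c by simp
    qed
    show "mat N N (\<lambda>(i, j). H i j) *\<^sub>v vec N c = x \<cdot>\<^sub>v vec N c"
    proof (rule eq_vecI)
      fix i assume "i < dim_vec (x \<cdot>\<^sub>v vec N c)"
      then have "i < N" by simp
      then show "(mat N N (\<lambda>(i, j). H i j) *\<^sub>v vec N c) $ i = (x \<cdot>\<^sub>v vec N c) $ i"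
        using c(3)[of i] by (simp add: fmult_def scalar_prod_def atLeast0LessThan)
    qed simp
  qed simp
  then show "eigenvalue (mat N N (\<lambda>(i, j). H i j)) x" by (auto simp: eigenvalue_def)
qed

lemma finite_real_eigenvalues:
  assumes "A \<in> carrier_mat N N"
  shows "finite {x. eigenvalue A (complex_of_real x)}"
proof -
  have "char_poly A \<noteq> 0" using degree_monic_char_poly[OF assms] by auto
  then have "finite {k. poly (char_poly A) k = 0}" by (rule poly_roots_finite)
  then have "finite {k. eigenvalue A k}" by (simp add: eigenvalue_root_char_poly[OF assms])
  then have "finite (complex_of_real -` {k. eigenvalue A k})" by (rule finite_vimageI) (simp add: inj_on_def)
  then show ?thesis by (simp add: vimage_def)
qed

text \<open>
  An injective matrix has nonzero determinant, so its adjugate is a multiple of an inverse. The Frobenius norm of the adjugate then gives the bound.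
\<close>

lemma injective_bounded_below:
  assumes ker: "\<And>c. (\<forall>i<N. fmult N G c i = 0) \<Longrightarrow> (\<forall>i<N. c i = 0)"
  obtains L where "0 < L" "\<And>c. fnorm2 N c \<le> L * fnorm2 N (fmult N G c)"
proof -
  let ?B = "mat N N (\<lambda>(i, j). G i j)"
  have B: "?B \<in> carrier_mat N N" by simp
  have "\<not> eigenvalue ?B 0"
    unfolding eigenvalue_fmult_iff using ker by auto
  have "det ?B \<noteq> 0"
  proof
    assume "det ?B = 0"
    then obtain v where v: "v \<in> carrier_vec N" "v \<noteq> 0\<^sub>v N" "?B *\<^sub>v v = 0\<^sub>v N"
      using det_0_iff_vec_prod_zero[OF B] by auto
    then have "eigenvalue ?B 0" by (auto simp: eigenvalue_def eigenvector_def intro!: exI[of _ v])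
    with \<open>\<not> eigenvalue ?B 0\<close> show False ..
  qed
  define D where "D = (cmod (det ?B))\<^sup>2"
  define X where "X = (\<lambda>i j. adj_mat ?B $$ (i, j))"
  have adj: "adj_mat ?B \<in> carrier_mat N N" "adj_mat ?B * ?B = det ?B \<cdot>\<^sub>m 1\<^sub>m N"
    using adj_mat[OF B] by auto
  have XG: "fmult N X (fmult N G c) i = det ?B * c i" if i: "i < N" for c i
  proof -
    have "(\<Sum>k<N. X i k * G k j) = (if i = j then det ?B else 0)" if j: "j < N" for j
    proof -
      have "(adj_mat ?B * ?B) $$ (i, j) = (det ?B \<cdot>\<^sub>m 1\<^sub>m N) $$ (i, j)" by (simp only: adj(2))
      then show ?thesis using i j adj(1) by (simp add: X_def scalar_prod_def atLeast0LessThan)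
    qed
    then have "(\<Sum>j<N. (\<Sum>k<N. X i k * G k j) * c j) = (\<Sum>j<N. if j = i then det ?B * c i else 0)"
      by (intro sum.cong) auto
    also have "\<dots> = det ?B * c i" using i by simp
    finally show ?thesis
      unfolding fmult_def
      by (simp add: sum_distrib_left sum_distrib_right mult.assoc)
         (subst sum.swap, simp)
  qed
  define F where "F = (\<Sum>i<N. \<Sum>j<N. (cmod (X i j))\<^sup>2)"
  have D: "0 < D" using \<open>det ?B \<noteq> 0\<close> by (simp add: D_def)
  have F: "0 \<le> F" by (simp add: F_def sum_nonneg)
  have "fnorm2 N c \<le> (F / D + 1) * fnorm2 N (fmult N G c)" for c
  proof -
    have "D * fnorm2 N c = fnorm2 N (fmult N X (fmult N G c))"
      by (simp add: fnorm2_def XG D_def norm_mult power_mult_distrib sum_distrib_left)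
    also have "\<dots> \<le> F * fnorm2 N (fmult N G c)" unfolding F_def by (rule fnorm2_fmult_le)
    finally have "fnorm2 N c \<le> F / D * fnorm2 N (fmult N G c)"
      using D by (simp add: pos_le_divide_eq mult.commute)
    then show ?thesis using fnorm2_nonneg[of N "fmult N G c"] by (simp add: distrib_right)
  qed
  then show ?thesis using that[of "F / D + 1"] D F by (simp add: add_nonneg_pos)
qed

text \<open>
  The eigenvalue is the infimum \<open>\<mu>\<close> of the Rayleigh quotients. If \<open>\<mu>\<close> were not an eigenvalue, the positive
  semidefinite matrix \<open>H - \<mu>\<close> would be injective, and the two preceding lemmas would bound its form below by a positive
  multiple of the norm, so that the infimum would exceed \<open>\<mu>\<close>.
\<close>

lemma hermitian_least_eigenvalue:
  assumes N: "0 < N" and H: "\<forall>i<N. \<forall>j<N. H j i = cnj (H i j)"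
  shows "\<exists>\<mu>::real. eigenvalue (mat N N (\<lambda>(i, j). H i j)) (of_real \<mu>) \<and>
    (\<forall>c. \<mu> * fnorm2 N c \<le> Re (finner N c (fmult N H c)))"
proof -
  define qf where "qf = (\<lambda>c. Re (finner N c (fmult N H c)))"
  define Q where "Q = qf ` {c. fnorm2 N c = 1}"
  define \<mu> where "\<mu> = Inf Q"
  define F where "F = (\<Sum>i<N. \<Sum>j<N. (cmod (H i j))\<^sup>2)"
  have "fnorm2 N (\<lambda>i. if i = 0 then 1 else 0) = 1"
    using N by (simp add: fnorm2_def if_distrib[of "\<lambda>x. (cmod x)\<^sup>2"] cong: if_cong)
  then have Q: "Q \<noteq> {}" by (auto simp: Q_def)
  have bdd: "bdd_below Q"
  proof (rule bdd_belowI)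
    fix x assume "x \<in> Q"
    then obtain c where c: "fnorm2 N c = 1" "x = qf c" by (auto simp: Q_def)
    have "- qf c = Re (finner N (\<lambda>i. - c i) (fmult N H c))" by (simp add: qf_def finner_def sum_negf)
    also have "\<dots> \<le> (fnorm2 N (\<lambda>i. - c i) + fnorm2 N (fmult N H c)) / 2" by (rule Re_finner_le)
    also have "\<dots> \<le> (1 + F) / 2"
      using fnorm2_fmult_le[of N H c] c by (simp add: F_def fnorm2_def)
    finally show "- ((1 + F) / 2) \<le> x" unfolding c(2) by linarith
  qed
  have scale: "qf (\<lambda>i. of_real s * c i) = s\<^sup>2 * qf c" "fnorm2 N (\<lambda>i. of_real s * c i) = s\<^sup>2 * fnorm2 N c" for s :: real and c
  proof -
    have "finner N (\<lambda>i. of_real s * c i) (fmult N H (\<lambda>i. of_real s * c i)) = of_real (s\<^sup>2) * finner N c (fmult N H c)"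
      by (simp add: finner_def fmult_def sum_distrib_left power2_eq_square mult_ac)
    then show "qf (\<lambda>i. of_real s * c i) = s\<^sup>2 * qf c" by (simp add: qf_def del: of_real_power)
    show "fnorm2 N (\<lambda>i. of_real s * c i) = s\<^sup>2 * fnorm2 N c"
      by (simp add: fnorm2_def norm_mult power_mult_distrib sum_distrib_left)
  qed
  have bound: "x * fnorm2 N c \<le> qf c" if x: "\<And>y. y \<in> Q \<Longrightarrow> x \<le> y" for x c
  proof (cases "fnorm2 N c = 0")
    case True
    then have "qf c = 0" by (simp add: fnorm2_eq_0_iff qf_def finner_def)
    then show ?thesis using True by simp
  next
    case False
    then have pos: "0 < fnorm2 N c" using fnorm2_nonneg[of N c] by simp
    define s where "s = 1 / sqrt (fnorm2 N c)"
    have s2: "s\<^sup>2 * fnorm2 N c = 1" using pos by (simp add: s_def power_divide)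
    have "x \<le> qf (\<lambda>i. of_real s * c i)"
      by (rule x, unfold Q_def, rule imageI) (simp add: scale(2) s2)
    then have "x * fnorm2 N c \<le> (s\<^sup>2 * qf c) * fnorm2 N c"
      using pos by (simp add: scale)
    also have "\<dots> = qf c" using s2 by (simp add: mult_ac)
    finally show ?thesis .
  qed
  have \<mu>: "\<mu> * fnorm2 N c \<le> qf c" for c
    by (rule bound) (auto simp: \<mu>_def intro: cInf_lower bdd)
  have "eigenvalue (mat N N (\<lambda>(i, j). H i j)) (of_real \<mu>)"
  proof (rule ccontr)
    assume no: "\<not> ?thesis"
    define G where "G = (\<lambda>i j. H i j - (if i = j then of_real \<mu> else 0))"
    have Gm: "fmult N G c i = fmult N H c i - of_real \<mu> * c i" if "i < N" for c i
    proof -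
      have "fmult N G c i = fmult N H c i - (\<Sum>j<N. if j = i then of_real \<mu> * c i else 0)"
        unfolding fmult_def sum_subtractf[symmetric] by (rule sum.cong) (auto simp: G_def algebra_simps)
      then show ?thesis using that by simp
    qed
    have qG: "Re (finner N c (fmult N G c)) = qf c - \<mu> * fnorm2 N c" for c
    proof -
      have "finner N c (fmult N G c) = (\<Sum>i<N. cnj (c i) * fmult N H c i - of_real \<mu> * (cnj (c i) * c i))"
        unfolding finner_def by (rule sum.cong) (auto simp: Gm algebra_simps)
      also have "\<dots> = finner N c (fmult N H c) - of_real \<mu> * finner N c c"
        by (simp add: finner_def sum_subtractf sum_distrib_left)
      finally show ?thesis by (simp add: qf_def finner_self)
    qed
    have "\<exists>M>0. \<forall>c. fnorm2 N (fmult N G c) \<le> M * Re (finner N c (fmult N G c))"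
    proof (rule psd_fnorm2_le[of N G])
      show "\<forall>i<N. \<forall>j<N. G j i = cnj (G i j)"
      proof (intro allI impI)
        fix i j assume "i < N" "j < N"
        then have h: "H j i = cnj (H i j)" using H by blast
        show "G j i = cnj (G i j)" unfolding G_def h by simp
      qed
      show "0 \<le> Re (finner N c (fmult N G c))" for c using \<mu>[of c] by (simp add: qG)
    qed
    then obtain M where M: "0 < M" "\<And>c. fnorm2 N (fmult N G c) \<le> M * Re (finner N c (fmult N G c))"
      by auto
    have "\<forall>i<N. c i = 0" if "\<forall>i<N. fmult N G c i = 0" for c
      using no that unfolding eigenvalue_fmult_iff by (auto simp: Gm)
    then obtain L where L: "0 < L" "\<And>c. fnorm2 N c \<le> L * fnorm2 N (fmult N G c)"
      using injective_bounded_below[of N G] by metis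
    have LM: "0 < L * M" using L M by simp
    have "\<mu> + 1 / (L * M) \<le> y" if y: "y \<in> Q" for y
    proof -
      obtain c where c: "fnorm2 N c = 1" "y = qf c" using y by (auto simp: Q_def)
      have "1 \<le> L * fnorm2 N (fmult N G c)" using L(2)[of c] c by simp
      also have "\<dots> \<le> L * (M * (y - \<mu>))"
        using M(2)[of c] L(1) c by (intro mult_left_mono) (auto simp: qG)
      finally have "1 / (L * M) \<le> y - \<mu>" using LM by (simp add: pos_divide_le_eq mult_ac)
      then show ?thesis by simp
    qed
    then have "\<mu> + 1 / (L * M) \<le> \<mu>" unfolding \<mu>_def by (intro cInf_greatest[OF Q])
    then show False using LM by (simp add: not_le)
  qed
  then show ?thesis using \<mu> by (auto simp: qf_def)
qed

lemma le_smallest_eigenvalue_iff: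
  assumes N: "0 < N" and H: "\<forall>i<N. \<forall>j<N. H j i = cnj (H i j)"
  shows "\<epsilon> \<le> smallest_eigenvalue (mat N N (\<lambda>(i, j). H i j)) \<longleftrightarrow>
    (\<forall>c. \<epsilon> * fnorm2 N c \<le> Re (finner N c (fmult N H c)))"
proof -
  let ?A = "mat N N (\<lambda>(i, j). H i j)"
  obtain \<mu> where \<mu>: "eigenvalue ?A (of_real \<mu>)" "\<And>c. \<mu> * fnorm2 N c \<le> Re (finner N c (fmult N H c))"
    using hermitian_least_eigenvalue[OF assms] by auto
  have rayleigh: "\<epsilon> \<le> x"
    if x: "eigenvalue ?A (of_real x)" and e: "\<And>c. \<epsilon> * fnorm2 N c \<le> Re (finner N c (fmult N H c))" for \<epsilon> x
  proof -
    obtain c where c: "\<exists>i<N. c i \<noteq> 0" "\<And>i. i < N \<Longrightarrow> fmult N H c i = of_real x * c i"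
      using x unfolding eigenvalue_fmult_iff by auto
    have "finner N c (fmult N H c) = of_real x * finner N c c"
      unfolding finner_def sum_distrib_left by (rule sum.cong) (auto simp: c(2))
    then have "\<epsilon> * fnorm2 N c \<le> x * fnorm2 N c" using e[of c] by (simp add: finner_self)
    moreover have "0 < fnorm2 N c" using c(1) fnorm2_nonneg[of N c] fnorm2_eq_0_iff[of N c] by fastforce
    ultimately show ?thesis by simp
  qed
  have "smallest_eigenvalue ?A = \<mu>"
    unfolding smallest_eigenvalue_def
    by (rule Min_eqI) (use finite_real_eigenvalues[of ?A N] \<mu> rayleigh in auto)
  moreover have "\<epsilon> * fnorm2 N c \<le> Re (finner N c (fmult N H c))" if "\<epsilon> \<le> \<mu>" for c
    using mult_right_mono[OF that fnorm2_nonneg[of N c]] \<mu>(2)[of c] by linarith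
  ultimately show ?thesis using rayleigh[OF \<mu>(1)] by auto
qed

lemma le_smallest_eigenvalue_pick_iff:
  "\<epsilon> \<le> smallest_eigenvalue (pick_matrix z n) \<longleftrightarrow>
     (\<forall>c. \<epsilon> * (\<Sum>i\<le>n. (cmod (c i))\<^sup>2) \<le> pick_form z n c)"
proof -
  have "pick_matrix z n = mat (Suc n) (Suc n) (\<lambda>(i, j). 1 / (1 - z i * cnj (z j)))"
    by (simp add: pick_matrix_def)
  moreover have "\<epsilon> \<le> smallest_eigenvalue (mat (Suc n) (Suc n) (\<lambda>(i, j). 1 / (1 - z i * cnj (z j)))) \<longleftrightarrow>
    (\<forall>c. \<epsilon> * fnorm2 (Suc n) c \<le> Re (finner (Suc n) c (fmult (Suc n) (\<lambda>i j. 1 / (1 - z i * cnj (z j))) c)))"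
    by (rule le_smallest_eigenvalue_iff) (auto simp: mult.commute)
  ultimately show ?thesis
    by (simp add: fnorm2_def finner_def fmult_def pick_form_def kernel_sum_def lessThan_Suc_atMost)
qed

text \<open>
  The smallest eigenvalues decrease, since a vector of coefficients may be extended by zero. So their limit is
  positive exactly when they have a common positive lower bound.
\<close>

lemma regular_iff_uniform_bound:
  assumes z: "\<And>k. cmod (z k) < 1"
  shows "regular_NP_zero_problem z \<longleftrightarrow>
    (\<exists>\<epsilon>>0. \<forall>n c. \<epsilon> * (\<Sum>i\<le>n. (cmod (c i))\<^sup>2) \<le> pick_form z n c)"
proof -
  define s where "s = (\<lambda>n. smallest_eigenvalue (pick_matrix z n))"
  have s_iff: "\<epsilon> \<le> s n \<longleftrightarrow> (\<forall>c. \<epsilon> * (\<Sum>i\<le>n. (cmod (c i))\<^sup>2) \<le> pick_form z n c)" for \<epsilon> n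
    unfolding s_def by (rule le_smallest_eigenvalue_pick_iff)
  have nonneg: "0 \<le> s n" for n
  proof -
    have "0 \<le> pick_form z n c" for c
      by (rule sums_le[OF _ sums_zero kernel_coeff_square_sums[OF z]]) simp
    then show ?thesis unfolding s_iff by simp
  qed
  have dec: "decseq s"
  proof (rule decseq_SucI)
    fix n
    show "s (Suc n) \<le> s n"
      unfolding s_iff[of "s (Suc n)" n]
    proof
      fix c :: "nat \<Rightarrow> complex"
      define d where "d = (\<lambda>i. if i \<le> n then c i else 0)"
      have "s (Suc n) * (\<Sum>i\<le>Suc n. (cmod (d i))\<^sup>2) \<le> pick_form z (Suc n) d"
        using s_iff[of "s (Suc n)" "Suc n"] by blast
      moreover have "pick_form z (Suc n) d = pick_form z n c"
        by (simp add: pick_form_def kernel_sum_def d_def)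
      ultimately show "s (Suc n) * (\<Sum>i\<le>n. (cmod (c i))\<^sup>2) \<le> pick_form z n c" by (simp add: d_def)
    qed
  qed
  obtain l where l: "s \<longlonglongrightarrow> l" "\<And>n. l \<le> s n"
    using decseq_convergent[OF dec, of 0] nonneg by blast
  have "pick_lambda0 z = l" unfolding pick_lambda0_def using l(1) by (simp add: s_def limI)
  then have "regular_NP_zero_problem z \<longleftrightarrow> 0 < l" by (simp add: regular_NP_zero_problem_def)
  also have "\<dots> \<longleftrightarrow> (\<exists>\<epsilon>>0. \<forall>n. \<epsilon> \<le> s n)"
  proof
    assume "\<exists>\<epsilon>>0. \<forall>n. \<epsilon> \<le> s n"
    then obtain \<epsilon> where "0 < \<epsilon>" "\<And>n. \<epsilon> \<le> s n" by auto
    moreover from this have "\<epsilon> \<le> l" by (intro LIMSEQ_le_const[OF l(1)]) auto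
    ultimately show "0 < l" by simp
  qed (use l(2) in auto)
  finally show ?thesis by (simp add: s_iff)
qed

section \<open>Derivatives of Blaschke products\<close>

lemma norm_blaschke_factor:
  "cmod (blaschke_factor a w) = cmod (a - w) / cmod (1 - w * cnj a)"
  by (simp add: blaschke_factor_def norm_mult norm_divide)

text \<open>
  This is the identity \<open>|1 - w cnj a|\<^sup>2 - |a - w|\<^sup>2 = (1 - |a|\<^sup>2) (1 - |w|\<^sup>2)\<close>, written in real coordinates for the proof.
\<close>

lemma norm_blaschke_factor_le_1:
  assumes a: "cmod a < 1" and w: "cmod w < 1"
  shows "cmod (blaschke_factor a w) \<le> 1"
proof -
  have expand: "(1 - (p\<^sup>2 + q\<^sup>2)) * (1 - (s\<^sup>2 + t\<^sup>2))
      = ((1 - (s * p - t * - q))\<^sup>2 + (0 - (s * - q + t * p))\<^sup>2) - ((p - s)\<^sup>2 + (q - t)\<^sup>2)"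
    for p q s t :: real by (simp add: power2_eq_square algebra_simps)
  have "0 \<le> (1 - (cmod a)\<^sup>2) * (1 - (cmod w)\<^sup>2)"
    using a w by (intro mult_nonneg_nonneg) (auto simp: abs_square_le_1)
  also have "\<dots> = (cmod (1 - w * cnj a))\<^sup>2 - (cmod (a - w))\<^sup>2"
    unfolding cmod_power2 minus_complex.simps times_complex.simps one_complex.simps cnj.simps by (rule expand)
  finally have "(cmod (a - w))\<^sup>2 \<le> (cmod (1 - w * cnj a))\<^sup>2" by simp
  then have "cmod (a - w) \<le> cmod (1 - w * cnj a)" by (rule power2_le_imp_le) simp
  then show ?thesis
    using one_minus_cnj_nonzero(1)[OF w less_imp_le[OF a]] by (simp add: norm_blaschke_factor divide_le_eq)
qed

text \<open>
  The constant \<open>|a|/a\<close> in the factor is chosen so that \<open>b - 1\<close> is \<open>1 - |a|\<close> times a quantity bounded on smaller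
  disks. This is what makes the Blaschke condition sufficient for convergence. For \<open>a = 0\<close> the bound is trivial because then
  \<open>1 - |a| = 1\<close>.
\<close>

lemma blaschke_factor_near_1:
  assumes a: "cmod a < 1" and w: "cmod w \<le> r" and r: "r < 1"
  shows "cmod (blaschke_factor a w - 1) \<le> (1 - cmod a) * (2 / (1 - r))"
proof -
  have r0: "0 \<le> r" using w norm_ge_zero order_trans by blast
  show ?thesis
  proof (cases "a = 0")
    case True
    have "cmod (w - 1) \<le> 2" using norm_triangle_ineq4[of w 1] w r by simp
    also have "\<dots> \<le> 2 / (1 - r)" using r r0 by (simp add: pos_le_divide_eq)
    finally show ?thesis using True by (simp add: blaschke_factor_def)
  next
    case False
    have nz: "1 - w * cnj a \<noteq> 0" using one_minus_cnj_nonzero(1)[of w a] a w r by simp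
    have cc: "a * cnj a = of_real (cmod a) * of_real (cmod a)"
      by (simp only: complex_norm_square[symmetric] power2_eq_square of_real_mult)
    have "blaschke_factor a w - 1 = ((a - w) * of_real (cmod a) - (1 - w * cnj a) * a) / ((1 - w * cnj a) * a)"
      using nz False by (simp add: blaschke_factor_def divide_simps)
    also have "(a - w) * of_real (cmod a) - (1 - w * cnj a) * a = - of_real (1 - cmod a) * (a + w * of_real (cmod a))"
      using cc by (simp add: algebra_simps)
    finally have "cmod (blaschke_factor a w - 1)
        = (1 - cmod a) * cmod (a + w * of_real (cmod a)) / (cmod (1 - w * cnj a) * cmod a)"
      using a by (simp add: norm_mult norm_divide del: of_real_diff)
    also have "\<dots> \<le> (1 - cmod a) * (2 * cmod a) / ((1 - r) * cmod a)"
    proof (intro frac_le mult_left_mono mult_right_mono mult_nonneg_nonneg mult_pos_pos)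
      have "cmod (a + w * of_real (cmod a)) \<le> cmod a + cmod w * cmod a"
        by (rule order_trans[OF norm_triangle_ineq]) (simp add: norm_mult)
      also have "\<dots> \<le> 2 * cmod a" using w r by (simp add: mult_left_le_one_le)
      finally show "cmod (a + w * of_real (cmod a)) \<le> 2 * cmod a" .
      have "cmod (w * cnj a) \<le> r * 1" unfolding norm_mult using a w r0 by (intro mult_mono) auto
      then show "1 - r \<le> cmod (1 - w * cnj a)"
        using norm_triangle_ineq2[of 1 "w * cnj a"] by simp
    qed (use a r False in auto)
    also have "\<dots> = (1 - cmod a) * (2 / (1 - r))" using False by simp
    finally show ?thesis .
  qed
qed

lemma blaschke_factor_differentiable:
  assumes "cmod a < 1" "cmod w < 1"
  shows "blaschke_factor a field_differentiable at w"
  using one_minus_cnj_nonzero(1)[of w a] assms unfolding blaschke_factor_def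
  by (cases "a = 0") (auto intro!: derivative_intros)

lemma blaschke_factor_prod_differentiable:
  assumes z: "\<And>k. cmod (z k) < 1" and w: "cmod w < 1"
  shows "(\<lambda>w. \<Prod>l\<in>I. blaschke_factor (z l) w) field_differentiable at w"
proof -
  have "blaschke_factor (z l) holomorphic_on ball 0 1" for l
    unfolding holomorphic_on_def
    by (intro ballI, rule field_differentiable_at_within, rule blaschke_factor_differentiable)
       (use z in auto)
  then have "(\<lambda>w. \<Prod>l\<in>I. blaschke_factor (z l) w) holomorphic_on ball 0 1"
    by (intro holomorphic_on_prod)
  then show ?thesis using w by (intro holomorphic_on_imp_differentiable_at[of _ "ball 0 1"]) auto
qed

lemma blaschke_factor_deriv_at_zero:
  assumes a: "cmod a < 1"
  obtains D where "(blaschke_factor a has_field_derivative D) (at a)" "cmod D = 1 / cmod (1 - a * cnj a)"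
proof (cases "a = 0")
  case True
  have "(blaschke_factor a has_field_derivative 1) (at a)"
    unfolding blaschke_factor_def using True by simp
  then show ?thesis using that[of 1] True by simp
next
  case False
  have nz: "1 - a * cnj a \<noteq> 0" using one_minus_cnj_nonzero(1)[of a a] a by simp
  have "((\<lambda>w. (a - w) / (1 - w * cnj a) * (of_real (cmod a) / a)) has_field_derivative
      (- 1 / (1 - a * cnj a)) * (of_real (cmod a) / a)) (at a)"
  proof -
    have 1: "((\<lambda>w. a - w) has_field_derivative - 1) (at a)"
      by (auto intro!: derivative_eq_intros)
    have 2: "((\<lambda>w. 1 - w * cnj a) has_field_derivative - cnj a) (at a)"
      by (auto intro!: derivative_eq_intros)
    have "(- 1 * d - (a - a) * e) / (d * d) = - 1 / d" if "d \<noteq> 0" for d e :: complex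
      using that by simp
    from DERIV_divide[OF 1 2 nz, unfolded this[OF nz]]
    have "((\<lambda>w. (a - w) / (1 - w * cnj a)) has_field_derivative - 1 / (1 - a * cnj a)) (at a)" .
    then show ?thesis by (rule DERIV_cmult_right)
  qed
  then have "(blaschke_factor a has_field_derivative (- 1 / (1 - a * cnj a)) * (of_real (cmod a) / a)) (at a)"
    using False by (simp add: blaschke_factor_def[abs_def])
  moreover have "cmod ((- 1 / (1 - a * cnj a)) * (of_real (cmod a) / a)) = 1 / cmod (1 - a * cnj a)"
    using False by (simp add: norm_mult norm_divide)
  ultimately show ?thesis using that by blast
qed

text \<open>
  At a zero only the derivative of the vanishing factor survives in the product rule.
\<close>

lemma finite_blaschke_deriv:
  assumes z: "\<And>k. cmod (z k) < 1" and k: "k \<le> n"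
  shows "cmod (deriv (\<lambda>w. \<Prod>l<Suc n. blaschke_factor (z l) w) (z k)) = cmod (blaschke_deriv z n k)"
proof -
  obtain D where D: "(blaschke_factor (z k) has_field_derivative D) (at (z k))" "cmod D = 1 / cmod (1 - z k * cnj (z k))"
    by (rule blaschke_factor_deriv_at_zero[OF z])
  define P where "P = (\<lambda>w. \<Prod>l\<in>{..n}-{k}. blaschke_factor (z l) w)"
  have "P field_differentiable at (z k)"
    unfolding P_def by (rule blaschke_factor_prod_differentiable[OF z z])
  then obtain P' where P': "(P has_field_derivative P') (at (z k))" by (auto simp: field_differentiable_def)
  have eq: "(\<lambda>w. \<Prod>l<Suc n. blaschke_factor (z l) w) = (\<lambda>w. blaschke_factor (z k) w * P w)"
    unfolding P_def lessThan_Suc_atMost by (rule ext, rule prod.remove) (use k in auto)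
  have "blaschke_factor (z k) (z k) = 0" by (simp add: blaschke_factor_def)
  then have "((\<lambda>w. blaschke_factor (z k) w * P w) has_field_derivative D * P (z k)) (at (z k))"
    using DERIV_mult[OF D(1) P'] by simp
  then have "deriv (\<lambda>w. \<Prod>l<Suc n. blaschke_factor (z l) w) (z k) = D * P (z k)"
    unfolding eq by (rule DERIV_imp_deriv)
  moreover have "cmod (P (z k)) = (\<Prod>l\<in>{..n}-{k}. cmod (z k - z l)) / (\<Prod>l\<in>{..n}-{k}. cmod (1 - z k * cnj (z l)))"
    by (simp add: P_def prod_norm[symmetric] norm_blaschke_factor norm_minus_commute prod_dividef)
  moreover have "(\<Prod>l\<le>n. cmod (1 - z k * cnj (z l)))
      = cmod (1 - z k * cnj (z k)) * (\<Prod>l\<in>{..n}-{k}. cmod (1 - z k * cnj (z l)))"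
    by (rule prod.remove) (use k in auto)
  ultimately show ?thesis
    by (simp add: D(2) norm_mult norm_divide blaschke_deriv_def prod_norm[symmetric])
qed

text \<open>
  Uniform convergence on smaller disks comes from the M-test. Pointwise absolute convergence identifies the limit with the infinite product, at the nodes too.
\<close>

lemma blaschke_partial_products:
  assumes z: "\<And>k. cmod (z k) < 1" and sum: "summable (\<lambda>k. 1 - cmod (z k))" and r: "r < 1"
  shows "uniform_limit (cball 0 r) (\<lambda>N w. \<Prod>k<N. blaschke_factor (z k) w) (blaschke_product z) sequentially"
proof -
  have bd: "cmod (blaschke_factor (z k) w - 1) \<le> (1 - cmod (z k)) * (2 / (1 - r))" if "w \<in> cball 0 r" for k w
    using blaschke_factor_near_1[OF z _ r, of w k] that by simp
  have sum': "summable (\<lambda>k. (1 - cmod (z k)) * (2 / (1 - r)))" by (rule summable_mult2[OF sum])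
  have "uniformly_convergent_on (cball 0 r) (\<lambda>N w. \<Prod>k<N. blaschke_factor (z k) w)"
  proof (rule uniformly_convergent_on_prod')
    show "continuous_on (cball 0 r) (blaschke_factor (z k))" for k
      using blaschke_factor_differentiable[OF z, of _ k] r
      by (intro continuous_at_imp_continuous_on ballI field_differentiable_imp_continuous_at) auto
    show "uniformly_convergent_on (cball 0 r) (\<lambda>N w. \<Sum>k<N. norm (blaschke_factor (z k) w - 1))"
      by (rule Weierstrass_m_test'[OF _ sum']) (use bd in auto)
  qed auto
  then obtain g where g: "uniform_limit (cball 0 r) (\<lambda>N w. \<Prod>k<N. blaschke_factor (z k) w) g sequentially"
    by (auto simp: uniformly_convergent_on_def)
  have "g w = blaschke_product z w" if w: "w \<in> cball 0 r" for w
  proof -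
    have "summable (\<lambda>k. norm (blaschke_factor (z k) w - 1))"
      by (rule summable_comparison_test'[OF sum', of 0]) (use bd[OF w] in simp)
    then have "convergent_prod (\<lambda>k. blaschke_factor (z k) w)"
      by (intro abs_convergent_prod_imp_convergent_prod summable_imp_abs_convergent_prod)
    then have "(\<lambda>N. \<Prod>k<N. blaschke_factor (z k) w) \<longlonglongrightarrow> blaschke_product z w"
      unfolding blaschke_product_def by (intro has_prod_imp_tendsto' convergent_prod_has_prod)
    moreover have "(\<lambda>N. \<Prod>k<N. blaschke_factor (z k) w) \<longlonglongrightarrow> g w"
      by (rule tendsto_uniform_limitI[OF g w])
    ultimately show ?thesis by (rule LIMSEQ_unique[rotated])
  qed
  then show ?thesis by (subst uniform_limit_cong'[OF refl, symmetric]) (use g in auto)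
qed

lemma blaschke_deriv_tendsto:
  assumes z: "\<And>k. cmod (z k) < 1" and sum: "summable (\<lambda>k. 1 - cmod (z k))"
  shows "(\<lambda>n. cmod (blaschke_deriv z n k)) \<longlonglongrightarrow> cmod (deriv (blaschke_product z) (z k))"
proof -
  define F where "F = (\<lambda>N w. \<Prod>l<N. blaschke_factor (z l) w)"
  have "\<exists>g'. \<forall>x\<in>ball 0 1. (blaschke_product z has_field_derivative g' x) (at x) \<and>
      (\<lambda>N. deriv (F N) x) \<longlonglongrightarrow> g' x"
  proof (rule has_complex_derivative_uniform_sequence)
    fix N and x :: complex assume "x \<in> ball 0 1"
    then have "F N field_differentiable at x"
      unfolding F_def by (intro blaschke_factor_prod_differentiable z) auto
    then show "(F N has_field_derivative deriv (F N) x) (at x)"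
      by (simp add: DERIV_deriv_iff_field_differentiable)
  next
    fix x :: complex assume x: "x \<in> ball 0 1"
    define d where "d = (1 - cmod x) / 2"
    have sub: "cball x d \<subseteq> cball 0 ((1 + cmod x) / 2)"
      by (auto simp: d_def cball_subset_cball_iff dist_norm field_simps)
    have "uniform_limit (cball x d) F (blaschke_product z) sequentially"
      unfolding F_def
      by (rule uniform_limit_on_subset[OF blaschke_partial_products[OF z sum] sub]) (use x in simp)
    moreover have "cball x d \<subseteq> ball 0 1" using sub x by (force simp: subset_eq)
    ultimately show "\<exists>d>0. cball x d \<subseteq> ball 0 1 \<and> uniform_limit (cball x d) F (blaschke_product z) sequentially"
      using x by (intro exI[of _ d]) (auto simp: d_def)
  qed simp
  moreover have "z k \<in> ball 0 1" using z[of k] by simp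
  ultimately obtain g' where "(blaschke_product z has_field_derivative g') (at (z k))" "(\<lambda>N. deriv (F N) (z k)) \<longlonglongrightarrow> g'"
    by blast
  then have "(\<lambda>N. deriv (F N) (z k)) \<longlonglongrightarrow> deriv (blaschke_product z) (z k)"
    by (simp add: DERIV_imp_deriv)
  then have "(\<lambda>n. cmod (deriv (F (Suc n)) (z k))) \<longlonglongrightarrow> cmod (deriv (blaschke_product z) (z k))"
    by (intro tendsto_norm LIMSEQ_Suc)
  moreover have "\<forall>\<^sub>F n in sequentially. cmod (deriv (F (Suc n)) (z k)) = cmod (blaschke_deriv z n k)"
    using eventually_ge_at_top[of k] unfolding F_def by eventually_elim (rule finite_blaschke_deriv[OF z])
  ultimately show ?thesis by (rule Lim_transform_eventually)
qed

lemma norm_blaschke_deriv: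
  assumes k: "k \<le> n"
  shows "cmod (blaschke_deriv z n k)
    = (\<Prod>l\<le>n. if l = k then 1 else cmod (blaschke_factor (z l) (z k))) / cmod (1 - z k * cnj (z k))"
proof -
  have "(\<Prod>l\<le>n. cmod (1 - z k * cnj (z l)))
      = cmod (1 - z k * cnj (z k)) * (\<Prod>l\<in>{..n}-{k}. cmod (1 - z k * cnj (z l)))"
    by (rule prod.remove) (use k in auto)
  moreover have "(\<Prod>l\<le>n. if l = k then 1 else cmod (blaschke_factor (z l) (z k)))
      = (\<Prod>l\<in>{..n}-{k}. cmod (z k - z l) / cmod (1 - z k * cnj (z l)))"
    by (subst prod.remove[of _ k]) (use k in \<open>auto simp: norm_blaschke_factor norm_minus_commute intro!: prod.cong\<close>)
  ultimately show ?thesis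
    by (simp add: blaschke_deriv_def norm_divide prod_norm[symmetric] prod_dividef)
qed

text \<open>
  The modulus of the derivative is the limit of the \<open>blaschke_deriv\<close>, hence a constant times the convergent infinite product of the moduli of the
  other factors at \<open>z k\<close>. None of these vanishes, as the nodes are distinct.
\<close>

lemma deriv_blaschke_product_nonzero:
  assumes z: "\<And>k. cmod (z k) < 1" and inj: "inj z" and sum: "summable (\<lambda>k. 1 - cmod (z k))"
  shows "deriv (blaschke_product z) (z k) \<noteq> 0"
proof -
  \<comment> \<open>The factor that vanishes at the node is replaced by 1 so that the product stays nonzero.\<close>
  define g where "g = (\<lambda>l. if l = k then 1 else cmod (blaschke_factor (z l) (z k)))"
  have g0: "g l \<noteq> 0" for l
    using inj one_minus_cnj_nonzero(1)[OF z less_imp_le[OF z], of k l]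
    by (auto simp: g_def norm_blaschke_factor inj_eq)
  have "summable (\<lambda>l. norm (g l - 1))"
  proof (rule summable_comparison_test'[OF summable_mult2[OF sum, of "2 / (1 - cmod (z k))"], of 0])
    fix l
    have "norm (g l - 1) \<le> cmod (blaschke_factor (z l) (z k) - 1)"
      using norm_triangle_ineq3[of "blaschke_factor (z l) (z k)" 1] by (simp add: g_def)
    also have "\<dots> \<le> (1 - cmod (z l)) * (2 / (1 - cmod (z k)))"
      by (rule blaschke_factor_near_1) (auto simp: z)
    finally show "norm (norm (g l - 1)) \<le> (1 - cmod (z l)) * (2 / (1 - cmod (z k)))" by simp
  qed
  then have conv: "convergent_prod g"
    by (intro abs_convergent_prod_imp_convergent_prod summable_imp_abs_convergent_prod)
  have "(\<lambda>n. (\<Prod>l\<le>n. g l) / cmod (1 - z k * cnj (z k))) \<longlonglongrightarrow> prodinf g / cmod (1 - z k * cnj (z k))"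
    using one_minus_cnj_nonzero(1)[OF z less_imp_le[OF z], of k k]
    by (intro tendsto_divide convergent_prod_LIMSEQ[OF conv] tendsto_const) simp
  moreover have "\<forall>\<^sub>F n in sequentially. (\<Prod>l\<le>n. g l) / cmod (1 - z k * cnj (z k)) = cmod (blaschke_deriv z n k)"
    using eventually_ge_at_top[of k] by eventually_elim (simp add: norm_blaschke_deriv g_def)
  ultimately have "(\<lambda>n. cmod (blaschke_deriv z n k)) \<longlonglongrightarrow> prodinf g / cmod (1 - z k * cnj (z k))"
    by (rule Lim_transform_eventually)
  then have "cmod (deriv (blaschke_product z) (z k)) = prodinf g / cmod (1 - z k * cnj (z k))"
    by (rule LIMSEQ_unique[OF blaschke_deriv_tendsto[OF z sum]])
  moreover have "prodinf g \<noteq> 0" using conv g0 by (rule prodinf_nonzero)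
  ultimately show ?thesis
    using one_minus_cnj_nonzero(1)[OF z less_imp_le[OF z], of k k] by auto
qed

text \<open>
  Adding nodes multiplies the derivative at \<open>z k\<close> by factors of modulus at most one.
\<close>

lemma norm_deriv_blaschke_product_le:
  assumes z: "\<And>k. cmod (z k) < 1" and sum: "summable (\<lambda>k. 1 - cmod (z k))" and k: "k \<le> n"
  shows "cmod (deriv (blaschke_product z) (z k)) \<le> cmod (blaschke_deriv z n k)"
proof -
  define X where "X = (\<lambda>m. cmod (blaschke_deriv z (m + n) k))"
  have "X (Suc m) \<le> X m" for m
  proof -
    let ?P = "\<lambda>n. (\<Prod>l\<le>n. if l = k then 1 else cmod (blaschke_factor (z l) (z k)))"
    have "?P (Suc (m + n)) \<le> ?P (m + n) * 1"
      unfolding prod.atMost_Suc using norm_blaschke_factor_le_1[OF z z]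
      by (intro mult_left_mono prod_nonneg) auto
    then show ?thesis using k by (simp add: X_def norm_blaschke_deriv divide_right_mono)
  qed
  then have "decseq X" by (rule decseq_SucI)
  moreover have "X \<longlonglongrightarrow> cmod (deriv (blaschke_product z) (z k))"
    unfolding X_def by (rule LIMSEQ_ignore_initial_segment[OF blaschke_deriv_tendsto[OF z sum]])
  ultimately have "cmod (deriv (blaschke_product z) (z k)) \<le> X 0" by (rule decseq_ge)
  then show ?thesis by (simp add: X_def)
qed

section \<open>Carleson embedding and regularity\<close>

text \<open>
  The integral over the circle of radius \<open>r\<close> is \<open>\<Sum> |a\<^sub>n|\<^sup>2 r\<^sup>2\<^sup>n\<close>. Letting \<open>r\<close> tend to \<open>1\<close> in finite
  partial sums bounds \<open>\<Sum> |a\<^sub>n|\<^sup>2\<close> by the supremum in the definition.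
\<close>

lemma hardy_H2_pseries:
  assumes "f \<in> hardy_H2"
  obtains a where "summable (\<lambda>n. (cmod (a n))\<^sup>2)" "\<And>w. cmod w < 1 \<Longrightarrow> f w = pseries a w"
proof -
  have hol: "f holomorphic_on ball 0 1"
    and fin: "(SUP r\<in>{0..<1::real}. \<integral>\<^sup>+\<zeta>. ennreal ((cmod (f (of_real r * \<zeta>)))\<^sup>2) \<partial>circle_measure) < \<infinity>"
    using assms by (auto simp: hardy_H2_def)
  define a where "a = (\<lambda>n. (deriv ^^ n) f 0 / fact n)"
  have sums: "(\<lambda>n. a n * w ^ n) sums f w" if "cmod w < 1" for w
    using holomorphic_power_series[OF hol, of w] that by (simp add: a_def)
  then have f: "f w = pseries a w" if "cmod w < 1" for w
    using that by (simp add: pseries_def sums_iff)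
  define s where "s = enn2real (SUP r\<in>{0..<1::real}. \<integral>\<^sup>+\<zeta>. ennreal ((cmod (f (of_real r * \<zeta>)))\<^sup>2) \<partial>circle_measure)"
  have s: "(SUP r\<in>{0..<1::real}. \<integral>\<^sup>+\<zeta>. ennreal ((cmod (f (of_real r * \<zeta>)))\<^sup>2) \<partial>circle_measure) = ennreal s" "0 \<le> s"
    using fin by (auto simp: s_def)
  have partial_r: "(\<Sum>n<N. (cmod (a n) * r ^ n)\<^sup>2) \<le> s" if r: "0 \<le> r" "r < 1" for r N
  proof -
    define R where "R = (1 + r) / 2"
    have R: "r < R" "R < 1" using r by (auto simp: R_def)
    have "summable (\<lambda>n. a n * (of_real R) ^ n)"
      using sums[of "of_real R"] r R by (simp add: sums_iff)
    then have "summable (\<lambda>n. norm (a n * (of_real r) ^ n))"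
      by (rule powser_insidea) (use r R in simp)
    from circle_parseval[OF this]
    have P: "summable (\<lambda>n. (cmod (a n) * r ^ n)\<^sup>2)"
      "(\<integral>\<^sup>+\<zeta>. ennreal ((cmod (pseries a (of_real r * \<zeta>)))\<^sup>2) \<partial>circle_measure) = ennreal (\<Sum>n. (cmod (a n) * r ^ n)\<^sup>2)"
      using r by (simp_all add: pseries_dilate norm_mult norm_power)
    have "ennreal (\<Sum>n. (cmod (a n) * r ^ n)\<^sup>2)
        = (\<integral>\<^sup>+\<zeta>. ennreal ((cmod (f (of_real r * \<zeta>)))\<^sup>2) \<partial>circle_measure)"
      unfolding P(2)[symmetric] by (rule nn_integral_cong) (use r in \<open>simp add: f norm_mult\<close>)
    also have "\<dots> \<le> ennreal s" unfolding s(1)[symmetric] by (rule SUP_upper) (use r in simp)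
    finally have "(\<Sum>n. (cmod (a n) * r ^ n)\<^sup>2) \<le> s" using s(2) by simp
    moreover have "(\<Sum>n<N. (cmod (a n) * r ^ n)\<^sup>2) \<le> (\<Sum>n. (cmod (a n) * r ^ n)\<^sup>2)"
      by (rule sum_le_suminf[OF P(1)]) auto
    ultimately show ?thesis by simp
  qed
  have partial: "(\<Sum>n<N. (cmod (a n))\<^sup>2) \<le> s" for N
  proof -
    have "((\<lambda>r. \<Sum>n<N. (cmod (a n) * r ^ n)\<^sup>2) \<longlongrightarrow> (\<Sum>n<N. (cmod (a n) * 1 ^ n)\<^sup>2)) (at_left (1::real))"
      by (intro tendsto_intros)
    moreover have "\<forall>\<^sub>F r in at_left (1::real). (\<Sum>n<N. (cmod (a n) * r ^ n)\<^sup>2) \<le> s"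
      unfolding eventually_at_left_field by (rule exI[of _ 0]) (use partial_r in auto)
    ultimately have "(\<Sum>n<N. (cmod (a n) * 1 ^ n)\<^sup>2) \<le> s"
      by (rule tendsto_upperbound) simp
    then show ?thesis by simp
  qed
  have "summable (\<lambda>n. (cmod (a n))\<^sup>2)"
    by (rule summableI_nonneg_bounded[OF _ partial]) simp
  then show ?thesis using f that by blast
qed

lemma pseries_in_hardy_H2:
  assumes b: "summable (\<lambda>n. (cmod (b n))\<^sup>2)"
    and f: "\<And>w. cmod w < 1 \<Longrightarrow> f w = pseries b w"
    and hol: "f holomorphic_on ball 0 1"
  shows "f \<in> hardy_H2"
proof -
  have "(\<integral>\<^sup>+\<zeta>. ennreal ((cmod (f (of_real r * \<zeta>)))\<^sup>2) \<partial>circle_measure) \<le> ennreal (\<Sum>n. (cmod (b n))\<^sup>2)"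
    if r: "r \<in> {0..<1}" for r
  proof -
    have "(\<integral>\<^sup>+\<zeta>. ennreal ((cmod (f (of_real r * \<zeta>)))\<^sup>2) \<partial>circle_measure)
        = (\<integral>\<^sup>+\<zeta>. ennreal ((cmod (pseries b (of_real r * \<zeta>)))\<^sup>2) \<partial>circle_measure)"
      by (rule nn_integral_cong) (use r in \<open>simp add: f norm_mult\<close>)
    also have "\<dots> \<le> ennreal (\<Sum>n. (cmod (b n))\<^sup>2)"
      using r dilated_parseval(2)[OF b, of r] dilated_sum_le[OF b, of r] by (simp add: ennreal_leI)
    finally show ?thesis .
  qed
  then have "(SUP r\<in>{0..<1::real}. \<integral>\<^sup>+\<zeta>. ennreal ((cmod (f (of_real r * \<zeta>)))\<^sup>2) \<partial>circle_measure)
      \<le> ennreal (\<Sum>n. (cmod (b n))\<^sup>2)"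
    by (rule SUP_least)
  then have "(SUP r\<in>{0..<1::real}. \<integral>\<^sup>+\<zeta>. ennreal ((cmod (f (of_real r * \<zeta>)))\<^sup>2) \<partial>circle_measure) < \<infinity>"
    by (rule le_less_trans) simp
  then show ?thesis using hol by (simp add: hardy_H2_def)
qed

lemma kernel_sum_hardy_H2:
  assumes z: "\<And>k. cmod (z k) < 1"
  shows "kernel_sum z n c \<in> hardy_H2"
    and "(\<integral>\<^sup>+\<zeta>. ennreal ((cmod (boundary_value (kernel_sum z n c) \<zeta>))\<^sup>2) \<partial>circle_measure) = ennreal (pick_form z n c)"
proof -
  have sq: "summable (\<lambda>m. (cmod (kernel_coeff z n c m))\<^sup>2)" "(\<Sum>m. (cmod (kernel_coeff z n c m))\<^sup>2) = pick_form z n c"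
    using kernel_coeff_square_sums[OF z] by (auto simp: sums_iff)
  have eq: "kernel_sum z n c w = pseries (kernel_coeff z n c) w" if "cmod w < 1" for w
    using kernel_coeff_sums[OF z less_imp_le[OF that]] by (simp add: pseries_def sums_iff)
  have "kernel_sum z n c holomorphic_on ball 0 1"
    unfolding kernel_sum_def
    by (intro holomorphic_intros) (use one_minus_cnj_nonzero(1)[OF _ less_imp_le[OF z]] in auto)
  then show "kernel_sum z n c \<in> hardy_H2"
    by (intro pseries_in_hardy_H2[OF sq(1) eq])
  show "(\<integral>\<^sup>+\<zeta>. ennreal ((cmod (boundary_value (kernel_sum z n c) \<zeta>))\<^sup>2) \<partial>circle_measure) = ennreal (pick_form z n c)"
    using boundary_norm[OF sq(1) eq] by (simp add: sq(2))
qed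

text \<open>
  The interpolating combination of kernels is the orthogonal projection of \<open>pseries a\<close>, so its norm cannot be
  larger. In coefficients: \<open>pick_form\<close> is the inner product of the two series because they agree at the nodes, and
  \<open>2 Re(x cnj y) \<le> |x|\<^sup>2 + |y|\<^sup>2\<close> finishes the argument.
\<close>

lemma interpolant_pick_form_le:
  assumes z: "\<And>k. cmod (z k) < 1" and a: "summable (\<lambda>n. (cmod (a n))\<^sup>2)"
    and c: "\<And>i. i \<le> n \<Longrightarrow> kernel_sum z n c (z i) = pseries a (z i)"
  shows "pick_form z n c \<le> (\<Sum>m. (cmod (a m))\<^sup>2)"
proof -
  let ?b = "kernel_coeff z n c"
  have b: "(\<lambda>m. (cmod (?b m))\<^sup>2) sums pick_form z n c" by (rule kernel_coeff_square_sums[OF z])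
  have "(\<lambda>m. \<Sum>i\<le>n. cnj (c i) * (a m * z i ^ m)) sums (\<Sum>i\<le>n. cnj (c i) * pseries a (z i))"
    by (intro sums_sum sums_mult square_summable_pseries_sums a z)
  moreover have "(\<Sum>i\<le>n. cnj (c i) * (a m * z i ^ m)) = a m * cnj (?b m)" for m
    by (simp add: kernel_coeff_def sum_distrib_left mult_ac)
  ultimately have "(\<lambda>m. a m * cnj (?b m)) sums (\<Sum>i\<le>n. cnj (c i) * pseries a (z i))" by simp
  then have "(\<lambda>m. Re (a m * cnj (?b m))) sums Re (\<Sum>i\<le>n. cnj (c i) * pseries a (z i))" by (rule sums_Re)
  moreover have "Re (\<Sum>i\<le>n. cnj (c i) * pseries a (z i)) = pick_form z n c"
    unfolding pick_form_def by (intro arg_cong[where f=Re] sum.cong) (auto simp: c)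
  ultimately have inner: "(\<lambda>m. Re (a m * cnj (?b m))) sums pick_form z n c" by simp
  have upper: "(\<lambda>m. ((cmod (a m))\<^sup>2 + (cmod (?b m))\<^sup>2) / 2) sums (((\<Sum>m. (cmod (a m))\<^sup>2) + pick_form z n c) / 2)"
    by (intro sums_divide sums_add summable_sums a b)
  have "Re (a m * cnj (?b m)) \<le> ((cmod (a m))\<^sup>2 + (cmod (?b m))\<^sup>2) / 2" for m
    using Re_finner_le[of 1 "\<lambda>_. ?b m" "\<lambda>_. a m"] by (simp add: finner_def fnorm2_def algebra_simps)
  then have "pick_form z n c \<le> ((\<Sum>m. (cmod (a m))\<^sup>2) + pick_form z n c) / 2"
    by (rule sums_le[OF _ inner upper])
  then show ?thesis by simp
qed

lemma nn_integral_blaschke_measure: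
  assumes z: "\<And>k. z k \<in> ball 0 1" and g: "g \<in> borel_measurable unit_disk_borel"
  shows "(\<integral>\<^sup>+w. g w \<partial>blaschke_measure z)
    = (\<Sum>k. ennreal (1 / (cmod (deriv (blaschke_product z) (z k)))\<^sup>2) * g (z k))"
proof -
  let ?w = "\<lambda>k. ennreal (1 / (cmod (deriv (blaschke_product z) (z k)))\<^sup>2)"
  have "(\<integral>\<^sup>+w. g w \<partial>blaschke_measure z) = (\<integral>\<^sup>+k. g (z k) \<partial>point_measure UNIV ?w)"
    unfolding blaschke_measure_def
    by (rule nn_integral_distr) (use blaschke_measure_measurable[of z, OF z] g in simp_all)
  then show ?thesis
    by (simp add: point_measure_def nn_integral_density nn_integral_count_space_nat)
qed

lemma measurable_unit_disk_holomorphic: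
  assumes "f holomorphic_on ball 0 1"
  shows "(\<lambda>w. ennreal ((cmod (f w))\<^sup>2)) \<in> borel_measurable unit_disk_borel"
proof -
  have "f \<in> borel_measurable unit_disk_borel"
    unfolding unit_disk_borel_def
    by (rule borel_measurable_continuous_on_restrict[OF holomorphic_on_imp_continuous_on[OF assms]])
  then show ?thesis by measurable
qed

text \<open>
  For each \<open>n\<close> the projection onto the span of the first kernels gives the inequality with the finite masses. Fix
  finitely many nodes, let \<open>n\<close> tend to infinity, and then add nodes.
\<close>

lemma carleson_inequality_of_bound:
  assumes z: "\<And>k. cmod (z k) < 1" and inj: "inj z" and sum: "summable (\<lambda>k. 1 - cmod (z k))"
    and \<epsilon>: "0 < \<epsilon>" and bound: "\<And>n c. \<epsilon> * (\<Sum>i\<le>n. (cmod (c i))\<^sup>2) \<le> pick_form z n c"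
    and a: "summable (\<lambda>n. (cmod (a n))\<^sup>2)"
  shows "(\<Sum>k. ennreal (1 / (cmod (deriv (blaschke_product z) (z k)))\<^sup>2) * ennreal ((cmod (pseries a (z k)))\<^sup>2))
    \<le> ennreal (1 / \<epsilon> * (\<Sum>n. (cmod (a n))\<^sup>2))"
proof -
  let ?A = "\<Sum>n. (cmod (a n))\<^sup>2" and ?d = "\<lambda>k. cmod (deriv (blaschke_product z) (z k))"
  have fin: "(\<Sum>i\<le>n. (cmod (pseries a (z i)))\<^sup>2 / (cmod (blaschke_deriv z n i))\<^sup>2) \<le> 1 / \<epsilon> * ?A" for n
  proof -
    obtain c where c: "\<And>i. i \<le> n \<Longrightarrow> kernel_sum z n c (z i) = pseries a (z i)"
      using interpolating_kernel_sum[OF z inj, of n "\<lambda>i. pseries a (z i)"] by metis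
    have "\<epsilon> * (\<Sum>i\<le>n. (cmod (kernel_sum z n c (z i)))\<^sup>2 / (cmod (blaschke_deriv z n i))\<^sup>2) \<le> pick_form z n c"
      using pick_form_bound_iff[OF z inj, of \<epsilon> n] bound by blast
    also have "\<dots> \<le> ?A" by (rule interpolant_pick_form_le[OF z a c])
    finally show ?thesis using \<epsilon> by (simp add: c pos_le_divide_eq mult.commute)
  qed
  have part: "(\<Sum>k<N. (cmod (pseries a (z k)))\<^sup>2 / (?d k)\<^sup>2) \<le> 1 / \<epsilon> * ?A" for N
  proof (rule LIMSEQ_le_const2)
    show "(\<lambda>n. \<Sum>k<N. (cmod (pseries a (z k)))\<^sup>2 / (cmod (blaschke_deriv z n k))\<^sup>2)
        \<longlonglongrightarrow> (\<Sum>k<N. (cmod (pseries a (z k)))\<^sup>2 / (?d k)\<^sup>2)"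
      using deriv_blaschke_product_nonzero[OF z inj sum]
      by (intro tendsto_sum tendsto_divide tendsto_const tendsto_power blaschke_deriv_tendsto[OF z sum]) auto
    have "(\<Sum>k<N. (cmod (pseries a (z k)))\<^sup>2 / (cmod (blaschke_deriv z n k))\<^sup>2) \<le> 1 / \<epsilon> * ?A" if "N \<le> n" for n
    proof -
      have "(\<Sum>k<N. (cmod (pseries a (z k)))\<^sup>2 / (cmod (blaschke_deriv z n k))\<^sup>2)
          \<le> (\<Sum>k\<le>n. (cmod (pseries a (z k)))\<^sup>2 / (cmod (blaschke_deriv z n k))\<^sup>2)"
        by (rule sum_mono2) (use that in auto)
      also note fin[of n]
      finally show ?thesis .
    qed
    then show "\<exists>M. \<forall>n\<ge>M. (\<Sum>k<N. (cmod (pseries a (z k)))\<^sup>2 / (cmod (blaschke_deriv z n k))\<^sup>2) \<le> 1 / \<epsilon> * ?A"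
      by blast
  qed
  have "(\<Sum>k<N. ennreal (1 / (?d k)\<^sup>2) * ennreal ((cmod (pseries a (z k)))\<^sup>2)) \<le> ennreal (1 / \<epsilon> * ?A)" for N
  proof -
    have "(\<Sum>k<N. ennreal (1 / (?d k)\<^sup>2) * ennreal ((cmod (pseries a (z k)))\<^sup>2))
        = ennreal (\<Sum>k<N. (cmod (pseries a (z k)))\<^sup>2 / (?d k)\<^sup>2)"
      by (subst sum_ennreal[symmetric]) (auto simp: ennreal_mult[symmetric])
    then show ?thesis using part[of N] by (simp add: ennreal_leI)
  qed
  then show ?thesis by (intro suminf_le_const summableI) auto
qed

theorem theorem1:
  fixes z :: "nat \<Rightarrow> complex"
  assumes "\<And>k. z k \<in> ball 0 1"
    and "inj z"
    and "summable (\<lambda>k. 1 - cmod (z k))"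
  shows "regular_NP_zero_problem z \<longleftrightarrow> Carleson_measure (blaschke_measure z)"
proof -
  have z: "cmod (z k) < 1" for k using assms(1)[of k] by simp
  let ?\<nu> = "\<lambda>k. 1 / (cmod (deriv (blaschke_product z) (z k)))\<^sup>2"
  show ?thesis
    unfolding regular_iff_uniform_bound[OF z]
  proof
    assume "\<exists>\<epsilon>>0. \<forall>n c. \<epsilon> * (\<Sum>i\<le>n. (cmod (c i))\<^sup>2) \<le> pick_form z n c"
    then obtain \<epsilon> where \<epsilon>: "0 < \<epsilon>" "\<And>n c. \<epsilon> * (\<Sum>i\<le>n. (cmod (c i))\<^sup>2) \<le> pick_form z n c" by auto
    note carleson = carleson_inequality_of_bound[OF z assms(2,3) \<epsilon>]
    have "finite_measure (blaschke_measure z)"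
    proof
      \<comment> \<open>The constant function 1 as a test function bounds the total mass.\<close>
      define e where "e = (\<lambda>n::nat. if n = 0 then 1 else 0 :: complex)"
      have e: "summable (\<lambda>n. (cmod (e n))\<^sup>2)" by (rule summable_finite[of "{0}"]) (auto simp: e_def)
      have pe: "pseries e w = 1" for w
        using sums_single[of 0 "\<lambda>n. w ^ n"]
        by (auto simp: e_def pseries_def sums_iff if_distrib[of "\<lambda>x. x * _"] cong: if_cong)
      have "emeasure (blaschke_measure z) (space (blaschke_measure z)) = (\<integral>\<^sup>+w. 1 \<partial>blaschke_measure z)"
        by simp
      also have "\<dots> = (\<Sum>k. ennreal (?\<nu> k) * 1)"
        by (rule nn_integral_blaschke_measure[OF assms(1)]) simp
      also have "\<dots> \<le> ennreal (1 / \<epsilon> * (\<Sum>n. (cmod (e n))\<^sup>2))"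
        using carleson[OF e] by (simp add: pe)
      finally show "emeasure (blaschke_measure z) (space (blaschke_measure z)) \<noteq> \<infinity>"
        by (auto simp: top_unique)
    qed
    moreover have "(\<integral>\<^sup>+w. ennreal ((cmod (f w))\<^sup>2) \<partial>blaschke_measure z)
        \<le> ennreal (1 / \<epsilon>) * (\<integral>\<^sup>+\<zeta>. ennreal ((cmod (boundary_value f \<zeta>))\<^sup>2) \<partial>circle_measure)"
      if f: "f \<in> hardy_H2" for f
    proof -
      obtain a where a: "summable (\<lambda>n. (cmod (a n))\<^sup>2)" "\<And>w. cmod w < 1 \<Longrightarrow> f w = pseries a w"
        using hardy_H2_pseries[OF f] by metis
      have "(\<integral>\<^sup>+w. ennreal ((cmod (f w))\<^sup>2) \<partial>blaschke_measure z) = (\<Sum>k. ennreal (?\<nu> k) * ennreal ((cmod (f (z k)))\<^sup>2))"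
        by (rule nn_integral_blaschke_measure[OF assms(1)], rule measurable_unit_disk_holomorphic)
           (use f in \<open>simp add: hardy_H2_def\<close>)
      also have "\<dots> \<le> ennreal (1 / \<epsilon> * (\<Sum>n. (cmod (a n))\<^sup>2))"
        using carleson[OF a(1)] by (simp add: a(2) z)
      also have "\<dots> = ennreal (1 / \<epsilon>) * (\<integral>\<^sup>+\<zeta>. ennreal ((cmod (boundary_value f \<zeta>))\<^sup>2) \<partial>circle_measure)"
      proof -
        have "0 \<le> (\<Sum>n. (cmod (a n))\<^sup>2)" by (rule suminf_nonneg[OF a(1)]) simp
        then have "ennreal (1 / \<epsilon> * (\<Sum>n. (cmod (a n))\<^sup>2)) = ennreal (1 / \<epsilon>) * ennreal (\<Sum>n. (cmod (a n))\<^sup>2)"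
          using \<epsilon>(1) by (intro ennreal_mult) auto
        then show ?thesis by (simp only: boundary_norm[OF a])
      qed
      finally show ?thesis .
    qed
    moreover have "sets (blaschke_measure z) = sets unit_disk_borel"
      by (simp add: blaschke_measure_def)
    ultimately show "Carleson_measure (blaschke_measure z)"
      unfolding Carleson_measure_def using \<epsilon>(1) by (intro conjI exI[of _ "1 / \<epsilon>"]) auto
  next
    assume "Carleson_measure (blaschke_measure z)"
    then obtain C where C: "0 < C" "\<And>f. f \<in> hardy_H2 \<Longrightarrow> (\<integral>\<^sup>+w. ennreal ((cmod (f w))\<^sup>2) \<partial>blaschke_measure z)
        \<le> ennreal C * (\<integral>\<^sup>+\<zeta>. ennreal ((cmod (boundary_value f \<zeta>))\<^sup>2) \<partial>circle_measure)"
      by (auto simp: Carleson_measure_def)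
    have key: "1 / C * (\<Sum>i\<le>n. (cmod (kernel_sum z n c (z i)))\<^sup>2 / (cmod (blaschke_deriv z n i))\<^sup>2) \<le> pick_form z n c" for n c
    proof -
      let ?f = "kernel_sum z n c"
      have pf: "0 \<le> pick_form z n c"
        by (rule sums_le[OF _ sums_zero kernel_coeff_square_sums[OF z]]) simp
      have "(\<Sum>i\<le>n. (cmod (?f (z i)))\<^sup>2 / (cmod (blaschke_deriv z n i))\<^sup>2) \<le> (\<Sum>i\<le>n. ?\<nu> i * (cmod (?f (z i)))\<^sup>2)"
      proof (rule sum_mono)
        fix i assume "i \<in> {..n}"
        then have "(cmod (deriv (blaschke_product z) (z i)))\<^sup>2 \<le> (cmod (blaschke_deriv z n i))\<^sup>2"
          by (intro power_mono norm_deriv_blaschke_product_le[OF z assms(3)]) auto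
        then show "(cmod (?f (z i)))\<^sup>2 / (cmod (blaschke_deriv z n i))\<^sup>2 \<le> ?\<nu> i * (cmod (?f (z i)))\<^sup>2"
          using deriv_blaschke_product_nonzero[OF z assms(2,3), of i] by (simp add: frac_le)
      qed
      then have "ennreal (\<Sum>i\<le>n. (cmod (?f (z i)))\<^sup>2 / (cmod (blaschke_deriv z n i))\<^sup>2)
          \<le> ennreal (\<Sum>i\<le>n. ?\<nu> i * (cmod (?f (z i)))\<^sup>2)" by (rule ennreal_leI)
      also have "\<dots> = (\<Sum>i\<le>n. ennreal (?\<nu> i) * ennreal ((cmod (?f (z i)))\<^sup>2))"
        by (subst sum_ennreal[symmetric]) (auto simp: ennreal_mult[symmetric])
      also have "\<dots> \<le> (\<Sum>k. ennreal (?\<nu> k) * ennreal ((cmod (?f (z k)))\<^sup>2))"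
        by (rule sum_le_suminf) auto
      also have "\<dots> = (\<integral>\<^sup>+w. ennreal ((cmod (?f w))\<^sup>2) \<partial>blaschke_measure z)"
        by (rule nn_integral_blaschke_measure[OF assms(1), symmetric], rule measurable_unit_disk_holomorphic)
           (use kernel_sum_hardy_H2(1)[OF z] in \<open>simp add: hardy_H2_def\<close>)
      also have "\<dots> \<le> ennreal C * ennreal (pick_form z n c)"
        using C(2)[OF kernel_sum_hardy_H2(1)[OF z]] by (simp add: kernel_sum_hardy_H2(2)[OF z])
      finally have "(\<Sum>i\<le>n. (cmod (?f (z i)))\<^sup>2 / (cmod (blaschke_deriv z n i))\<^sup>2) \<le> C * pick_form z n c"
        using C(1) pf by (simp add: ennreal_mult[symmetric])
      then show ?thesis using C(1) by (simp add: pos_divide_le_eq mult.commute)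
    qed
    have "1 / C * (\<Sum>i\<le>n. (cmod (c i))\<^sup>2) \<le> pick_form z n c" for n c
      using pick_form_bound_iff[OF z assms(2), of "1 / C" n] key by blast
    then show "\<exists>\<epsilon>>0. \<forall>n c. \<epsilon> * (\<Sum>i\<le>n. (cmod (c i))\<^sup>2) \<le> pick_form z n c"
      using C(1) by (intro exI[of _ "1 / C"]) auto
  qed
qed

end
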